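(* Let $B$ be a finite connected $d$-regular graph with $d\ge3$. Then for every integer $j>0$ there exist $\epsilon>0$, $C>0$ and an integer $r$ such that: (1) if $B$ is not bipartite, the probability that $G\in\mathcal C_n(B)$ contains no connected component with fewer than $r$ vertices and has $|\lambda_i(G)|\ge d-\epsilon$ for some $i>1$ is at most $Cn^{-j}$; (2) if $B$ is bipartite, the same holds with the condition "$i>1$" replaced by "$i\ne 1,|V_G|$".
   Context: Graphs allow multiple edges, whole-loops and half-loops; the degree of a vertex is the number of directed edges with it as tail; $A_G$ is the adjacency matrix and $\lambda_1(G)\ge\lambda_2(G)\ge\cdots\ge\lambda_{|V_G|}(G)$ are its eigenvalues. $\mathcal C_n(B)$: for a permutation assignment $\sigma:E^{\mathrm{dir}}_B\to S_n$ ($\sigma(\iota e)=\sigma(e)^{-1}$), $B[\sigma]$ has vertices $V_B\times[n]$, directed edges $E^{\mathrm{dir}}_B\times[n]$, $t(e,i)=(t(e),i)$, $h(e,i)=(h(e),\sigma(e)i)$, $\iota(e,i)=(\iota e,\sigma(e)i)$; the $\sigma(e)$ are independent apart from $\sigma(\iota e)=\sigma(e)^{-1}$, uniform on $S_n$ for non-half-loops, and for a half-loop a uniform fixed-point-free involution ($n$ even) or uniform involution with exactly one fixed point ($n$ odd). *)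

theory Defs
  imports "Jordan_Normal_Form.Char_Poly" "HOL-Combinatorics.Permutations" "HOL-Library.Multiset"
begin

text \<open>Graphs in the sense of the paper: a set of vertices, a set of directed edges,
  tail and head maps, and an involution on directed edges (a directed edge fixed by
  the involution is a half-loop; a pair of distinct directed edges u->u is a whole-loop).\<close>

record ('v, 'e) mgraph =
  verts :: "'v set"
  darts :: "'e set"
  tl :: "'e \<Rightarrow> 'v"
  hd :: "'e \<Rightarrow> 'v"
  rev :: "'e \<Rightarrow> 'e"

definition wf_graph :: "('v, 'e) mgraph \<Rightarrow> bool" where
  "wf_graph G \<longleftrightarrow> finite (verts G) \<and> finite (darts G) \<and>
     (\<forall>e \<in> darts G. tl G e \<in> verts G \<and> hd G e \<in> verts G \<and> rev G e \<in> darts G \<and>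
        rev G (rev G e) = e \<and> tl G (rev G e) = hd G e)"

definition degree :: "('v, 'e) mgraph \<Rightarrow> 'v \<Rightarrow> nat" where
  "degree G v = card {e \<in> darts G. tl G e = v}"

definition regular :: "('v, 'e) mgraph \<Rightarrow> nat \<Rightarrow> bool" where
  "regular G d \<longleftrightarrow> (\<forall>v \<in> verts G. degree G v = d)"

definition adj :: "('v, 'e) mgraph \<Rightarrow> 'v \<Rightarrow> 'v \<Rightarrow> bool" where
  "adj G u v \<longleftrightarrow> (\<exists>e \<in> darts G. tl G e = u \<and> hd G e = v)"

definition connected_graph :: "('v, 'e) mgraph \<Rightarrow> bool" where
  "connected_graph G \<longleftrightarrow> verts G \<noteq> {} \<and> (\<forall>u \<in> verts G. \<forall>v \<in> verts G. (adj G)\<^sup>*\<^sup>* u v)"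

definition component :: "('v, 'e) mgraph \<Rightarrow> 'v \<Rightarrow> 'v set" where
  "component G u = {v. (adj G)\<^sup>*\<^sup>* u v}"

definition bipartite :: "('v, 'e) mgraph \<Rightarrow> bool" where
  "bipartite G \<longleftrightarrow> (\<exists>S \<subseteq> verts G. \<forall>e \<in> darts G. (tl G e \<in> S \<longleftrightarrow> hd G e \<notin> S))"

text \<open>A fixed enumeration of the vertices, used to index the adjacency matrix
  (the spectrum does not depend on the choice).\<close>
definition vert_list :: "('v, 'e) mgraph \<Rightarrow> 'v list" where
  "vert_list G = (SOME xs. distinct xs \<and> set xs = verts G)"

definition adj_mat :: "('v, 'e) mgraph \<Rightarrow> real mat" where
  "adj_mat G = (let vs = vert_list G in
     mat (length vs) (length vs)
       (\<lambda>(i, j). real (card {e \<in> darts G. tl G e = vs ! i \<and> hd G e = vs ! j})))"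

text \<open>Eigenvalues with multiplicity, in non-increasing order:
  index 0 is lambda_1, index |V|-1 is lambda_|V|.\<close>
definition eigs :: "('v, 'e) mgraph \<Rightarrow> real list" where
  "eigs G = List.rev (sorted_list_of_multiset (proots (char_poly (adj_mat G))))"

definition lift :: "('v, 'e) mgraph \<Rightarrow> nat \<Rightarrow> ('e \<Rightarrow> nat \<Rightarrow> nat) \<Rightarrow> ('v \<times> nat, 'e \<times> nat) mgraph" where
  "lift B n \<sigma> = \<lparr> verts = verts B \<times> {..<n}, darts = darts B \<times> {..<n},
     tl = (\<lambda>(e, i). (tl B e, i)), hd = (\<lambda>(e, i). (hd B e, \<sigma> e i)),
     rev = (\<lambda>(e, i). (rev B e, \<sigma> e i)) \<rparr>"

text \<open>Admissible permutation assignments: sigma(iota e) = sigma(e)^{-1}; half-loops get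
  involutions with exactly (n mod 2) fixed points; sigma is the identity off the edge set.
  The uniform distribution on this set is exactly the product distribution of the paper
  (independent over pairs {e, iota e}, uniform on S_n resp. on the relevant involutions).\<close>
definition lift_assignments :: "('v, 'e) mgraph \<Rightarrow> nat \<Rightarrow> ('e \<Rightarrow> nat \<Rightarrow> nat) set" where
  "lift_assignments B n = {\<sigma>.
     (\<forall>e \<in> darts B. \<sigma> e permutes {..<n} \<and> \<sigma> (rev B e) = Hilbert_Choice.inv (\<sigma> e) \<and>
        (rev B e = e \<longrightarrow> \<sigma> e \<circ> \<sigma> e = id \<and> card {i \<in> {..<n}. \<sigma> e i = i} = n mod 2)) \<and>
     (\<forall>e. e \<notin> darts B \<longrightarrow> \<sigma> e = id)}"

definition prob_lift :: "('v, 'e) mgraph \<Rightarrow> nat \<Rightarrow> (('v \<times> nat, 'e \<times> nat) mgraph \<Rightarrow> bool) \<Rightarrow> real" where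
  "prob_lift B n P = real (card {\<sigma> \<in> lift_assignments B n. P (lift B n \<sigma>)}) / real (card (lift_assignments B n))"

end

theory Submission
  imports Defs "HOL-Real_Asymp.Real_Asymp"
begin

text \<open>If \<open>G\<close> has an eigenvalue near \<open>d\<close> whose eigenvector is orthogonal to the constants, a Cheeger
  sweep of its positive part gives a nonempty set \<open>U\<close> of at most half of the vertices with few edges
  leaving it. As \<open>B\<close> is connected, all the sections \<open>U\<^sub>v \<subseteq> {..<n}\<close> then have nearly the same size \<open>k\<close>, and
  each \<open>\<sigma>(e)\<close> maps almost all of \<open>U\<^sub>u\<close> into \<open>U\<^sub>v\<close>, which has probability about \<open>(n choose k) powr (-1/2)\<close>
  per directed edge. There are about \<open>n choose k\<close> choices of each section, so every vertex contributes
  a factor \<open>(n choose k) powr (1 - d/2)\<close> to the union bound. Since \<open>d \<ge> 3\<close>, this beats \<open>n powr (-j)\<close> once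
  \<open>k\<close> exceeds a constant. A set \<open>U\<close> below that size has an edge leaving it unless it contains a component,
  so it is excluded by the lower bound on component sizes.

  For an eigenvalue near \<open>-d\<close> and \<open>B\<close> not bipartite, the same argument runs on the bipartite double
  cover of \<open>B\<close>, which is connected; a vertex now carries two disjoint sections \<open>S\<^sub>v\<close>, \<open>T\<^sub>v\<close> that the
  permutations interchange, and binomial coefficients become trinomial ones.\<close>

section \<open>Counting permutations and involutions\<close>

text \<open>The bound is charged to directed edges so that half-loops, which supply only one, fit
  in. A random permutation carries a given pair of disjoint sets to another one with probability
  about \<open>1 / multinom3\<close>, split evenly between the two directions of an edge. A random
  matching preserves a set, or interchanges two sets, with probability about the square root of
  that, which is what a half-loop must pay. The union bound then becomes a product over vertices,
  each with exactly \<open>d\<close> equal factors. The image of a section is only almost contained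
  in the target section. This is made exact by letting every directed edge name the subset of its
  tail section that stays inside \<open>U\<close>; because of \<open>slack\<close>, the number of
  such subsets is a small power of the binomial coefficient. For bipartite \<open>B\<close> the
  double cover is disconnected and the argument near \<open>-d\<close> breaks down. There the sign
  vector is a second known eigenvector: multiplying an eigenfunction by it negates the eigenvalue
  and turns orthogonality to the sign vector into zero sum, so only eigenvalues near
  \<open>d\<close> remain.\<close>

lemma restrict_id_permutes:
  assumes "\<tau> permutes A" "F \<subseteq> A" "\<tau> ` F = F"
  shows "restrict_id \<tau> F permutes F"
proof -
  have "bij_betw \<tau> F F"
    using assms by (metis bij_betw_def inj_on_subset permutes_inj subset_UNIV)
  thus ?thesis by (rule permutes_restrict_id)
qed

lemma permutes_image_Diff:
  assumes "\<tau> permutes A" "\<tau> ` F = G"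
  shows "\<tau> ` (A - F) = A - G"
  using assms by (metis image_set_diff permutes_image permutes_inj)

lemma permutes_eqI:
  assumes "s permutes A" "t permutes A" "\<And>x. x \<in> A \<Longrightarrow> s x = t x"
  shows "s = t"
  using assms by (metis ext permutes_not_in)

lemma restrict_id_eqD: "restrict_id s F = restrict_id t F \<Longrightarrow> x \<in> F \<Longrightarrow> s x = t x"
  by (metis restrict_id_simps(1))

lemma card_Diff_two_subsets:
  assumes "finite A" "F \<subseteq> A" "F' \<subseteq> A" "F \<inter> F' = {}"
  shows "card (A - F - F') = card A - card F - card F'"
proof -
  have "finite F" "finite F'" using assms by (auto intro: finite_subset)
  moreover have "F' \<subseteq> A - F" using assms by auto
  ultimately show ?thesis using assms by (simp add: card_Diff_subset)
qed

text \<open>A permutation that preserves both sets is determined by its restrictions to them and to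
  the remaining points.\<close>

lemma card_permutes_fixing_two_sets:
  assumes fin: "finite A" and F: "F \<subseteq> A" and F': "F' \<subseteq> A" and disj: "F \<inter> F' = {}"
  shows "card {\<tau>. \<tau> permutes A \<and> \<tau> ` F = F \<and> \<tau> ` F' = F'}
           \<le> fact (card F) * fact (card F') * fact (card A - card F - card F')"
proof -
  let ?Z = "{\<tau>. \<tau> permutes A \<and> \<tau> ` F = F \<and> \<tau> ` F' = F'}"
  let ?R = "A - F - F'"
  let ?f = "\<lambda>\<tau>. (restrict_id \<tau> F, restrict_id \<tau> F', restrict_id \<tau> ?R)"
  let ?T = "{p. p permutes F} \<times> {p. p permutes F'} \<times> {p. p permutes ?R}"
  have inj: "inj_on ?f ?Z"
  proof (rule inj_onI)
    fix s t assume s: "s \<in> ?Z" and t: "t \<in> ?Z" and eq: "?f s = ?f t"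
    show "s = t"
      using s t eq by (intro permutes_eqI[of s A t]) (auto dest: restrict_id_eqD)
  qed
  have sub: "?f ` ?Z \<subseteq> ?T"
  proof
    fix y assume "y \<in> ?f ` ?Z"
    then obtain t where t: "t permutes A" "t ` F = F" "t ` F' = F'" and y: "y = ?f t" by auto
    have R: "t ` ?R = ?R" using t
      by (metis image_set_diff permutes_image permutes_inj)
    show "y \<in> ?T" unfolding y
      using restrict_id_permutes[OF t(1) F t(2)] restrict_id_permutes[OF t(1) F' t(3)]
        restrict_id_permutes[OF t(1) _ R] by auto
  qed
  have fT: "finite ?T" using fin F F' by (auto intro!: finite_permutations intro: finite_subset)
  have "card ?R = card A - card F - card F'" by (rule card_Diff_two_subsets[OF assms])
  moreover have "card ?T = fact (card F) * fact (card F') * fact (card ?R)"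
    using fin F F' by (simp add: card_cartesian_product card_permutations finite_subset)
  ultimately show ?thesis using card_inj_on_le[OF inj sub fT] by simp
qed

text \<open>Composing with the inverse of one such permutation \<open>t\<close> embeds the set into
  the stabiliser of \<open>F\<close> and \<open>F'\<close>, so the bound is independent of the
  targets \<open>X\<close> and \<open>Y\<close>.\<close>

lemma card_permutes_mapping_two_sets:
  assumes fin: "finite A" and F: "F \<subseteq> A" and F': "F' \<subseteq> A" and disj: "F \<inter> F' = {}"
  shows "card {\<tau>. \<tau> permutes A \<and> \<tau> ` F = X \<and> \<tau> ` F' = Y}
           \<le> fact (card F) * fact (card F') * fact (card A - card F - card F')"
proof (cases "{\<tau>. \<tau> permutes A \<and> \<tau> ` F = X \<and> \<tau> ` F' = Y} = {}")
  case False
  let ?Z = "{\<tau>. \<tau> permutes A \<and> \<tau> ` F = X \<and> \<tau> ` F' = Y}"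
  let ?W = "{\<tau>. \<tau> permutes A \<and> \<tau> ` F = F \<and> \<tau> ` F' = F'}"
  obtain t where t: "t permutes A" "t ` F = X" "t ` F' = Y" using False by auto
  let ?f = "\<lambda>s. Hilbert_Choice.inv t \<circ> s"
  have bij: "bij t" using t(1) by (rule permutes_bij)
  have inj: "inj_on ?f ?Z"
  proof (rule inj_onI)
    fix s u :: "'a \<Rightarrow> 'a" assume "s \<in> ?Z" "u \<in> ?Z" "?f s = ?f u"
    hence "t \<circ> ?f s = t \<circ> ?f u" by simp
    thus "s = u" using bij by (simp add: o_assoc[symmetric] fun_eq_iff bij_is_surj surj_f_inv_f)
  qed
  have sub: "?f ` ?Z \<subseteq> ?W"
  proof (rule image_subsetI)
    fix s assume "s \<in> ?Z"
    hence "s permutes A" "s ` F = X" "s ` F' = Y" by auto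
    hence "Hilbert_Choice.inv t \<circ> s permutes A \<and> (Hilbert_Choice.inv t \<circ> s) ` F = F \<and> (Hilbert_Choice.inv t \<circ> s) ` F' = F'"
      using t bij by (metis bij_is_inj image_comp image_inv_f_f permutes_compose permutes_inv)
    thus "?f s \<in> ?W" by simp
  qed
  have "finite ?W" by (rule finite_subset[OF _ finite_permutations[OF fin]]) auto
  from card_inj_on_le[OF inj sub this] card_permutes_fixing_two_sets[OF assms] show ?thesis by linarith
next
  case True thus ?thesis by (metis card.empty le0)
qed

section \<open>Perfect and near-perfect matchings\<close>

definition minfix_invols :: "'a set \<Rightarrow> ('a \<Rightarrow> 'a) set" where
  "minfix_invols A = {\<tau>. \<tau> permutes A \<and> \<tau> \<circ> \<tau> = id \<and> card {i \<in> A. \<tau> i = i} = card A mod 2}"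

text \<open>The product of the odd numbers up to \<open>n\<close>, that is \<open>(n - 1)!!\<close>
  for even \<open>n\<close> and \<open>n!!\<close> for odd \<open>n\<close>: the number of matchings
  of \<open>n\<close> points that miss \<open>n mod 2\<close> points.\<close>

fun odd_fact :: "nat \<Rightarrow> nat" where
  "odd_fact 0 = 1"
| "odd_fact (Suc n) = (if even n then Suc n * odd_fact n else odd_fact n)"

lemma finite_minfix_invols: "finite A \<Longrightarrow> finite (minfix_invols A)"
  by (rule finite_subset[OF _ finite_permutations[of A]]) (auto simp: minfix_invols_def)

text \<open>The points that move fall into two-element orbits \<open>{i, \<tau> i}\<close>, so their
  number is even.\<close>

lemma invol_card_fixed_parity:
  assumes fin: "finite A" and t: "\<tau> permutes A" "\<tau> \<circ> \<tau> = id"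
  shows "card {i \<in> A. \<tau> i = i} mod 2 = card A mod 2"
proof -
  let ?N = "{i \<in> A. \<tau> i \<noteq> i}"
  let ?C = "(\<lambda>i. {i, \<tau> i}) ` ?N"
  have tt: "\<tau> (\<tau> i) = i" for i using t(2) by (metis comp_apply id_apply)
  have un: "\<Union>?C = ?N"
  proof
    show "\<Union>?C \<subseteq> ?N" using t(1) tt by (auto simp: permutes_in_image)
    show "?N \<subseteq> \<Union>?C" by auto
  qed
  have "2 dvd card (\<Union>?C)"
  proof (rule dvd_partition)
    show "finite (\<Union> ?C)" unfolding un using fin by auto
    show "\<forall>c\<in>?C. 2 dvd card c" by auto
    show "\<forall>c1\<in>?C. \<forall>c2\<in>?C. c1 \<noteq> c2 \<longrightarrow> c1 \<inter> c2 = {}"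
    proof (intro ballI impI equals0I)
      fix c1 c2 x assume c: "c1 \<in> ?C" "c2 \<in> ?C" "c1 \<noteq> c2" "x \<in> c1 \<inter> c2"
      then obtain i j where ij: "c1 = {i, \<tau> i}" "c2 = {j, \<tau> j}" by auto
      have *: "{k, \<tau> k} = {x, \<tau> x}" if "x \<in> {k, \<tau> k}" for k
      proof (cases "x = k")
        case False
        hence "\<tau> k = x" using that by auto
        moreover have "\<tau> x = k" using tt[of k] \<open>\<tau> k = x\<close> by simp
        ultimately show ?thesis by auto
      qed simp
      have m: "x \<in> {i, \<tau> i}" "x \<in> {j, \<tau> j}" using c(4) ij by simp_all
      note *[OF m(1)] *[OF m(2)]
      hence "c1 = c2" using ij *[OF m(1)] by simp
      thus False using c by blast
    qed
  qed
  hence ev: "even (card ?N)" by (simp add: un)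
  have "A = {i \<in> A. \<tau> i = i} \<union> ?N" by auto
  hence "card A = card {i \<in> A. \<tau> i = i} + card ?N"
    using fin by (metis (no_types, lifting) card_Un_disjoint finite_Un mem_Collect_eq disjoint_iff)
  thus ?thesis using ev by presburger
qed

lemma minfix_invols_fixing_point:
  assumes fin: "finite A" and x: "x \<in> A" and odd: "odd (card A)"
  shows "{\<tau> \<in> minfix_invols A. \<tau> x = x} = minfix_invols (A - {x})"
proof -
  have cA: "card (A - {x}) mod 2 = 0" using odd fin x by simp
  have per: "\<tau> permutes A \<and> \<tau> x = x \<longleftrightarrow> \<tau> permutes (A - {x})" for \<tau> :: "'a \<Rightarrow> 'a"
    using x by (auto simp: permutes_def; metis)
  have fx: "card {i \<in> A. \<tau> i = i} = 1 \<longleftrightarrow> card {i \<in> A - {x}. \<tau> i = i} = 0" if "\<tau> x = x" for \<tau>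
  proof -
    have "{i \<in> A. \<tau> i = i} = insert x {i \<in> A - {x}. \<tau> i = i}" using that x by auto
    thus ?thesis using fin by simp
  qed
  show ?thesis unfolding minfix_invols_def using cA odd per fx
    by (auto simp: odd_iff_mod_2_eq_one permutes_not_in)
qed

text \<open>Classify by the unique fixed point \<open>x\<close>; deleting it leaves a perfect
  matching of \<open>A - {x}\<close>.\<close>

lemma card_minfix_invols_odd_step:
  assumes fin: "finite A" and odd: "odd (card A)"
    and k: "\<And>x. x \<in> A \<Longrightarrow> card (minfix_invols (A - {x})) = k"
  shows "card (minfix_invols A) = card A * k"
proof -
  have eq: "minfix_invols A = (\<Union>x\<in>A. minfix_invols (A - {x}))" (is "_ = ?U")
  proof
    show "?U \<subseteq> minfix_invols A" using minfix_invols_fixing_point[OF fin _ odd] by blast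
    show "minfix_invols A \<subseteq> ?U"
    proof
      fix t assume t: "t \<in> minfix_invols A"
      hence "card {i \<in> A. t i = i} = 1" using odd by (auto simp: minfix_invols_def odd_iff_mod_2_eq_one)
      then obtain x where "x \<in> A" "t x = x" by (metis (mono_tags, lifting) card_1_singletonE insertI1 mem_Collect_eq)
      thus "t \<in> ?U" using minfix_invols_fixing_point[OF fin _ odd] t by blast
    qed
  qed
  have "card ?U = (\<Sum>x\<in>A. card (minfix_invols (A - {x})))"
  proof (rule card_UN_disjoint[OF fin])
    show "\<forall>i\<in>A. finite (minfix_invols (A - {i}))" using fin by (auto intro: finite_minfix_invols)
    show "\<forall>i\<in>A. \<forall>j\<in>A. i \<noteq> j \<longrightarrow> minfix_invols (A - {i}) \<inter> minfix_invols (A - {j}) = {}"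
    proof (intro ballI impI equals0I)
      fix i j t assume ij: "i \<in> A" "j \<in> A" "i \<noteq> j" and t: "t \<in> minfix_invols (A - {i}) \<inter> minfix_invols (A - {j})"
      hence "t \<in> minfix_invols A" "t i = i" "t j = j" using minfix_invols_fixing_point[OF fin _ odd] by blast+
      hence c: "card {i \<in> A. t i = i} = 1" using odd by (auto simp: minfix_invols_def odd_iff_mod_2_eq_one)
      then obtain z where "{i \<in> A. t i = i} = {z}" by (rule card_1_singletonE)
      moreover have "i \<in> {i \<in> A. t i = i}" "j \<in> {i \<in> A. t i = i}" using ij \<open>t i = i\<close> \<open>t j = j\<close> by simp_all
      ultimately have "i = z" "j = z" by (metis singletonD)+
      thus False using ij by simp
    qed
  qed
  thus ?thesis using eq k by simp
qed

text \<open>Composing with the transposition of \<open>x\<close> and \<open>y\<close> erases this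
  matched pair: both points become fixed and drop out of the carrier. The same composition restores
  the pair, so it serves as its own inverse.\<close>

lemma minfix_invols_swapping:
  assumes fin: "finite A" and x: "x \<in> A" "y \<in> A" "x \<noteq> y"
  shows "card {\<tau> \<in> minfix_invols A. \<tau> x = y} = card (minfix_invols (A - {x, y}))"
proof -
  let ?s = "Transposition.transpose x y"
  let ?f = "\<lambda>\<tau>. \<tau> \<circ> ?s"
  have cA: "card (A - {x, y}) mod 2 = card A mod 2"
  proof -
    have "card {x,y} \<le> card A" using fin x by (intro card_mono) auto
    moreover have "card (A - {x, y}) = card A - card {x,y}" using fin x by (intro card_Diff_subset) auto
    moreover have "card {x, y} = 2" using x(3) by simp
    ultimately show ?thesis by (simp add: le_mod_geq)
  qed
  have 1: "t \<circ> ?s \<in> minfix_invols (A - {x, y})" if t: "t \<in> minfix_invols A" "t x = y" for t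
  proof -
    have tt: "t (t i) = i" for i using t(1) by (simp add: minfix_invols_def) (metis comp_apply id_apply)
    have ty: "t y = x" using tt t(2) by metis
    have tp: "t permutes A" using t by (simp add: minfix_invols_def)
    have val: "(t \<circ> ?s) i = (if i = x \<or> i = y then i else t i)" for i
      using t(2) ty by (auto simp: transpose_def)
    have "(t \<circ> ?s) permutes A" using tp x by (intro permutes_compose permutes_swap_id) auto
    hence "(t \<circ> ?s) permutes (A - {x,y})"
      by (rule permutes_superset) (use val in auto)
    moreover have "(t \<circ> ?s) \<circ> (t \<circ> ?s) = id"
    proof
      fix i show "((t \<circ> ?s) \<circ> (t \<circ> ?s)) i = id i"
        using val tt t(2) ty by (simp only: comp_apply[of "t \<circ> ?s" "t \<circ> ?s"] val) (auto, metis+)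
    qed
    moreover have "{i \<in> A - {x,y}. (t \<circ> ?s) i = i} = {i \<in> A. t i = i}"
      using val t(2) ty x(3) by (auto simp del: comp_apply)
    ultimately show ?thesis using t(1) cA by (simp add: minfix_invols_def)
  qed
  have 2: "u \<circ> ?s \<in> minfix_invols A \<and> (u \<circ> ?s) x = y" if u: "u \<in> minfix_invols (A - {x, y})" for u
  proof -
    have uu: "u (u i) = i" for i using u by (simp add: minfix_invols_def) (metis comp_apply id_apply)
    have up: "u permutes (A - {x,y})" using u by (simp add: minfix_invols_def)
    have ux: "u x = x" "u y = y" using up by (auto simp: permutes_def)
    have val: "(u \<circ> ?s) i = (if i = x then y else if i = y then x else u i)" for i
      using ux by (auto simp: transpose_def)
    have "u permutes A" using up by (rule permutes_subset) auto
    hence "(u \<circ> ?s) permutes A" using x by (intro permutes_compose permutes_swap_id) auto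
    moreover have "(u \<circ> ?s) \<circ> (u \<circ> ?s) = id"
    proof
      fix i
      have "u i = x \<longrightarrow> i = x" "u i = y \<longrightarrow> i = y" using uu ux by metis+
      thus "((u \<circ> ?s) \<circ> (u \<circ> ?s)) i = id i"
        using uu ux by (simp only: comp_apply[of "u \<circ> ?s" "u \<circ> ?s"] val) auto
    qed
    moreover have "{i \<in> A - {x,y}. u i = i} = {i \<in> A. (u \<circ> ?s) i = i}"
      using val ux x(3) by (auto simp del: comp_apply)
    ultimately show ?thesis using u cA val[of x] by (simp add: minfix_invols_def del: comp_apply)
  qed
  have "bij_betw ?f {\<tau> \<in> minfix_invols A. \<tau> x = y} (minfix_invols (A - {x, y}))"
    by (rule bij_betw_byWitness[where f' = ?f]) (use 1 2 in \<open>auto simp: o_assoc[symmetric] simp del: comp_apply\<close>)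
  thus ?thesis by (rule bij_betw_same_card)
qed

lemma card_minfix_invols_even_step:
  assumes fin: "finite A" and ev: "even (card A)" and x: "x \<in> A"
    and k: "\<And>y. y \<in> A - {x} \<Longrightarrow> card (minfix_invols (A - {x, y})) = k"
  shows "card (minfix_invols A) = (card A - 1) * k"
proof -
  have eq: "minfix_invols A = (\<Union>y\<in>A - {x}. {\<tau> \<in> minfix_invols A. \<tau> x = y})" (is "_ = ?U")
  proof
    show "minfix_invols A \<subseteq> ?U"
    proof
      fix t assume t: "t \<in> minfix_invols A"
      hence "card {i \<in> A. t i = i} = 0" using ev by (auto simp: minfix_invols_def)
      hence "t x \<noteq> x" using x fin by auto
      moreover have "t x \<in> A" using t x by (auto simp: minfix_invols_def permutes_in_image)
      ultimately show "t \<in> ?U" using t by auto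
    qed
  qed auto
  have "card ?U = (\<Sum>y\<in>A - {x}. card {\<tau> \<in> minfix_invols A. \<tau> x = y})"
    using fin by (intro card_UN_disjoint) (auto intro: finite_subset[OF _ finite_minfix_invols[OF fin]])
  also have "\<dots> = (\<Sum>y\<in>A - {x}. k)"
    using minfix_invols_swapping[OF fin x] k by (intro sum.cong) auto
  also have "\<dots> = (card A - 1) * k" using fin x by simp
  finally show ?thesis using eq by simp
qed

lemma card_minfix_invols: "finite A \<Longrightarrow> card (minfix_invols A) = odd_fact (card A)"
proof (induction "card A" arbitrary: A rule: less_induct)
  case less
  show ?case
  proof (cases "A = {}")
    case True
    have "minfix_invols ({} :: 'a set) = {id}" by (auto simp: minfix_invols_def)
    thus ?thesis using True by simp
  next
    case False
    then obtain x where x: "x \<in> A" by auto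
    hence pos: "card A > 0" using less.prems by (auto simp: card_gt_0_iff)
    show ?thesis
    proof (cases "odd (card A)")
      case True
      have "card (minfix_invols A) = card A * odd_fact (card A - 1)"
        using less True pos by (intro card_minfix_invols_odd_step) auto
      thus ?thesis using True pos by (cases "card A") auto
    next
      case False
      have c: "card (A - {x, y}) = card A - 2" if "y \<in> A - {x}" for y
        using that x less.prems by (subst card_Diff_subset) auto
      have "card (minfix_invols A) = (card A - 1) * odd_fact (card A - 2)"
        using less.prems False pos x c by (intro card_minfix_invols_even_step[where x = x]) (auto simp: less.hyps)
      moreover obtain m where "card A = Suc (Suc m)" using False pos by (metis even_Suc even_zero gr0_implies_Suc not0_implies_Suc)
      ultimately show ?thesis using False by auto
    qed
  qed
qed

text \<open>The restrictions to \<open>F\<close> and to its complement have at most one fixed point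
  in total, so parity forces each of them to have the least possible number. Both are therefore
  matchings of the same kind on smaller sets.\<close>

lemma card_minfix_invols_fixing_set:
  assumes fin: "finite A" and F: "F \<subseteq> A"
  shows "card {\<tau> \<in> minfix_invols A. \<tau> ` F = F} \<le> odd_fact (card F) * odd_fact (card A - card F)"
proof -
  let ?Z = "{\<tau> \<in> minfix_invols A. \<tau> ` F = F}" and ?R = "A - F"
  let ?f = "\<lambda>\<tau>. (restrict_id \<tau> F, restrict_id \<tau> ?R)"
  let ?T = "minfix_invols F \<times> minfix_invols ?R"
  have finF: "finite F" using fin F by (rule finite_subset[rotated])
  have inj: "inj_on ?f ?Z"
  proof (rule inj_onI)
    fix s t assume s: "s \<in> ?Z" and t: "t \<in> ?Z" and eq: "?f s = ?f t"
    show "s = t"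
      using s t eq by (intro permutes_eqI[of s A t]) (auto simp: minfix_invols_def dest: restrict_id_eqD)
  qed
  have sub: "?f ` ?Z \<subseteq> ?T"
  proof
    fix y assume "y \<in> ?f ` ?Z"
    then obtain t where t: "t permutes A" "t \<circ> t = id" "card {i \<in> A. t i = i} = card A mod 2" "t ` F = F"
      and y: "y = ?f t" by (auto simp: minfix_invols_def)
    have R: "t ` ?R = ?R" using permutes_image_Diff[OF t(1,4)] .
    have tt: "t (t i) = i" for i using t(2) by (metis comp_apply id_apply)
    let ?a = "restrict_id t F" and ?b = "restrict_id t ?R"
    have pa: "?a permutes F" and pb: "?b permutes ?R"
      using restrict_id_permutes[OF t(1) F t(4)] restrict_id_permutes[OF t(1) _ R] by auto
    have ia: "?a \<circ> ?a = id" using tt t(4) by (auto simp: restrict_id_def fun_eq_iff)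
    have ib: "?b \<circ> ?b = id" using tt R by (auto simp: restrict_id_def fun_eq_iff)
    have "{i \<in> A. t i = i} = {i \<in> F. ?a i = i} \<union> {i \<in> ?R. ?b i = i}"
      using F by (auto simp: restrict_id_def)
    moreover have "card ({i \<in> F. ?a i = i} \<union> {i \<in> ?R. ?b i = i}) = card {i \<in> F. ?a i = i} + card {i \<in> ?R. ?b i = i}"
      using fin finF by (intro card_Un_disjoint) auto
    ultimately have "card {i \<in> F. ?a i = i} + card {i \<in> ?R. ?b i = i} = card A mod 2" using t(3) by simp
    moreover have "card A mod 2 < 2" by simp
    ultimately have lt: "card {i \<in> F. ?a i = i} < 2" "card {i \<in> ?R. ?b i = i} < 2" by linarith+
    have "finite ?R" using fin by simp
    hence "card {i \<in> F. ?a i = i} = card F mod 2" "card {i \<in> ?R. ?b i = i} = card ?R mod 2"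
      using trans[OF mod_less[OF lt(1), symmetric] invol_card_fixed_parity[OF finF pa ia]]
        trans[OF mod_less[OF lt(2), symmetric] invol_card_fixed_parity[OF _ pb ib]]
      by auto
    thus "y \<in> ?T" unfolding y using pa pb ia ib by (auto simp: minfix_invols_def)
  qed
  have fT: "finite ?T" using fin finF by (auto intro: finite_minfix_invols)
  have "card ?T = odd_fact (card F) * odd_fact (card A - card F)"
    using fin finF F by (simp add: card_cartesian_product card_minfix_invols card_Diff_subset)
  thus ?thesis using card_inj_on_le[OF inj sub fT] by simp
qed

text \<open>On \<open>F'\<close> the involution inverts its own action on \<open>F\<close>, so only
  a bijection from \<open>F\<close> to \<open>F'\<close> and a matching of the remaining points are
  free. Composing with a fixed \<open>t0\<close> of the same kind turns the bijection into a
  permutation of \<open>F\<close>.\<close>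

lemma card_minfix_invols_moving_set:
  assumes fin: "finite A" and F: "F \<subseteq> A" and F': "F' \<subseteq> A" and disj: "F \<inter> F' = {}"
  shows "card {\<tau> \<in> minfix_invols A. \<tau> ` F = F'} \<le> fact (card F) * odd_fact (card A - 2 * card F)"
proof (cases "{\<tau> \<in> minfix_invols A. \<tau> ` F = F'} = {}")
  case False
  let ?Z = "{\<tau> \<in> minfix_invols A. \<tau> ` F = F'}" and ?R = "A - F - F'"
  obtain t0 where t0: "t0 \<in> minfix_invols A" "t0 ` F = F'" using False by auto
  have p0: "t0 permutes A" and tt0: "t0 (t0 i) = i" for i
    using t0 by (auto simp: minfix_invols_def) (metis comp_apply id_apply)
  have t0F': "t0 ` F' = F" using t0(2) tt0 by (auto simp: image_image image_iff)
  let ?f = "\<lambda>\<tau>. (restrict_id (t0 \<circ> \<tau>) F, restrict_id \<tau> ?R)"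
  let ?T = "{p. p permutes F} \<times> minfix_invols ?R"
  have finF: "finite F" using fin F by (rule finite_subset[rotated])
  have inj: "inj_on ?f ?Z"
  proof (rule inj_onI)
    fix s t assume s: "s \<in> ?Z" and t: "t \<in> ?Z" and eq: "?f s = ?f t"
    have ss: "s (s i) = i" for i using s by (auto simp: minfix_invols_def) (metis comp_apply id_apply)
    have tt: "t (t i) = i" for i using t by (auto simp: minfix_invols_def) (metis comp_apply id_apply)
    have F: "s x = t x" if "x \<in> F" for x
    proof -
      have "restrict_id (t0 \<circ> s) F x = restrict_id (t0 \<circ> t) F x" using eq by simp
      hence "t0 (s x) = t0 (t x)" using that by (simp add: restrict_id_def)
      thus ?thesis using tt0 by metis
    qed
    have F': "s x = t x" if x: "x \<in> F'" for x
    proof -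
      obtain z where z: "z \<in> F" "x = s z" using s x by auto
      hence "x = t z" using F by auto
      thus ?thesis using z ss tt by metis
    qed
    show "s = t"
      using s t eq F F' by (intro permutes_eqI[of s A t]) (auto simp: minfix_invols_def dest: restrict_id_eqD)
  qed
  have cF': "card F' = card F" using t0(2) p0 by (metis card_image inj_on_subset permutes_inj subset_UNIV)
  have cR: "card ?R = card A - 2 * card F"
    using card_Diff_two_subsets[OF fin F F' disj] cF' by simp
  have le: "2 * card F \<le> card A"
  proof -
    have "card (F \<union> F') = 2 * card F" using cF' disj fin F F'
      by (subst card_Un_disjoint) (auto intro: finite_subset)
    thus ?thesis using card_mono[OF fin, of "F \<union> F'"] F F' by auto
  qed
  have sub: "?f ` ?Z \<subseteq> ?T"
  proof
    fix y assume "y \<in> ?f ` ?Z"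
    then obtain t where t: "t permutes A" "t \<circ> t = id" "card {i \<in> A. t i = i} = card A mod 2" "t ` F = F'"
      and y: "y = ?f t" by (auto simp: minfix_invols_def)
    have tt: "t (t i) = i" for i using t(2) by (metis comp_apply id_apply)
    have tF': "t ` F' = F" using t(4) tt by (auto simp: image_image image_iff)
    have "t ` ?R = A - F' - F"
      using t(1,4) tF' by (simp add: image_set_diff permutes_inj permutes_image)
    hence R: "t ` ?R = ?R" by blast
    let ?b = "restrict_id t ?R"
    have pb: "?b permutes ?R" using restrict_id_permutes[OF t(1) _ R] by auto
    have ib: "?b \<circ> ?b = id" using tt R by (auto simp: restrict_id_def fun_eq_iff)
    have ne: "t i \<noteq> i" if "i \<in> F \<or> i \<in> F'" for i
      using that t(4) tF' disj by (metis disjoint_iff imageI)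
    have "{i \<in> A. t i = i} = {i \<in> ?R. ?b i = i}" using ne by (auto simp: restrict_id_def)
    hence "card {i \<in> ?R. ?b i = i} = card ?R mod 2" using t(3) cR le by (simp add: mod_eq_dvd_iff_nat)
    moreover have "restrict_id (t0 \<circ> t) F permutes F"
      by (rule restrict_id_permutes[of _ A]) (use p0 t F t0F' in \<open>auto intro: permutes_compose simp: image_comp[symmetric]\<close>)
    ultimately show "y \<in> ?T" unfolding y using pb ib by (auto simp: minfix_invols_def)
  qed
  have fT: "finite ?T" using fin finF by (auto intro: finite_minfix_invols finite_permutations)
  have "card ?T = fact (card F) * odd_fact (card A - 2 * card F)"
    using fin finF F cR by (simp add: card_cartesian_product card_minfix_invols card_permutations)
  thus ?thesis using card_inj_on_le[OF inj sub fT] by simp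
next
  case True thus ?thesis by (metis card.empty le0)
qed

section \<open>Comparing double factorials with factorials\<close>

lemma odd_fact_pos: "odd_fact n > 0"
  by (induction n) auto

text \<open>Measures how far \<open>odd_fact n\<close> is from the square root of \<open>n!\<close>.
  It equals \<open>(n - 1)!! / n!!\<close> for even \<open>n\<close> and
  \<open>n!! / (n - 1)!!\<close> for odd \<open>n\<close>; this deviation turns out to cost nothing
  or a polynomial factor.\<close>

definition invol_ratio :: "nat \<Rightarrow> real" where
  "invol_ratio n = real (odd_fact n) ^ 2 / fact n"

lemma invol_ratio_pos: "invol_ratio n > 0"
  using odd_fact_pos[of n] by (simp add: invol_ratio_def)

lemma invol_ratio_add_2:
  "invol_ratio (Suc (Suc n)) = invol_ratio n * (if even n then (real n + 1) / (real n + 2) else (real n + 2) / (real n + 1))"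
proof -
  have f: "fact (Suc (Suc n)) = (real n + 2) * ((real n + 1) * fact n)" by (simp add: algebra_simps)
  show ?thesis
  proof (cases "even n")
    case True
    have o: "real (odd_fact (Suc (Suc n))) = (real n + 1) * real (odd_fact n)"
      using True by (simp add: algebra_simps)
    have "invol_ratio (Suc (Suc n)) = (real n + 1) ^ 2 * real (odd_fact n) ^ 2 / ((real n + 2) * ((real n + 1) * fact n))"
      unfolding invol_ratio_def o f power_mult_distrib by (rule refl)
    also have "\<dots> = invol_ratio n * ((real n + 1) / (real n + 2))"
      unfolding invol_ratio_def by (simp add: power2_eq_square divide_simps)
    finally show ?thesis using True by simp
  next
    case False
    have o: "real (odd_fact (Suc (Suc n))) = (real n + 2) * real (odd_fact n)"
      using False by (simp add: algebra_simps)
    have "invol_ratio (Suc (Suc n)) = (real n + 2) ^ 2 * real (odd_fact n) ^ 2 / ((real n + 2) * ((real n + 1) * fact n))"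
      unfolding invol_ratio_def o f power_mult_distrib by (rule refl)
    also have "\<dots> = invol_ratio n * ((real n + 2) / (real n + 1))"
      unfolding invol_ratio_def by (simp add: power2_eq_square divide_simps)
    finally show ?thesis using False by simp
  qed
qed

lemma invol_ratio_0: "invol_ratio 0 = 1"
  by (simp add: invol_ratio_def)

text \<open>Passing from an even \<open>c\<close> to \<open>c + 2\<close> multiplies the ratio by
  \<open>(c + 1) / (c + 2)\<close>, which is at most the corresponding factor at
  \<open>c + b\<close> for either parity of \<open>b\<close>. Evenness matters: for
  \<open>a = b = 1\<close> the left side is 1 and the right side 1/2.\<close>

lemma invol_ratio_mult_even:
  assumes "even a"
  shows "invol_ratio a * invol_ratio b \<le> invol_ratio (a + b)"
proof -
  obtain k where a: "a = 2 * k" using assms by blast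
  have "invol_ratio (2 * k) * invol_ratio b \<le> invol_ratio (2 * k + b)"
  proof (induction k)
    case 0 show ?case by (simp add: invol_ratio_0)
  next
    case (Suc k)
    define c where "c = 2 * k"
    have ev: "even c" by (simp add: c_def)
    let ?r = "if even (c + b) then (real (c + b) + 1) / (real (c + b) + 2) else (real (c + b) + 2) / (real (c + b) + 1)"
    have "(real c + 1) / (real c + 2) \<le> ?r"
      by (auto simp: divide_simps) (auto simp: algebra_simps)
    moreover have "invol_ratio c * invol_ratio b \<le> invol_ratio (c + b)" using Suc by (simp add: c_def)
    ultimately have "(invol_ratio c * invol_ratio b) * ((real c + 1) / (real c + 2)) \<le> invol_ratio (c + b) * ?r"
      using invol_ratio_pos[of "c + b"] by (intro mult_mono) auto
    hence "invol_ratio (Suc (Suc c)) * invol_ratio b \<le> invol_ratio (Suc (Suc (c + b)))"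
      unfolding invol_ratio_add_2 using ev by (simp add: algebra_simps)
    thus ?case by (simp add: c_def)
  qed
  thus ?thesis by (simp add: a)
qed

text \<open>Each factor \<open>(2 * k + 1) / (2 * k + 2)\<close> is at least
  \<open>(2 * k + 1) / (2 * k + 3)\<close>, and the product of the latter telescopes. The true order
  is \<open>k powr (-1/2)\<close>, but a polynomial loss is affordable.\<close>

lemma invol_ratio_even_ge: "invol_ratio (2 * k) \<ge> 1 / (2 * real k + 1)"
proof (induction k)
  case 0 show ?case by (simp add: invol_ratio_0)
next
  case (Suc k)
  have "1 / (2 * real (Suc k) + 1) \<le> 1 / (2 * real k + 1) * ((2 * real k + 1) / (2 * real k + 2))"
    by (simp add: divide_simps)
  also have "\<dots> \<le> invol_ratio (2 * k) * ((2 * real k + 1) / (2 * real k + 2))"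
    using Suc by (intro mult_right_mono) auto
  also have "\<dots> = invol_ratio (Suc (Suc (2 * k)))" unfolding invol_ratio_add_2 by simp
  finally show ?case by simp
qed

text \<open>Squaring reduces this to \<open>invol_ratio_mult_even\<close>, because
  \<open>n choose a\<close> is the quotient of the factorials. It says that a random matching
  preserves a given \<open>a\<close>-set with probability at most the inverse square root of
  \<open>n choose a\<close>.\<close>

lemma odd_fact_mult_fixing:
  assumes "a \<le> n" "even a \<or> even (n - a)"
  shows "real (odd_fact a * odd_fact (n - a)) * sqrt (real (n choose a)) \<le> real (odd_fact n)"
proof -
  have "invol_ratio a * invol_ratio (n - a) \<le> invol_ratio n"
    using invol_ratio_mult_even[of a "n - a"] invol_ratio_mult_even[of "n - a" a] assms
    by (auto simp: mult.commute)
  hence "(real (odd_fact a * odd_fact (n - a)))\<^sup>2 * (fact n / (fact a * fact (n - a))) \<le> real (odd_fact n) ^ 2"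
    unfolding invol_ratio_def by (simp add: divide_simps power_mult_distrib mult_ac)
  hence "(real (odd_fact a * odd_fact (n - a)))\<^sup>2 * real (n choose a) \<le> real (odd_fact n) ^ 2"
    using assms by (simp add: binomial_fact)
  hence "(real (odd_fact a * odd_fact (n - a)) * sqrt (real (n choose a)))\<^sup>2 \<le> real (odd_fact n) ^ 2"
    by (simp add: power_mult_distrib)
  thus ?thesis by (rule power2_le_imp_le) simp
qed

section \<open>Trinomial coefficients and the weight of a pair of sets\<close>

definition multinom3 :: "nat \<Rightarrow> nat \<Rightarrow> nat \<Rightarrow> nat" where
  "multinom3 n a b = (n choose a) * ((n - a) choose b)"

lemma multinom3_fact:
  assumes "a + b \<le> n"
  shows "real (multinom3 n a b) = fact n / (fact a * fact b * fact (n - a - b))"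
  using assms by (simp add: multinom3_def binomial_fact)

lemma multinom3_pos: "a + b \<le> n \<Longrightarrow> multinom3 n a b > 0"
  by (simp add: multinom3_def)

text \<open>\<open>invol_ratio_mult_even\<close> with the even argument \<open>2 * a\<close>
  compares \<open>n - 2 * a\<close> with \<open>n\<close> at the cost of
  \<open>invol_ratio (2 * a)\<close>, whose lower bound produces the factor
  \<open>2 * a + 1\<close>. This loss is the origin of the numerator of
  \<open>set_pair_weight\<close>.\<close>

lemma odd_fact_mult_moving:
  assumes "2 * a \<le> n"
  shows "real (fact a * odd_fact (n - 2 * a)) * sqrt (real (multinom3 n a a)) \<le> (2 * real a + 1) * real (odd_fact n)"
proof -
  have M: "real (multinom3 n a a) = fact n / (fact a * fact a * fact (n - 2 * a))"
    using multinom3_fact[of a a n] assms by (simp add: mult_2)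
  have "1 / (2 * real a + 1) * invol_ratio (n - 2 * a) \<le> invol_ratio (2 * a) * invol_ratio (n - 2 * a)"
    using invol_ratio_even_ge[of a] invol_ratio_pos[of "n - 2 * a"] by (intro mult_right_mono) auto
  also have "\<dots> \<le> invol_ratio n" using invol_ratio_mult_even[of "2 * a" "n - 2 * a"] assms by simp
  finally have "invol_ratio (n - 2 * a) \<le> (2 * real a + 1) * invol_ratio n" by (simp add: divide_simps mult_ac)
  also have "\<dots> \<le> (2 * real a + 1) ^ 2 * invol_ratio n"
    using invol_ratio_pos[of n] by (intro mult_right_mono) (auto simp: power2_eq_square)
  finally have "real (odd_fact (n - 2 * a)) ^ 2 * (fact n / fact (n - 2 * a)) \<le> (2 * real a + 1) ^ 2 * real (odd_fact n) ^ 2"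
    unfolding invol_ratio_def by (simp add: divide_simps mult_ac)
  hence "real (fact a * odd_fact (n - 2 * a)) ^ 2 * real (multinom3 n a a) \<le> (2 * real a + 1) ^ 2 * real (odd_fact n) ^ 2"
    using M by (simp add: power_mult_distrib power2_eq_square mult_ac)
  hence "(real (fact a * odd_fact (n - 2 * a)) * sqrt (real (multinom3 n a a)))\<^sup>2 \<le> ((2 * real a + 1) * real (odd_fact n)) ^ 2"
    by (simp add: power_mult_distrib)
  thus ?thesis by (rule power2_le_imp_le) simp
qed

text \<open>The price of one directed edge: the weight bounds the probability at a half-loop, and
  its square bounds the probability at an edge with two directions. The numerator comes from
  half-loops that interchange the two sets; keeping it everywhere gives one weight for all
  cases.\<close>

definition set_pair_weight :: "nat \<Rightarrow> 'a set \<times> 'a set \<Rightarrow> real" where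
  "set_pair_weight n = (\<lambda>(F, F'). (2 * real (card F + card F') + 1) / sqrt (real (multinom3 n (card F) (card F'))))"

text \<open>Eigenvalues near \<open>d\<close> lead to \<open>sw = False\<close> with an idle second component. Eigenvalues near \<open>-d\<close>
  lead to \<open>sw = True\<close>: the components are the two sheets of the double cover.\<close>
definition maps_pair :: "bool \<Rightarrow> 'a set \<times> 'a set \<Rightarrow> 'a set \<times> 'a set \<Rightarrow> ('a \<Rightarrow> 'a) \<Rightarrow> bool" where
  "maps_pair sw y y' \<tau> \<longleftrightarrow>
     (if sw then \<tau> ` fst y = snd y' \<and> \<tau> ` snd y = fst y'
      else \<tau> ` fst y = fst y' \<and> snd y = {} \<and> snd y' = {})"

lemma set_pair_weight_nonneg: "set_pair_weight n y \<ge> 0"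
  by (simp add: set_pair_weight_def split: prod.split)

lemma multinom3_commute: "a + b \<le> n \<Longrightarrow> multinom3 n a b = multinom3 n b a"
  using multinom3_fact[of a b n] multinom3_fact[of b a n]
  by (metis (no_types, lifting) add.commute diff_commute mult.commute of_nat_eq_iff)

lemma card_add_le_disjoint:
  assumes "F \<subseteq> {..<n::nat}" "F' \<subseteq> {..<n}" "F \<inter> F' = {}"
  shows "card F + card F' \<le> n"
proof -
  have "finite F" "finite F'" using assms by (auto intro: finite_subset)
  hence "card F + card F' = card (F \<union> F')" using assms by (simp add: card_Un_disjoint)
  also have "\<dots> \<le> card {..<n}" using assms by (intro card_mono) auto
  finally show ?thesis by simp
qed

text \<open>The two directions of an edge carry different labels, and a product over directed edges
  multiplies both weights. Their equality turns this into the square that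
  \<open>card_permutes_maps_pair\<close> provides.\<close>

lemma maps_pair_weight_eq:
  assumes "\<tau> permutes {..<n}" "maps_pair sw y y' \<tau>"
    "fst y \<subseteq> {..<n}" "snd y \<subseteq> {..<n}" "fst y \<inter> snd y = {}"
  shows "set_pair_weight n y = set_pair_weight n y'"
proof -
  have inj: "card (\<tau> ` S) = card S" for S
    using assms(1) by (metis card_image inj_on_subset permutes_inj subset_UNIV)
  have le: "card (fst y) + card (snd y) \<le> n" using assms by (intro card_add_le_disjoint)
  show ?thesis
  proof (cases sw)
    case True
    hence "card (fst y') = card (snd y)" "card (snd y') = card (fst y)"
      using assms(2) inj by (metis maps_pair_def)+
    thus ?thesis using le by (simp add: set_pair_weight_def split_beta multinom3_commute add.commute)
  next
    case False
    hence "card (fst y') = card (fst y)" "snd y' = snd y"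
      using assms(2) inj by (metis maps_pair_def)+
    thus ?thesis by (simp add: set_pair_weight_def split_beta)
  qed
qed

lemma card_permutes_maps_pair:
  assumes "fst y \<subseteq> {..<n}" "snd y \<subseteq> {..<n}" "fst y \<inter> snd y = {}"
  shows "real (card {\<tau>. \<tau> permutes {..<n} \<and> maps_pair sw y y' \<tau>}) \<le> set_pair_weight n y ^ 2 * fact n"
proof -
  define a b where "a = card (fst y)" and "b = card (snd y)"
  have le: "a + b \<le> n" unfolding a_def b_def using assms by (intro card_add_le_disjoint)
  \<comment> \<open>If \<open>sw\<close> is false, the second component is empty and so is its
    image, hence \<open>Y = {}\<close>. Both cases become the same counting problem.\<close>
  obtain X Y where XY: "\<And>\<tau>. maps_pair sw y y' \<tau> \<Longrightarrow> \<tau> ` fst y = X \<and> \<tau> ` snd y = Y"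
  proof (cases sw)
    case True thus ?thesis by (intro that[of "snd y'" "fst y'"]) (simp add: maps_pair_def)
  next
    case False thus ?thesis by (intro that[of "fst y'" "{}"]) (simp add: maps_pair_def)
  qed
  have fin: "finite {\<tau>. \<tau> permutes {..<n} \<and> \<tau> ` fst y = X \<and> \<tau> ` snd y = Y}"
    by (rule finite_subset[OF _ finite_permutations[of "{..<n}"]]) auto
  have "card {\<tau>. \<tau> permutes {..<n} \<and> maps_pair sw y y' \<tau>} \<le> card {\<tau>. \<tau> permutes {..<n} \<and> \<tau> ` fst y = X \<and> \<tau> ` snd y = Y}"
    using XY by (intro card_mono[OF fin] subsetI) blast
  also have "\<dots> \<le> fact a * fact b * fact (n - a - b)"
    using card_permutes_mapping_two_sets[OF _ assms, of X Y] by (simp add: a_def b_def)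
  finally have "real (card {\<tau>. \<tau> permutes {..<n} \<and> maps_pair sw y y' \<tau>}) \<le> real (fact a * fact b * fact (n - a - b))"
    by (rule of_nat_mono)
  hence "real (card {\<tau>. \<tau> permutes {..<n} \<and> maps_pair sw y y' \<tau>}) \<le> fact a * fact b * fact (n - a - b)"
    by simp
  also have "\<dots> = 1 / real (multinom3 n a b) * fact n" using le by (simp add: multinom3_fact)
  also have "\<dots> \<le> set_pair_weight n y ^ 2 * fact n"
  proof (intro mult_right_mono)
    have "1 / real (multinom3 n a b) \<le> (2 * real (a + b) + 1) ^ 2 / real (multinom3 n a b)"
      by (intro divide_right_mono) auto
    also have "\<dots> = set_pair_weight n y ^ 2"
      by (simp add: set_pair_weight_def split_beta power_divide a_def b_def)
    finally show "1 / real (multinom3 n a b) \<le> set_pair_weight n y ^ 2" .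
  qed simp
  finally show ?thesis .
qed

text \<open>By parity each of the two odd blocks would contain a fixed point, whereas a matching of
  an even set has none. This disposes of the parities that \<open>odd_fact_mult_fixing\<close>
  excludes.\<close>

lemma minfix_invols_fixing_odd_set:
  assumes "finite A" "F \<subseteq> A" "odd (card F)" "odd (card (A - F))"
  shows "{\<tau> \<in> minfix_invols A. \<tau> ` F = F} = {}"
proof (rule equals0I, clarify)
  fix t assume t: "t \<in> minfix_invols A" "t ` F = F"
  hence p: "t permutes A" and i: "t \<circ> t = id" by (auto simp: minfix_invols_def)
  have tt: "t (t i) = i" for i using i by (metis comp_apply id_apply)
  have finF: "finite F" using assms by (auto intro: finite_subset)
  have "even (card A)" using assms finF by (simp add: card_Diff_subset card_mono)
  hence 0: "card {i \<in> A. t i = i} = 0" using t by (auto simp: minfix_invols_def)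
  have "restrict_id t F \<circ> restrict_id t F = id" using tt t(2) by (auto simp: restrict_id_def fun_eq_iff)
  from invol_card_fixed_parity[OF finF restrict_id_permutes[OF p assms(2) t(2)] this]
  have "card {i \<in> F. restrict_id t F i = i} \<noteq> 0" using assms(3) by (metis even_zero odd_iff_mod_2_eq_one dvd_eq_mod_eq_0)
  hence "{i \<in> F. restrict_id t F i = i} \<noteq> {}" by (rule contrapos_nn) (simp only: card.empty)
  then obtain i where "i \<in> F" "restrict_id t F i = i" by blast
  hence "i \<in> {i \<in> A. t i = i}" using assms(2) by (auto simp: restrict_id_def)
  thus False using 0 assms(1) by auto
qed

text \<open>A half-loop is its own reverse, so one pair \<open>y\<close> is both source and target:
  the matching interchanges its components or, if \<open>sw\<close> is false, preserves the first
  one.\<close>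

lemma card_invols_maps_pair:
  assumes "fst y \<subseteq> {..<n}" "snd y \<subseteq> {..<n}" "fst y \<inter> snd y = {}"
  shows "real (card {\<tau> \<in> minfix_invols {..<n}. maps_pair sw y y \<tau>})
           \<le> set_pair_weight n y * real (card (minfix_invols {..<n}))"
proof -
  define a b where "a = card (fst y)" and "b = card (snd y)"
  have le: "a + b \<le> n" unfolding a_def b_def using assms by (intro card_add_le_disjoint)
  have M: "real (multinom3 n a b) > 0" using multinom3_pos[OF le] by simp
  have q: "set_pair_weight n y = (2 * real (a + b) + 1) / sqrt (real (multinom3 n a b))"
    by (simp add: set_pair_weight_def split_beta a_def b_def)
  let ?Z = "{\<tau> \<in> minfix_invols {..<n}. maps_pair sw y y \<tau>}"
  have "real (card ?Z) * sqrt (real (multinom3 n a b)) \<le> (2 * real (a + b) + 1) * real (odd_fact n)"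
  proof (cases "?Z = {}")
    case False
    then obtain t where t: "t \<in> minfix_invols {..<n}" "maps_pair sw y y t" by auto
    show ?thesis
    proof (cases sw)
      case True
      have "t ` fst y = snd y" using t(2) True by (simp add: maps_pair_def)
      moreover have "t permutes {..<n}" using t(1) by (simp add: minfix_invols_def)
      ultimately have b: "b = a" unfolding a_def b_def by (metis card_image inj_on_subset permutes_inj subset_UNIV)
      have fin: "finite {\<tau> \<in> minfix_invols {..<n}. \<tau> ` fst y = snd y}"
        by (rule finite_subset[OF _ finite_minfix_invols[of "{..<n}"]]) auto
      have "card ?Z \<le> card {\<tau> \<in> minfix_invols {..<n}. \<tau> ` fst y = snd y}"
        using True by (intro card_mono[OF fin]) (auto simp: maps_pair_def)
      also have "\<dots> \<le> fact a * odd_fact (n - 2 * a)"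
        using card_minfix_invols_moving_set[OF _ assms] by (simp add: a_def)
      finally have "real (card ?Z) * sqrt (real (multinom3 n a a)) \<le> real (fact a * odd_fact (n - 2 * a)) * sqrt (real (multinom3 n a a))"
        by (intro mult_right_mono) (use of_nat_mono in blast, simp)
      also have "\<dots> \<le> (2 * real a + 1) * real (odd_fact n)"
        using le b by (intro odd_fact_mult_moving) auto
      also have "\<dots> \<le> (2 * real (a + b) + 1) * real (odd_fact n)" by (intro mult_right_mono) auto
      finally show ?thesis by (simp add: b)
    next
      case False
      hence b: "b = 0" and tF: "t ` fst y = fst y" using t(2) by (simp_all add: maps_pair_def b_def)
      have "\<not> (odd a \<and> odd (n - a))"
      proof
        assume o: "odd a \<and> odd (n - a)"
        have "card ({..<n} - fst y) = n - a" using assms by (subst card_Diff_subset) (auto simp: a_def intro: finite_subset)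
        hence "{\<tau> \<in> minfix_invols {..<n}. \<tau> ` fst y = fst y} = {}"
          using o assms by (intro minfix_invols_fixing_odd_set) (auto simp: a_def)
        thus False using t tF by blast
      qed
      have fin: "finite {\<tau> \<in> minfix_invols {..<n}. \<tau> ` fst y = fst y}"
        by (rule finite_subset[OF _ finite_minfix_invols[of "{..<n}"]]) auto
      have "card ?Z \<le> card {\<tau> \<in> minfix_invols {..<n}. \<tau> ` fst y = fst y}"
        using False by (intro card_mono[OF fin]) (auto simp: maps_pair_def)
      also have "\<dots> \<le> odd_fact a * odd_fact (n - a)"
        using card_minfix_invols_fixing_set[OF _ assms(1)] by (simp add: a_def)
      finally have "real (card ?Z) * sqrt (real (n choose a)) \<le> real (odd_fact a * odd_fact (n - a)) * sqrt (real (n choose a))"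
        by (intro mult_right_mono) (use of_nat_mono in blast, simp)
      also have "\<dots> \<le> real (odd_fact n)"
        using le \<open>\<not> (odd a \<and> odd (n - a))\<close> by (intro odd_fact_mult_fixing) auto
      also have "\<dots> \<le> (2 * real (a + b) + 1) * real (odd_fact n)" by (simp add: algebra_simps)
      finally show ?thesis by (simp add: b multinom3_def)
    qed
  next
    case True
    show ?thesis unfolding True by simp
  qed
  thus ?thesis using M by (simp add: q card_minfix_invols divide_simps mult_ac)
qed

section \<open>The union bound over permutation assignments\<close>

definition local_assignments :: "('v, 'e) mgraph \<Rightarrow> nat \<Rightarrow> 'e \<Rightarrow> (nat \<Rightarrow> nat) set" where
  "local_assignments B n e = (if rev B e = e then minfix_invols {..<n} else {\<tau>. \<tau> permutes {..<n}})"

lemma finite_local_assignments: "finite (local_assignments B n e)"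
  by (simp add: local_assignments_def finite_minfix_invols finite_permutations)

lemma lift_assignments_local:
  assumes "\<sigma> \<in> lift_assignments B n" "e \<in> darts B"
  shows "\<sigma> e \<in> local_assignments B n e"
  using assms by (auto simp: lift_assignments_def local_assignments_def minfix_invols_def)

lemma lift_assignments_rev:
  assumes "\<sigma> \<in> lift_assignments B n" "e \<in> darts B"
  shows "\<sigma> (rev B e) = Hilbert_Choice.inv (\<sigma> e)"
  using assms by (simp add: lift_assignments_def)

lemma wf_graph_rev:
  assumes "wf_graph B" "e \<in> darts B"
  shows "rev B e \<in> darts B" "rev B (rev B e) = e" "tl B (rev B e) = hd B e" "hd B (rev B e) = tl B e"
    "tl B e \<in> verts B" "hd B e \<in> verts B"
  using assms unfolding wf_graph_def by metis+

text \<open>One direction of every edge: the coordinates in which an assignment is a product of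
  independent choices.\<close>

definition edge_representatives :: "('v, 'e) mgraph \<Rightarrow> 'e set \<Rightarrow> bool" where
  "edge_representatives B R \<longleftrightarrow> R \<subseteq> darts B \<and>
     (\<forall>e\<in>darts B. if rev B e = e then e \<in> R else (e \<in> R \<longleftrightarrow> rev B e \<notin> R))"

lemma edge_representativesD:
  assumes "edge_representatives B R"
  shows "R \<subseteq> darts B" "\<And>e. e \<in> darts B \<Longrightarrow> rev B e \<noteq> e \<Longrightarrow> e \<in> R \<longleftrightarrow> rev B e \<notin> R"
    "\<And>e. e \<in> darts B \<Longrightarrow> rev B e = e \<Longrightarrow> e \<in> R"
  using assms by (auto simp: edge_representatives_def)

lemma ex_edge_representatives:
  assumes wf: "wf_graph B"
  shows "\<exists>R. edge_representatives B R"
proof -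
  \<comment> \<open>The choice depends only on the set \<open>{e, rev B e}\<close>, so both
    directions of an edge agree on it.\<close>
  define c where "c = (\<lambda>e. SOME x. x \<in> {e, rev B e})"
  have c: "c e \<in> {e, rev B e}" for e unfolding c_def by (rule someI_ex) blast
  have cr: "c (rev B e) = c e" if "e \<in> darts B" for e
    unfolding c_def using wf_graph_rev(2)[OF wf that] by (simp add: insert_commute)
  have "edge_representatives B {e \<in> darts B. c e = e}"
    unfolding edge_representatives_def
  proof (intro conjI ballI)
    fix e assume e: "e \<in> darts B"
    show "if rev B e = e then e \<in> {e \<in> darts B. c e = e}
        else (e \<in> {e \<in> darts B. c e = e} \<longleftrightarrow> rev B e \<notin> {e \<in> darts B. c e = e})"
      using c[of e] cr[OF e] e wf_graph_rev(1)[OF wf e] by auto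
  qed auto
  thus ?thesis ..
qed

text \<open>Free choices on the representatives extend to an assignment by taking inverses on the
  opposite directions. This bounds the denominator of a probability from below; injectivity of the
  restriction to \<open>R\<close> bounds the numerator from above.\<close>

lemma card_lift_assignments_ge:
  assumes wf: "wf_graph B" and rep: "edge_representatives B R"
    and fin: "finite (lift_assignments B n)"
  shows "(\<Prod>e\<in>R. card (local_assignments B n e)) \<le> card (lift_assignments B n)"
proof -
  note R = edge_representativesD(1)[OF rep] and R1 = edge_representativesD(2)[OF rep] and R2 = edge_representativesD(3)[OF rep]
  let ?P = "PiE R (local_assignments B n)"
  let ?g = "\<lambda>f e. if e \<in> R then f e else if e \<in> darts B then Hilbert_Choice.inv (f (rev B e)) else id"
  have finR: "finite R" using R wf by (auto simp: wf_graph_def intro: finite_subset)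
  have inj: "inj_on ?g ?P"
  proof (rule inj_onI)
    fix f h assume f: "f \<in> ?P" and h: "h \<in> ?P" and eq: "?g f = ?g h"
    show "f = h"
    proof
      fix e
      have "?g f e = ?g h e" by (rule fun_cong[OF eq])
      thus "f e = h e" using f h by (cases "e \<in> R") (auto simp: PiE_def extensional_def)
    qed
  qed
  have sub: "?g ` ?P \<subseteq> lift_assignments B n"
  proof (rule image_subsetI)
    fix f assume f: "f \<in> ?P"
    have loc: "f e \<in> local_assignments B n e" if "e \<in> R" for e using f that by auto
    have per: "f e permutes {..<n}" if "e \<in> R" for e
      using loc[OF that] by (auto simp: local_assignments_def minfix_invols_def split: if_splits)
    have "?g f e permutes {..<n} \<and> ?g f (rev B e) = Hilbert_Choice.inv (?g f e) \<and>
        (rev B e = e \<longrightarrow> ?g f e \<circ> ?g f e = id \<and> card {i \<in> {..<n}. ?g f e i = i} = n mod 2)"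
      if e: "e \<in> darts B" for e
    proof (cases "rev B e = e")
      case True
      hence eR: "e \<in> R" using R2 e by auto
      hence m: "f e \<in> minfix_invols {..<n}" using loc[OF eR] True by (simp add: local_assignments_def)
      have "f e \<circ> f e = id" using m by (simp add: minfix_invols_def)
      hence "Hilbert_Choice.inv (f e) = f e" by (metis inv_unique_comp)
      thus ?thesis using m eR True by (auto simp: minfix_invols_def)
    next
      case False
      note r = wf_graph_rev[OF wf e]
      show ?thesis
      proof (cases "e \<in> R")
        case True
        hence "rev B e \<notin> R" using R1[OF e False] by simp
        thus ?thesis using True r False per[OF True] by simp
      next
        case eR: False
        hence rR: "rev B e \<in> R" using R1[OF e False] by simp
        have "Hilbert_Choice.inv (Hilbert_Choice.inv (f (rev B e))) = f (rev B e)"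
          using per[OF rR] by (simp add: inv_inv_eq permutes_bij)
        thus ?thesis using eR rR e False per[OF rR] by (simp add: permutes_inv)
      qed
    qed
    thus "?g f \<in> lift_assignments B n" using R by (auto simp: lift_assignments_def)
  qed
  have "card ?P = (\<Prod>e\<in>R. card (local_assignments B n e))" by (rule card_PiE[OF finR])
  thus ?thesis using card_inj_on_le[OF inj sub fin] by simp
qed

lemma lift_assignments_restrict_inj:
  assumes wf: "wf_graph B" and rep: "edge_representatives B R"
  shows "inj_on (\<lambda>\<sigma>. restrict \<sigma> R) (lift_assignments B n)"
proof (rule inj_onI)
  note R = edge_representativesD(1)[OF rep] and R1 = edge_representativesD(2)[OF rep] and R2 = edge_representativesD(3)[OF rep]
  fix s t assume s: "s \<in> lift_assignments B n" and t: "t \<in> lift_assignments B n"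
    and eq: "restrict s R = restrict t R"
  have R': "s e = t e" if "e \<in> R" for e using eq that by (metis restrict_apply')
  show "s = t"
  proof
    fix e
    consider "e \<in> R" | "e \<notin> darts B" | "e \<in> darts B" "e \<notin> R" by blast
    thus "s e = t e"
    proof cases
      case 1 thus ?thesis using R' by simp
    next
      case 2 thus ?thesis using s t by (simp add: lift_assignments_def)
    next
      case 3
      hence "rev B e \<noteq> e" using R2 by auto
      hence rR: "rev B e \<in> R" using R1 3 by auto
      have re: "rev B e \<in> darts B" "rev B (rev B e) = e" using wf_graph_rev[OF wf 3(1)] by auto
      hence "s e = Hilbert_Choice.inv (s (rev B e))" "t e = Hilbert_Choice.inv (t (rev B e))"
        using lift_assignments_rev[OF s re(1)] lift_assignments_rev[OF t re(1)] by simp_all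
      thus ?thesis using R'[OF rR] by simp
    qed
  qed
qed

lemma finite_lift_assignments:
  assumes wf: "wf_graph B"
  shows "finite (lift_assignments B n)"
proof -
  have "finite (darts B)" using wf by (simp add: wf_graph_def)
  hence "finite (PiE (darts B) (local_assignments B n))"
    by (intro finite_PiE) (auto simp: finite_local_assignments)
  moreover have "inj_on (\<lambda>\<sigma>. restrict \<sigma> (darts B)) (lift_assignments B n)"
  proof (rule inj_onI)
    fix s t assume s: "s \<in> lift_assignments B n" and t: "t \<in> lift_assignments B n"
      and eq: "restrict s (darts B) = restrict t (darts B)"
    show "s = t"
    proof
      fix e show "s e = t e"
      proof (cases "e \<in> darts B")
        case True thus ?thesis using eq by (metis restrict_apply')
      next
        case False thus ?thesis using s t by (simp add: lift_assignments_def)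
      qed
    qed
  qed
  moreover have "(\<lambda>\<sigma>. restrict \<sigma> (darts B)) ` lift_assignments B n \<subseteq> PiE (darts B) (local_assignments B n)"
    using lift_assignments_local by fastforce
  ultimately show ?thesis by (metis finite_imageD finite_subset)
qed

text \<open>An edge with two directions supplies the equal factors \<open>q e\<close> and
  \<open>q (rev B e)\<close>, a half-loop only one. This is the passage from independent edges to
  directed edges.\<close>

lemma prod_darts_representatives:
  fixes q :: "'e \<Rightarrow> real"
  assumes wf: "wf_graph B" and rep: "edge_representatives B R"
    and q: "\<And>e. e \<in> darts B \<Longrightarrow> q (rev B e) = q e"
  shows "(\<Prod>e\<in>R. if rev B e = e then q e else (q e)\<^sup>2) = (\<Prod>e\<in>darts B. q e)"
proof -
  note R = edge_representativesD(1)[OF rep] and R1 = edge_representativesD(2)[OF rep] and R2 = edge_representativesD(3)[OF rep]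
  let ?N = "{e \<in> R. rev B e \<noteq> e}"
  have fin: "finite (darts B)" using wf by (simp add: wf_graph_def)
  hence finR: "finite R" using R by (rule finite_subset[rotated])
  have im: "rev B ` ?N = darts B - R"
  proof
    show "rev B ` ?N \<subseteq> darts B - R" using R R1 wf_graph_rev(1)[OF wf] by auto
    show "darts B - R \<subseteq> rev B ` ?N"
    proof
      fix e assume e: "e \<in> darts B - R"
      hence ne: "rev B e \<noteq> e" using R2 by auto
      hence "rev B e \<in> R" using R1 e by auto
      moreover have "rev B (rev B e) = e" using wf_graph_rev(2)[OF wf] e by auto
      ultimately show "e \<in> rev B ` ?N" using ne by (intro image_eqI[of _ _ "rev B e"]) auto
    qed
  qed
  have inj: "inj_on (rev B) ?N"
    using R wf_graph_rev(2)[OF wf] by (intro inj_onI) (metis (mono_tags, lifting) mem_Collect_eq subsetD)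
  have "(\<Prod>e\<in>darts B. q e) = (\<Prod>e\<in>R. q e) * (\<Prod>e\<in>darts B - R. q e)"
    using prod.subset_diff[OF R fin, of q] by (simp add: mult.commute)
  also have "(\<Prod>e\<in>darts B - R. q e) = (\<Prod>e\<in>?N. q (rev B e))"
    unfolding im[symmetric] by (subst prod.reindex[OF inj]) simp
  also have "\<dots> = (\<Prod>e\<in>?N. q e)" using q R by (intro prod.cong) auto
  also have "\<dots> = (\<Prod>e\<in>R. if rev B e \<noteq> e then q e else 1)"
    using finR by (simp add: prod.inter_filter)
  also have "(\<Prod>e\<in>R. q e) * \<dots> = (\<Prod>e\<in>R. if rev B e = e then q e else (q e)\<^sup>2)"
    unfolding prod.distrib[symmetric] by (intro prod.cong) (auto simp: power2_eq_square)
  finally show ?thesis by simp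
qed

lemma card_lift_assignments_local_constraints:
  fixes q :: "'e \<Rightarrow> real" and B :: "('v, 'e) mgraph"
  assumes wf: "wf_graph B" and q0: "\<And>e. q e \<ge> 0"
    and q: "\<And>e. e \<in> darts B \<Longrightarrow> q (rev B e) = q e"
    and half: "\<And>e. e \<in> darts B \<Longrightarrow> rev B e = e \<Longrightarrow>
       real (card {\<tau> \<in> local_assignments B n e. Q e \<tau>}) \<le> q e * real (card (local_assignments B n e))"
    and full: "\<And>e. e \<in> darts B \<Longrightarrow> rev B e \<noteq> e \<Longrightarrow>
       real (card {\<tau> \<in> local_assignments B n e. Q e \<tau>}) \<le> (q e)\<^sup>2 * real (card (local_assignments B n e))"
  shows "real (card {\<sigma> \<in> lift_assignments B n. \<forall>e\<in>darts B. Q e (\<sigma> e)})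
           \<le> (\<Prod>e\<in>darts B. q e) * real (card (lift_assignments B n))"
proof -
  obtain R where rep: "edge_representatives B R" using ex_edge_representatives[OF wf] by blast
  note R = edge_representativesD(1)[OF rep]
  have finR: "finite R" using R wf by (auto simp: wf_graph_def intro: finite_subset)
  let ?Z = "{\<sigma> \<in> lift_assignments B n. \<forall>e\<in>darts B. Q e (\<sigma> e)}"
  let ?L = "\<lambda>e. {\<tau> \<in> local_assignments B n e. Q e \<tau>}"
  have inj: "inj_on (\<lambda>\<sigma>. restrict \<sigma> R) ?Z"
    by (rule inj_on_subset[OF lift_assignments_restrict_inj[OF wf rep]]) auto
  have sub: "(\<lambda>\<sigma>. restrict \<sigma> R) ` ?Z \<subseteq> PiE R ?L"
    using R lift_assignments_local by fastforce
  have "finite (PiE R ?L)" by (intro finite_PiE[OF finR]) (simp add: finite_local_assignments)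
  from card_inj_on_le[OF inj sub this] have "card ?Z \<le> (\<Prod>e\<in>R. card (?L e))"
    by (simp add: card_PiE[OF finR])
  hence "real (card ?Z) \<le> real (\<Prod>e\<in>R. card (?L e))" by (rule of_nat_mono)
  also have "\<dots> = (\<Prod>e\<in>R. real (card (?L e)))" by (rule of_nat_prod)
  also have "\<dots> \<le> (\<Prod>e\<in>R. (if rev B e = e then q e else (q e)\<^sup>2) * real (card (local_assignments B n e)))"
    using half full R by (intro prod_mono) auto
  also have "\<dots> = (\<Prod>e\<in>darts B. q e) * (\<Prod>e\<in>R. real (card (local_assignments B n e)))"
    by (simp add: prod.distrib prod_darts_representatives[where q = q, OF wf rep q])
  also have "\<dots> \<le> (\<Prod>e\<in>darts B. q e) * real (card (lift_assignments B n))"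
  proof (intro mult_left_mono prod_nonneg)
    have "real (\<Prod>e\<in>R. card (local_assignments B n e)) \<le> real (card (lift_assignments B n))"
      by (rule of_nat_mono, rule card_lift_assignments_ge[OF wf rep finite_lift_assignments[OF wf]])
    thus "(\<Prod>e\<in>R. real (card (local_assignments B n e))) \<le> real (card (lift_assignments B n))" by simp
  qed (use q0 in auto)
  finally show ?thesis .
qed

lemma prod_group_by_tail:
  fixes f :: "'v \<Rightarrow> real"
  assumes wf: "wf_graph B" and reg: "regular B d"
  shows "(\<Prod>e\<in>darts B. f (tl B e)) = (\<Prod>v\<in>verts B. f v ^ d)"
proof -
  have fin: "finite (darts B)" "finite (verts B)" using wf by (simp_all add: wf_graph_def)
  have "(\<Prod>e\<in>darts B. f (tl B e)) = (\<Prod>v\<in>verts B. \<Prod>e\<in>{e \<in> darts B. tl B e = v}. f (tl B e))"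
    using wf_graph_rev(5)[OF wf] by (intro prod.group[symmetric] fin) auto
  also have "\<dots> = (\<Prod>v\<in>verts B. f v ^ d)"
    using reg by (intro prod.cong) (auto simp: regular_def degree_def)
  finally show ?thesis .
qed

text \<open>Here \<open>x\<close> labels vertices and \<open>y\<close> labels directed edges. For
  fixed \<open>x\<close>, the sum over \<open>y\<close> of a product over directed edges is a
  product of sums, and the sum at \<open>e\<close> depends only on the label of its tail. Each
  vertex is the tail of \<open>d\<close> directed edges, which gives the power \<open>d\<close>; the
  sum over \<open>x\<close> then factors over the vertices in the same way.\<close>

lemma card_lift_assignments_union_bound:
  fixes q :: "'y \<Rightarrow> real" and B :: "('v, 'e) mgraph" and \<Omega> :: "'x set" and Y :: "'x \<Rightarrow> 'y set"
  assumes wf: "wf_graph B" and reg: "regular B d" and q0: "\<And>y. q y \<ge> 0"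
    and fin: "finite \<Omega>" "\<And>x. x \<in> \<Omega> \<Longrightarrow> finite (Y x)"
    and sym: "\<And>x y y' \<tau>. x \<in> \<Omega> \<Longrightarrow> y \<in> Y x \<Longrightarrow> \<tau> permutes {..<n} \<Longrightarrow> Q y y' \<tau> \<Longrightarrow> q y = q y'"
    and half: "\<And>x y. x \<in> \<Omega> \<Longrightarrow> y \<in> Y x \<Longrightarrow>
       real (card {\<tau> \<in> minfix_invols {..<n}. Q y y \<tau>}) \<le> q y * real (card (minfix_invols {..<n}))"
    and full: "\<And>x y y'. x \<in> \<Omega> \<Longrightarrow> y \<in> Y x \<Longrightarrow>
       real (card {\<tau>. \<tau> permutes {..<n} \<and> Q y y' \<tau>}) \<le> (q y)\<^sup>2 * fact n"
    and bad: "\<And>\<sigma>. \<sigma> \<in> bad \<Longrightarrow> \<sigma> \<in> lift_assignments B n \<and>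
       (\<exists>x y. (\<forall>v\<in>verts B. x v \<in> \<Omega>) \<and> (\<forall>e\<in>darts B. y e \<in> Y (x (tl B e)) \<and> Q (y e) (y (rev B e)) (\<sigma> e)))"
  shows "real (card bad) \<le> (\<Sum>x\<in>\<Omega>. (\<Sum>y\<in>Y x. q y) ^ d) ^ card (verts B) * real (card (lift_assignments B n))"
proof -
  let ?A = "lift_assignments B n"
  define X where "X = PiE (verts B) (\<lambda>_. \<Omega>)"
  define YY where "YY = (\<lambda>x. PiE (darts B) (\<lambda>e. Y (x (tl B e))))"
  define Z where "Z = (\<lambda>y. {\<sigma> \<in> ?A. \<forall>e\<in>darts B. Q (y e) (y (rev B e)) (\<sigma> e)})"
  have finB: "finite (darts B)" "finite (verts B)" using wf by (simp_all add: wf_graph_def)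
  have finX: "finite X" unfolding X_def by (intro finite_PiE finB fin)
  have tl: "x (tl B e) \<in> \<Omega>" if "x \<in> X" "e \<in> darts B" for x e
    using that wf_graph_rev(5)[OF wf] unfolding X_def by auto
  have finY: "finite (YY x)" if "x \<in> X" for x
    unfolding YY_def using tl[OF that] by (intro finite_PiE finB fin)
  have finA: "finite ?A" by (rule finite_lift_assignments[OF wf])
  have finZ: "finite (Z y)" for y unfolding Z_def using finA by simp
  have sub: "bad \<subseteq> (\<Union>x\<in>X. \<Union>y\<in>YY x. Z y)"
  proof
    fix s assume "s \<in> bad"
    from bad[OF this] obtain x y where s: "s \<in> ?A" and x: "\<forall>v\<in>verts B. x v \<in> \<Omega>"
      and y: "\<forall>e\<in>darts B. y e \<in> Y (x (tl B e)) \<and> Q (y e) (y (rev B e)) (s e)" by blast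
    have "restrict x (verts B) \<in> X" using x by (auto simp: X_def)
    moreover have "restrict y (darts B) \<in> YY (restrict x (verts B))"
      using y wf_graph_rev(5)[OF wf] by (auto simp: YY_def)
    moreover have "s \<in> Z (restrict y (darts B))"
      using s y wf_graph_rev(1)[OF wf] by (auto simp: Z_def)
    ultimately show "s \<in> (\<Union>x\<in>X. \<Union>y\<in>YY x. Z y)" by blast
  qed
  have "card bad \<le> card (\<Union>x\<in>X. \<Union>y\<in>YY x. Z y)"
    using finX finY finZ by (intro card_mono[OF _ sub]) auto
  also have "\<dots> \<le> (\<Sum>x\<in>X. card (\<Union>y\<in>YY x. Z y))" by (rule card_UN_le[OF finX])
  also have "\<dots> \<le> (\<Sum>x\<in>X. \<Sum>y\<in>YY x. card (Z y))" by (intro sum_mono card_UN_le finY)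
  finally have "real (card bad) \<le> real (\<Sum>x\<in>X. \<Sum>y\<in>YY x. card (Z y))" by (rule of_nat_mono)
  also have "\<dots> = (\<Sum>x\<in>X. \<Sum>y\<in>YY x. real (card (Z y)))" by simp
  also have "\<dots> \<le> (\<Sum>x\<in>X. \<Sum>y\<in>YY x. (\<Prod>e\<in>darts B. q (y e)) * real (card ?A))"
  proof (intro sum_mono)
    fix x y assume x: "x \<in> X" and y: "y \<in> YY x"
    have ye: "y e \<in> Y (x (tl B e))" if "e \<in> darts B" for e using y that by (auto simp: YY_def)
    show "real (card (Z y)) \<le> (\<Prod>e\<in>darts B. q (y e)) * real (card ?A)"
    proof (cases "\<forall>e\<in>darts B. q (y (rev B e)) = q (y e)")
      case True
      show ?thesis unfolding Z_def
      proof (rule card_lift_assignments_local_constraints[OF wf])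
        fix e assume e: "e \<in> darts B"
        show "q (y (rev B e)) = q (y e)" using True e by auto
        { assume r: "rev B e = e"
          thus "real (card {\<tau> \<in> local_assignments B n e. Q (y e) (y (rev B e)) \<tau>}) \<le> q (y e) * real (card (local_assignments B n e))"
            using half[OF tl[OF x e] ye[OF e]] by (simp add: local_assignments_def)
        next
          assume r: "rev B e \<noteq> e"
          thus "real (card {\<tau> \<in> local_assignments B n e. Q (y e) (y (rev B e)) \<tau>}) \<le> (q (y e))\<^sup>2 * real (card (local_assignments B n e))"
            using full[OF tl[OF x e] ye[OF e]] by (simp add: local_assignments_def card_permutations[OF refl])
        }
      qed (use q0 in auto)
    next
      \<comment> \<open>If the weights of the two directions of some edge differ, no assignment
        realises the labels and the term vanishes.\<close>
      case False
      then obtain e where e: "e \<in> darts B" "q (y (rev B e)) \<noteq> q (y e)" by auto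
      have "Z y = {}"
      proof (rule equals0I)
        fix s assume "s \<in> Z y"
        hence "Q (y e) (y (rev B e)) (s e)" "s e permutes {..<n}" using e by (auto simp: Z_def lift_assignments_def)
        thus False using sym[OF tl[OF x e(1)] ye[OF e(1)]] e(2) by metis
      qed
      thus ?thesis using q0 by (simp add: prod_nonneg)
    qed
  qed
  also have "\<dots> = (\<Sum>x\<in>X. \<Sum>y\<in>YY x. \<Prod>e\<in>darts B. q (y e)) * real (card ?A)"
    by (simp add: sum_distrib_right)
  also have "(\<Sum>x\<in>X. \<Sum>y\<in>YY x. \<Prod>e\<in>darts B. q (y e)) = (\<Sum>x\<in>X. \<Prod>e\<in>darts B. \<Sum>y\<in>Y (x (tl B e)). q y)"
    unfolding YY_def using finB tl fin by (intro sum.cong refl prod_sum_PiE[symmetric]) auto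
  also have "\<dots> = (\<Sum>x\<in>X. \<Prod>v\<in>verts B. (\<Sum>y\<in>Y (x v). q y) ^ d)"
    by (intro sum.cong refl prod_group_by_tail[OF wf reg, of "\<lambda>v. \<Sum>y\<in>Y (_ v). q y"])
  also have "\<dots> = (\<Prod>v\<in>verts B. \<Sum>x\<in>\<Omega>. (\<Sum>y\<in>Y x. q y) ^ d)"
    unfolding X_def using finB fin by (intro prod_sum_PiE[symmetric]) auto
  also have "\<dots> = (\<Sum>x\<in>\<Omega>. (\<Sum>y\<in>Y x. q y) ^ d) ^ card (verts B)" by simp
  finally show ?thesis .
qed

section \<open>Binomial estimates\<close>

text \<open>The exponential moment bound: with \<open>y = t / n\<close>, multiplying each term by
  \<open>y powr (i - t) \<ge> 1\<close> allows the sum to be completed to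
  \<open>(1 + y) ^ n \<le> exp t\<close>, and \<open>y powr (- t)\<close> remains.\<close>

lemma sum_binomial_le_powr:
  fixes t :: real
  assumes t: "0 < t" "t \<le> real n"
  shows "(\<Sum>i\<in>{i. i \<le> n \<and> real i \<le> t}. real (n choose i)) \<le> (real n / t) powr t * exp t"
proof -
  define y where "y = t / real n"
  have n: "n > 0" using t by (cases n) auto
  have y: "0 < y" "y \<le> 1" using t n by (auto simp: y_def)
  have "(\<Sum>i\<in>{i. i \<le> n \<and> real i \<le> t}. real (n choose i))
          \<le> (\<Sum>i\<in>{i. i \<le> n \<and> real i \<le> t}. real (n choose i) * y ^ i * y powr (- t))"
  proof (rule sum_mono)
    fix i assume "i \<in> {i. i \<le> n \<and> real i \<le> t}"
    hence "real i - t \<le> 0" by auto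
    hence "1 \<le> y powr (real i - t)" using y powr_mono'[of "real i - t" 0 y] by simp
    also have "\<dots> = y ^ i * y powr (- t)" using y by (simp add: powr_diff powr_realpow powr_minus divide_inverse)
    finally show "real (n choose i) \<le> real (n choose i) * y ^ i * y powr (- t)"
      using mult_left_mono[of 1 "y ^ i * y powr (- t)" "real (n choose i)"] by (simp add: mult_ac)
  qed
  also have "\<dots> \<le> (\<Sum>i\<le>n. real (n choose i) * y ^ i * y powr (- t))"
    using y by (intro sum_mono2) auto
  also have "\<dots> = (y + 1) ^ n * y powr (- t)"
    unfolding binomial_ring sum_distrib_right by simp
  also have "\<dots> \<le> exp t * y powr (- t)"
  proof (intro mult_right_mono)
    have "(y + 1) ^ n \<le> exp y ^ n" using y exp_ge_add_one_self[of y] by (intro power_mono) (auto simp: add.commute)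
    also have "\<dots> = exp t" using n by (simp add: y_def flip: exp_of_nat_mult)
    finally show "(y + 1) ^ n \<le> exp t" .
  qed simp
  also have "y powr (- t) = (real n / t) powr t"
    using y t n by (simp add: y_def powr_minus powr_divide divide_simps)
  finally show ?thesis by (simp add: mult.commute)
qed

text \<open>Any small enough constant works here; this one keeps the estimate for the
  logarithm elementary.\<close>
definition slack :: real where "slack = 1 / 2 ^ 16"

text \<open>Counts exceptional sets inside all of \<open>{..<n}\<close>, although they lie in a set
  of size \<open>k\<close>: having \<open>n choose i\<close> in place of \<open>k choose i\<close>
  also pays for the larger weight of the reduced set, see \<open>shrink_term_le\<close>.\<close>

definition small_binomial_sum :: "nat \<Rightarrow> nat \<Rightarrow> real" where
  "small_binomial_sum n k = (\<Sum>i\<in>{i. i \<le> k \<and> real i \<le> slack * real k}. real (n choose i))"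

lemma ln_ratio_ge_third:
  assumes "0 < k" "3 * k \<le> 2 * n"
  shows "ln (real n / real k) \<ge> 1 / 3"
proof -
  have "ln (real k / real n) \<le> real k / real n - 1"
    using assms by (intro ln_le_minus_one) auto
  also have "\<dots> \<le> - 1 / 3" using assms by (simp add: field_simps)
  finally show ?thesis using assms by (simp add: ln_div)
qed

lemma ln_two_times_le: "eventually (\<lambda>k. ln (2 * real k + 1) \<le> real k / 180) sequentially"
  by real_asymp

text \<open>With \<open>x = ln (n / k)\<close> everything is compared with
  \<open>exp (k * x) = (n / k) ^ k\<close>, a lower bound for \<open>n choose k\<close>. The
  exponent \<open>1 / 30\<close> is shared equally between the sum and the factor
  \<open>exp c\<close>, which absorbs the polynomial \<open>2 * k + 1\<close>.\<close>

lemma small_binomial_sum_le: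
  assumes k: "0 < k" "3 * k \<le> 2 * n" and c: "0 \<le> c" "c \<le> real k / 180"
  shows "exp c * small_binomial_sum n k \<le> real (n choose k) powr (1 / 30)"
proof -
  define x where "x = ln (real n / real k)"
  define t where "t = slack * real k"
  have x: "x \<ge> 1 / 3" unfolding x_def by (rule ln_ratio_ge_third[OF k])
  have t: "0 < t" "t \<le> real k" using k by (auto simp: t_def slack_def)
  have n: "0 < n" "k \<le> n" using k by auto
  have "small_binomial_sum n k \<le> (\<Sum>i\<in>{i. i \<le> n \<and> real i \<le> t}. real (n choose i))"
    unfolding small_binomial_sum_def t_def using n by (intro sum_mono2) (auto intro: finite_subset[of _ "{..n}"])
  also have "\<dots> \<le> (real n / t) powr t * exp t" using t n by (intro sum_binomial_le_powr) auto
  also have "(real n / t) powr t = exp (t * ln (real n / t))" using t n by (simp add: powr_def)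
  also have "ln (real n / t) = x + 16 * ln 2"
  proof -
    have "real n / t = (real n / real k) * 2 ^ 16" by (simp add: t_def slack_def)
    moreover have "ln ((real n / real k) * 2 ^ 16) = x + ln (2 ^ 16)"
      unfolding x_def using n k by (intro ln_mult_pos) auto
    moreover have "ln (2 ^ 16 :: real) = 16 * ln 2" by (subst ln_realpow) auto
    ultimately show ?thesis by simp
  qed
  also have "exp (t * (x + 16 * ln 2)) * exp t \<le> exp (t * (x + 17))"
  proof -
    have "t * (16 * ln 2) \<le> t * 16" using t ln_2_less_1 by (intro mult_left_mono) auto
    thus ?thesis by (simp add: exp_add[symmetric] algebra_simps)
  qed
  finally have g: "small_binomial_sum n k \<le> exp (t * (x + 17))" .
  \<comment> \<open>As \<open>x \<ge> 1 / 3\<close>, one has \<open>17 \<le> 51 * x\<close>. The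
    next estimate is \<open>52 * slack \<le> 1 / 60\<close>, which is where the size of
    \<open>slack\<close> enters.\<close>
  have "t * (x + 17) \<le> t * (52 * x)" using x t by (intro mult_left_mono) auto
  also have "\<dots> \<le> real k * x / 60" using x k by (simp add: t_def slack_def field_simps)
  finally have a: "t * (x + 17) \<le> real k * x / 60" .
  \<comment> \<open>The same lower bound on \<open>x\<close> turns \<open>c \<le> k / 180\<close>
    into \<open>c \<le> k * x / 60\<close>.\<close>
  have "real k / 3 \<le> real k * x" using x k mult_left_mono[of "1/3" x "real k"] by simp
  hence "c \<le> real k * x / 60" using c by linarith
  hence "c + t * (x + 17) \<le> real k * x / 30" using a by linarith
  hence e: "exp (c + t * (x + 17)) \<le> exp (real k * x / 30)" by simp
  have "exp c * small_binomial_sum n k \<le> exp c * exp (t * (x + 17))"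
    using g by (intro mult_left_mono) auto
  also have "\<dots> \<le> exp (real k * x / 30)" using e by (simp only: exp_add)
  also have "exp (real k * x / 30) = ((real n / real k) ^ k) powr (1 / 30)"
    using n k by (simp add: powr_def x_def ln_realpow)
  also have "\<dots> \<le> real (n choose k) powr (1 / 30)"
    using binomial_ge_n_over_k_pow_k[of k n, where ?'a = real] n by (intro powr_mono2) auto
  finally show ?thesis .
qed

lemma small_binomial_sum_le':
  assumes "3 * k \<le> 2 * n"
  shows "small_binomial_sum n k \<le> real (n choose k) powr (1 / 30)"
proof (cases "k = 0")
  case True
  have "{i. i \<le> (0::nat) \<and> real i \<le> slack * real 0} = {0}" by auto
  thus ?thesis using True by (simp add: small_binomial_sum_def)
next
  case False
  thus ?thesis using small_binomial_sum_le[of k n 0] assms by simp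
qed

text \<open>Choosing a \<open>k\<close>-set and \<open>i\<close> of its points amounts to choosing
  the other \<open>k - i\<close> points first and then \<open>i\<close> points from what
  remains.\<close>

lemma binomial_absorb_left:
  assumes "i \<le> k" "k \<le> n"
  shows "(n choose k) * (k choose i) \<le> (n choose (k - i)) * (n choose i)"
proof -
  have "(n choose k) * (k choose i) = (n choose k) * (k choose (k - i))"
    using assms by (metis binomial_symmetric)
  also have "\<dots> = (n choose (k - i)) * ((n - (k - i)) choose (k - (k - i)))"
    using assms by (intro choose_mult) auto
  also have "\<dots> \<le> (n choose (k - i)) * (n choose i)"
    using assms by (intro mult_left_mono) (auto intro: binomial_right_mono)
  finally show ?thesis .
qed

lemma multinom3_shrink:
  assumes "i \<le> k" "j \<le> l" "k + l \<le> n"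
  shows "(k choose i) * (l choose j) * multinom3 n k l \<le> (n choose i) * (n choose j) * multinom3 n (k - i) (l - j)"
proof -
  have "((n - k) choose l) * (l choose j) \<le> ((n - k) choose (l - j)) * ((n - k) choose j)"
    using assms by (intro binomial_absorb_left) auto
  also have "\<dots> \<le> ((n - (k - i)) choose (l - j)) * (n choose j)"
    using assms by (intro mult_mono binomial_right_mono) auto
  finally have 1: "((n - k) choose l) * (l choose j) \<le> ((n - (k - i)) choose (l - j)) * (n choose j)" .
  have 2: "(n choose k) * (k choose i) \<le> (n choose (k - i)) * (n choose i)"
    using assms by (intro binomial_absorb_left) auto
  have "((n choose k) * (k choose i)) * (((n - k) choose l) * (l choose j))
      \<le> ((n choose (k - i)) * (n choose i)) * (((n - (k - i)) choose (l - j)) * (n choose j))"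
    by (rule mult_mono[OF 2 1]) auto
  thus ?thesis by (simp add: multinom3_def mult_ac)
qed

text \<open>In the notation of the proof the claim is \<open>P / sqrt M' \<le> R / sqrt M\<close>.
  The inequalities \<open>P \<le> R\<close> and \<open>P * M \<le> R * M'\<close> multiply to
  \<open>P ^ 2 * M \<le> R ^ 2 * M'\<close>. Thus the gain in weight on smaller sets is covered by a
  cruder count of the exceptional sets.\<close>

lemma shrink_term_le:
  assumes "i \<le> k" "j \<le> l" "k + l \<le> n"
  shows "real ((k choose i) * (l choose j)) / sqrt (real (multinom3 n (k - i) (l - j)))
     \<le> real (n choose i) * real (n choose j) / sqrt (real (multinom3 n k l))"
proof -
  define P where "P = real ((k choose i) * (l choose j))"
  define R where "R = real (n choose i) * real (n choose j)"
  define M where "M = real (multinom3 n k l)"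
  define M' where "M' = real (multinom3 n (k - i) (l - j))"
  have M: "M > 0" "M' > 0" using assms multinom3_pos by (auto simp: M_def M'_def)
  have P0: "P \<ge> 0" by (simp add: P_def)
  have "k choose i \<le> n choose i" "l choose j \<le> n choose j"
    using assms by (auto intro: binomial_right_mono)
  hence PR: "P \<le> R" unfolding P_def R_def of_nat_mult by (intro mult_mono) auto
  have "real ((k choose i) * (l choose j) * multinom3 n k l) \<le> real ((n choose i) * (n choose j) * multinom3 n (k - i) (l - j))"
    by (rule of_nat_mono, rule multinom3_shrink[OF assms])
  hence "P * M \<le> R * M'" by (simp add: P_def R_def M_def M'_def)
  hence "P * (P * M) \<le> R * (R * M')" using PR P0 M by (intro mult_mono[of P R "P * M"]) auto
  hence "(P * sqrt M)\<^sup>2 \<le> (R * sqrt M')\<^sup>2" using M by (simp add: power_mult_distrib) (simp add: power2_eq_square mult_ac)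
  hence "P * sqrt M \<le> R * sqrt M'" by (rule power2_le_imp_le) (use PR P0 M in auto)
  hence "P / sqrt M' \<le> R / sqrt M" using M by (simp add: divide_simps mult_ac)
  thus ?thesis unfolding P_def R_def M_def M'_def .
qed

section \<open>Nearly full subsets and their total weight\<close>

definition near_subsets :: "'a set \<Rightarrow> 'a set set" where
  "near_subsets S = {F. F \<subseteq> S \<and> real (card (S - F)) \<le> slack * real (card S)}"

definition near_pairs :: "'a set \<times> 'a set \<Rightarrow> ('a set \<times> 'a set) set" where
  "near_pairs x = near_subsets (fst x) \<times> near_subsets (snd x)"

lemma finite_near_subsets: "finite S \<Longrightarrow> finite (near_subsets S)"
  by (rule finite_subset[of _ "Pow S"]) (auto simp: near_subsets_def)

lemma sum_near_subsets:
  fixes f :: "nat \<Rightarrow> real"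
  assumes fin: "finite S"
  shows "(\<Sum>F\<in>near_subsets S. f (card F)) =
     (\<Sum>i\<in>{i. i \<le> card S \<and> real i \<le> slack * real (card S)}. real (card S choose i) * f (card S - i))"
proof -
  let ?I = "{i. i \<le> card S \<and> real i \<le> slack * real (card S)}"
  have finI: "finite ?I" by (rule finite_subset[of _ "{..card S}"]) auto
  have "(\<Sum>F\<in>near_subsets S. f (card F)) = (\<Sum>i\<in>?I. \<Sum>F\<in>{F \<in> near_subsets S. card (S - F) = i}. f (card F))"
    by (rule sum.group[symmetric]) (use fin finI in \<open>auto simp: finite_near_subsets near_subsets_def intro: card_mono\<close>)
  also have "\<dots> = (\<Sum>i\<in>?I. real (card S choose i) * f (card S - i))"
  proof (rule sum.cong[OF refl])
    fix i assume i: "i \<in> ?I"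
    have eq: "{F \<in> near_subsets S. card (S - F) = i} = (\<lambda>D. S - D) ` {D. D \<subseteq> S \<and> card D = i}"
    proof
      show "{F \<in> near_subsets S. card (S - F) = i} \<subseteq> (\<lambda>D. S - D) ` {D. D \<subseteq> S \<and> card D = i}"
      proof
        fix F assume "F \<in> {F \<in> near_subsets S. card (S - F) = i}"
        hence "F \<subseteq> S" "card (S - F) = i" by (auto simp: near_subsets_def)
        thus "F \<in> (\<lambda>D. S - D) ` {D. D \<subseteq> S \<and> card D = i}"
          by (intro image_eqI[of _ _ "S - F"]) auto
      qed
      show "(\<lambda>D. S - D) ` {D. D \<subseteq> S \<and> card D = i} \<subseteq> {F \<in> near_subsets S. card (S - F) = i}"
        using i by (auto simp: near_subsets_def double_diff)
    qed
    have inj: "inj_on (\<lambda>D. S - D) {D. D \<subseteq> S \<and> card D = i}"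
      by (rule inj_onI) (metis (no_types, lifting) double_diff mem_Collect_eq order_refl)
    have "(\<Sum>F\<in>{F \<in> near_subsets S. card (S - F) = i}. f (card F)) = (\<Sum>F\<in>{F \<in> near_subsets S. card (S - F) = i}. f (card S - i))"
    proof (rule sum.cong[OF refl])
      fix F assume "F \<in> {F \<in> near_subsets S. card (S - F) = i}"
      hence F: "F \<subseteq> S" "card (S - F) = i" by (auto simp: near_subsets_def)
      have "card F \<le> card S" using F fin by (intro card_mono)
      moreover have "card (S - F) = card S - card F" using F fin by (intro card_Diff_subset) (auto intro: finite_subset)
      ultimately have "card F = card S - i" using F by simp
      thus "f (card F) = f (card S - i)" by simp
    qed
    also have "\<dots> = real (card {D. D \<subseteq> S \<and> card D = i}) * f (card S - i)"
      by (simp add: eq card_image[OF inj])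
    also have "\<dots> = real (card S choose i) * f (card S - i)" by (simp add: n_subsets[OF fin])
    finally show "(\<Sum>F\<in>{F \<in> near_subsets S. card (S - F) = i}. f (card F)) = real (card S choose i) * f (card S - i)" .
  qed
  finally show ?thesis .
qed

text \<open>The numerator is largest at the full sets and comes out of the sum; the rest is
  \<open>shrink_term_le\<close> term by term.\<close>

lemma sum_set_pair_weight_le:
  assumes fin: "finite S" "finite T" and kl: "card S + card T \<le> n"
  shows "(\<Sum>y\<in>near_pairs (S, T). set_pair_weight n y)
     \<le> (2 * real (card S + card T) + 1) * small_binomial_sum n (card S) * small_binomial_sum n (card T) / sqrt (real (multinom3 n (card S) (card T)))"
proof -
  define k l where "k = card S" and "l = card T"
  define c where "c = 2 * real (k + l) + 1"
  let ?I = "{i. i \<le> k \<and> real i \<le> slack * real k}" and ?J = "{i. i \<le> l \<and> real i \<le> slack * real l}"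
  have le: "set_pair_weight n (F, F') \<le> c / sqrt (real (multinom3 n (card F) (card F')))"
    if "F \<in> near_subsets S" "F' \<in> near_subsets T" for F F'
  proof -
    have "card F \<le> k" "card F' \<le> l" using that fin by (auto simp: near_subsets_def k_def l_def intro: card_mono)
    thus ?thesis by (auto simp: set_pair_weight_def c_def intro!: divide_right_mono)
  qed
  have "(\<Sum>y\<in>near_pairs (S, T). set_pair_weight n y) = (\<Sum>F\<in>near_subsets S. \<Sum>F'\<in>near_subsets T. set_pair_weight n (F, F'))"
    by (simp add: near_pairs_def sum.cartesian_product)
  also have "\<dots> \<le> (\<Sum>F\<in>near_subsets S. \<Sum>F'\<in>near_subsets T. c / sqrt (real (multinom3 n (card F) (card F'))))"
    by (intro sum_mono le)
  also have "\<dots> = (\<Sum>F\<in>near_subsets S. \<Sum>j\<in>?J. real (l choose j) * (c / sqrt (real (multinom3 n (card F) (l - j)))))"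
    unfolding l_def by (intro sum.cong refl sum_near_subsets[OF fin(2)])
  also have "\<dots> = (\<Sum>i\<in>?I. real (k choose i) * (\<Sum>j\<in>?J. real (l choose j) * (c / sqrt (real (multinom3 n (k - i) (l - j))))))"
    unfolding k_def by (rule sum_near_subsets[OF fin(1)])
  also have "\<dots> = (\<Sum>i\<in>?I. \<Sum>j\<in>?J. c * (real ((k choose i) * (l choose j)) / sqrt (real (multinom3 n (k - i) (l - j)))))"
    by (simp add: sum_distrib_left mult_ac)
  also have "\<dots> \<le> (\<Sum>i\<in>?I. \<Sum>j\<in>?J. c * (real (n choose i) * real (n choose j) / sqrt (real (multinom3 n k l))))"
    using kl by (intro sum_mono mult_left_mono shrink_term_le) (auto simp: k_def l_def c_def)
  also have "\<dots> = c * small_binomial_sum n k * small_binomial_sum n l / sqrt (real (multinom3 n k l))"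
    by (simp add: small_binomial_sum_def sum_distrib_left sum_distrib_right sum_divide_distrib mult_ac)
  finally show ?thesis by (simp add: c_def k_def l_def)
qed

section \<open>Summing the union bound\<close>

text \<open>The bound 2/3 keeps \<open>ln (n / k)\<close> away from zero, so that the binomial
  coefficients are exponentially large in \<open>k\<close>. It exceeds the density 1/2 to leave room
  for sections that are somewhat larger than the average. An empty second component is the idle
  one.\<close>

definition admissible_pairs :: "nat \<Rightarrow> nat \<Rightarrow> (nat set \<times> nat set) set" where
  "admissible_pairs n k0 = {(S, T). S \<subseteq> {..<n} \<and> T \<subseteq> {..<n} \<and> S \<inter> T = {} \<and> k0 \<le> card S \<and>
     3 * card S \<le> 2 * n \<and> 3 * card T \<le> 2 * n \<and> (T = {} \<or> k0 \<le> card T)}"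

lemma finite_admissible_pairs: "finite (admissible_pairs n k0)"
  by (rule finite_subset[of _ "Pow {..<n} \<times> Pow {..<n}"]) (auto simp: admissible_pairs_def)

lemma weighted_small_binomial_sum_le:
  assumes k1: "\<And>k. k \<ge> k1 \<Longrightarrow> ln (2 * real k + 1) \<le> real k / 180"
    and k: "k = 0 \<or> (k1 \<le> k \<and> 0 < k)" "3 * k \<le> 2 * n"
  shows "(2 * real k + 1) * small_binomial_sum n k \<le> real (n choose k) powr (1 / 30)"
proof (cases "k = 0")
  case True
  thus ?thesis using small_binomial_sum_le'[of k n] by simp
next
  case False
  have "exp (ln (2 * real k + 1)) * small_binomial_sum n k \<le> real (n choose k) powr (1 / 30)"
    using False k k1 by (intro small_binomial_sum_le) auto
  thus ?thesis by simp
qed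

lemma small_binomial_sum_nonneg: "small_binomial_sum n k \<ge> 0"
  unfolding small_binomial_sum_def by (intro sum_nonneg) auto

lemma sum_near_pairs_weight_le:
  assumes k1: "\<And>k. k \<ge> k1 \<Longrightarrow> ln (2 * real k + 1) \<le> real k / 180"
    and k0: "k1 \<le> k0" "0 < k0" and x: "x \<in> admissible_pairs n k0"
  shows "(\<Sum>y\<in>near_pairs x. set_pair_weight n y) \<le> real (multinom3 n (card (fst x)) (card (snd x))) powr (- 2 / 5)"
proof -
  obtain S T where x: "x = (S, T)" and ST: "S \<subseteq> {..<n}" "T \<subseteq> {..<n}" "S \<inter> T = {}" "k0 \<le> card S"
     "3 * card S \<le> 2 * n" "3 * card T \<le> 2 * n" "T = {} \<or> k0 \<le> card T"
    using x by (auto simp: admissible_pairs_def)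
  define k l where "k = card S" and "l = card T"
  have fin: "finite S" "finite T" using ST by (auto intro: finite_subset)
  have kl: "k + l \<le> n" unfolding k_def l_def using ST by (intro card_add_le_disjoint)
  define M where "M = real (multinom3 n k l)"
  have M1: "M \<ge> 1" using multinom3_pos[OF kl] by (simp add: M_def)
  have Ck: "real (n choose k) \<le> M"
  proof -
    have "(n choose k) * 1 \<le> multinom3 n k l"
      unfolding multinom3_def using kl by (intro mult_left_mono) (auto simp: Suc_le_eq)
    hence "real ((n choose k) * 1) \<le> M" unfolding M_def by (rule of_nat_mono)
    thus ?thesis by simp
  qed
  have Cl: "real (n choose l) \<le> M"
  proof -
    have "(n choose l) * 1 \<le> multinom3 n l k"
      unfolding multinom3_def using kl by (intro mult_left_mono) (auto simp: Suc_le_eq)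
    also have "\<dots> = multinom3 n k l" using kl by (simp add: multinom3_commute)
    finally have "real ((n choose l) * 1) \<le> M" unfolding M_def by (rule of_nat_mono)
    thus ?thesis by simp
  qed
  have A: "(2 * real k + 1) * small_binomial_sum n k \<le> M powr (1 / 30)"
  proof -
    have "(2 * real k + 1) * small_binomial_sum n k \<le> real (n choose k) powr (1 / 30)"
      using ST k0 by (intro weighted_small_binomial_sum_le[OF k1]) (auto simp: k_def)
    also have "\<dots> \<le> M powr (1 / 30)" using Ck by (intro powr_mono2) auto
    finally show ?thesis .
  qed
  have B: "(2 * real l + 1) * small_binomial_sum n l \<le> M powr (1 / 30)"
  proof -
    have "(2 * real l + 1) * small_binomial_sum n l \<le> real (n choose l) powr (1 / 30)"
      using ST k0 by (intro weighted_small_binomial_sum_le[OF k1]) (auto simp: l_def)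
    also have "\<dots> \<le> M powr (1 / 30)" using Cl by (intro powr_mono2) auto
    finally show ?thesis .
  qed
  have "(\<Sum>y\<in>near_pairs x. set_pair_weight n y) \<le> (2 * real (k + l) + 1) * small_binomial_sum n k * small_binomial_sum n l / sqrt M"
    unfolding x k_def l_def M_def using fin kl by (intro sum_set_pair_weight_le) (auto simp: k_def l_def)
  \<comment> \<open>The estimate \<open>2 * (k + l) + 1 \<le> (2 * k + 1) * (2 * l + 1)\<close>
    hands one polynomial factor to each binomial sum.\<close>
  also have "\<dots> \<le> ((2 * real k + 1) * small_binomial_sum n k) * ((2 * real l + 1) * small_binomial_sum n l) / sqrt M"
  proof (intro divide_right_mono)
    have "(2 * real (k + l) + 1) * (small_binomial_sum n k * small_binomial_sum n l)
       \<le> ((2 * real k + 1) * (2 * real l + 1)) * (small_binomial_sum n k * small_binomial_sum n l)"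
      by (intro mult_right_mono mult_nonneg_nonneg small_binomial_sum_nonneg) (simp add: algebra_simps)
    thus "(2 * real (k + l) + 1) * small_binomial_sum n k * small_binomial_sum n l
       \<le> ((2 * real k + 1) * small_binomial_sum n k) * ((2 * real l + 1) * small_binomial_sum n l)"
      by (simp only: mult_ac)
  qed (use M1 in auto)
  also have "\<dots> \<le> M powr (1 / 30) * M powr (1 / 30) / sqrt M"
    using A B M1 by (intro divide_right_mono mult_mono) (auto intro!: mult_nonneg_nonneg small_binomial_sum_nonneg)
  \<comment> \<open>The exponent is \<open>- 13 / 30\<close>. Anything below \<open>- 1 / 3\<close>
    suffices for \<open>d = 3\<close>, since the \<open>d\<close>-th power then still beats the
    number \<open>M\<close> of pairs.\<close>
  also have "\<dots> = M powr (1 / 30 + 1 / 30 - 1 / 2)" unfolding powr_add powr_diff using M1 by (simp add: powr_half_sqrt)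
  also have "\<dots> \<le> M powr (- 2 / 5)" using M1 by (intro powr_mono) auto
  finally show ?thesis by (simp add: x M_def k_def l_def)
qed

lemma card_disjoint_pairs:
  "card {(S, T). S \<subseteq> {..<n::nat} \<and> T \<subseteq> {..<n} \<and> S \<inter> T = {} \<and> card S = k \<and> card T = l} = multinom3 n k l"
proof -
  have "{(S, T). S \<subseteq> {..<n::nat} \<and> T \<subseteq> {..<n} \<and> S \<inter> T = {} \<and> card S = k \<and> card T = l}
      = (SIGMA S : {S. S \<subseteq> {..<n} \<and> card S = k}. {T. T \<subseteq> {..<n} - S \<and> card T = l})" by auto
  also have "card \<dots> = (\<Sum>S\<in>{S. S \<subseteq> {..<n} \<and> card S = k}. card {T. T \<subseteq> {..<n} - S \<and> card T = l})"
    by (rule card_SigmaI) auto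
  also have "\<dots> = (\<Sum>S\<in>{S. S \<subseteq> {..<n} \<and> card S = k}. (n - k) choose l)"
  proof (rule sum.cong[OF refl])
    fix S assume "S \<in> {S. S \<subseteq> {..<n} \<and> card S = k}"
    hence "card ({..<n} - S) = n - k" by (subst card_Diff_subset) (auto intro: finite_subset)
    thus "card {T. T \<subseteq> {..<n} - S \<and> card T = l} = (n - k) choose l" by (simp add: n_subsets)
  qed
  also have "\<dots> = multinom3 n k l" by (simp add: multinom3_def n_subsets)
  finally show ?thesis .
qed

definition vertex_factor :: "nat \<Rightarrow> nat \<Rightarrow> nat \<Rightarrow> real" where
  "vertex_factor n k0 d = (\<Sum>x\<in>admissible_pairs n k0. (\<Sum>y\<in>near_pairs x. set_pair_weight n y) ^ d)"

text \<open>Group the pairs by their sizes. At most \<open>M\<close> pairs have given sizes,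
  \<open>M\<close> being the trinomial coefficient, and \<open>d \<ge> 3\<close> makes each
  contribute at most \<open>M powr (- 6 / 5)\<close>, so \<open>M powr (- 1 / 5)\<close> is left.
  Finally \<open>M\<close> is at least \<open>n choose k0\<close>, and there are
  \<open>(n + 1) ^ 2\<close> possible sizes.\<close>

lemma vertex_factor_le:
  assumes k1: "\<And>k. k \<ge> k1 \<Longrightarrow> ln (2 * real k + 1) \<le> real k / 180"
    and k0: "k1 \<le> k0" "0 < k0" and d: "d \<ge> 3" and n: "3 * k0 \<le> n"
  shows "vertex_factor n k0 d
     \<le> (real n + 1)\<^sup>2 * ((real n / real k0) ^ k0) powr (- 1 / 5)"
proof -
  let ?\<Omega> = "admissible_pairs n k0" and ?sz = "\<lambda>x :: nat set \<times> nat set. (card (fst x), card (snd x))"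
  let ?M = "\<lambda>x. real (multinom3 n (fst x) (snd x))"
  let ?b = "((real n / real k0) ^ k0) powr (- 1 / 5)"
  have M1: "?M (?sz x) \<ge> 1" if "x \<in> ?\<Omega>" for x
  proof -
    have "card (fst x) + card (snd x) \<le> n"
      using that by (intro card_add_le_disjoint) (auto simp: admissible_pairs_def)
    from multinom3_pos[OF this] show ?thesis by simp
  qed
  have "vertex_factor n k0 d \<le> (\<Sum>x\<in>?\<Omega>. ?M (?sz x) powr (- 6 / 5))"
    unfolding vertex_factor_def
  proof (rule sum_mono)
    fix x assume x: "x \<in> ?\<Omega>"
    have "(\<Sum>y\<in>near_pairs x. set_pair_weight n y) ^ d \<le> (?M (?sz x) powr (- 2 / 5)) ^ d"
      using sum_near_pairs_weight_le[OF k1 k0 x] by (intro power_mono) (auto intro!: sum_nonneg set_pair_weight_nonneg)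
    also have "\<dots> = ?M (?sz x) powr (- 2 / 5 * real d)"
      using M1[OF x] by (simp add: powr_powr flip: powr_realpow)
    also have "\<dots> \<le> ?M (?sz x) powr (- 6 / 5)" using M1[OF x] d by (intro powr_mono) auto
    finally show "(\<Sum>y\<in>near_pairs x. set_pair_weight n y) ^ d \<le> ?M (?sz x) powr (- 6 / 5)" .
  qed
  also have "\<dots> = (\<Sum>p\<in>{..n} \<times> {..n}. \<Sum>x\<in>{x \<in> ?\<Omega>. ?sz x = p}. ?M (?sz x) powr (- 6 / 5))"
  proof (rule sum.group[symmetric])
    have "card S \<le> n" if "S \<subseteq> {..<n}" for S using card_mono[OF _ that] by simp
    thus "?sz ` ?\<Omega> \<subseteq> {..n} \<times> {..n}" by (auto simp: admissible_pairs_def)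
  qed (auto simp: finite_admissible_pairs)
  also have "\<dots> \<le> (\<Sum>p\<in>{..n} \<times> {..n}. ?b)"
  proof (rule sum_mono)
    fix p
    show "(\<Sum>x\<in>{x \<in> ?\<Omega>. ?sz x = p}. ?M (?sz x) powr (- 6 / 5)) \<le> ?b"
    proof (cases "{x \<in> ?\<Omega>. ?sz x = p} = {}")
      case False
      then obtain x0 where x0: "x0 \<in> ?\<Omega>" "?sz x0 = p" by auto
      define k l where "k = fst p" and "l = snd p"
      have k: "k0 \<le> k" "3 * k \<le> 2 * n" using x0 by (auto simp: admissible_pairs_def k_def)
      have kl: "k + l \<le> n"
        using card_add_le_disjoint[of "fst x0" n "snd x0"] x0 by (auto simp: admissible_pairs_def k_def l_def)
      have Mp: "?M p \<ge> 1" using M1[OF x0(1)] x0(2) by simp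
      have "card {x \<in> ?\<Omega>. ?sz x = p} \<le> card {(S, T). S \<subseteq> {..<n} \<and> T \<subseteq> {..<n} \<and> S \<inter> T = {} \<and> card S = k \<and> card T = l}"
        by (rule card_mono, rule finite_subset[of _ "Pow {..<n} \<times> Pow {..<n}"])
           (auto simp: admissible_pairs_def k_def l_def)
      hence "card {x \<in> ?\<Omega>. ?sz x = p} \<le> multinom3 n k l" by (simp only: card_disjoint_pairs)
      hence c: "real (card {x \<in> ?\<Omega>. ?sz x = p}) \<le> ?M p" unfolding k_def l_def by (rule of_nat_mono)
      have "(\<Sum>x\<in>{x \<in> ?\<Omega>. ?sz x = p}. ?M (?sz x) powr (- 6 / 5)) = real (card {x \<in> ?\<Omega>. ?sz x = p}) * ?M p powr (- 6 / 5)"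
        by simp
      also have "\<dots> \<le> ?M p * ?M p powr (- 6 / 5)" using c by (intro mult_right_mono) auto
      also have "\<dots> = ?M p powr (1 + - 6 / 5)" using Mp by (subst powr_add) simp
      also have "\<dots> = ?M p powr (- 1 / 5)" by simp
      also have "\<dots> \<le> ?b"
      proof (rule powr_mono2')
        \<comment> \<open>Binomial coefficients increase only up to the middle. Beyond it
          \<open>k\<close> is replaced by \<open>n - k\<close>, and
          \<open>k0 \<le> n / 3 \<le> n - k\<close>.\<close>
        have "(n choose k0) \<le> (n choose k)"
        proof (cases "2 * k \<le> n")
          case True thus ?thesis using k by (intro binomial_mono) auto
        next
          case False
          have "(n choose k0) \<le> (n choose (n - k))" using False k n by (intro binomial_mono) auto
          thus ?thesis using k by (metis binomial_symmetric kl le_add1 le_trans)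
        qed
        also have "\<dots> \<le> multinom3 n k l"
        proof -
          have "(n choose k) * 1 \<le> multinom3 n k l"
            unfolding multinom3_def using kl by (intro mult_left_mono) (auto simp: Suc_le_eq)
          thus ?thesis by simp
        qed
        finally have "real (n choose k0) \<le> ?M p" unfolding k_def l_def by (rule of_nat_mono)
        thus "(real n / real k0) ^ k0 \<le> ?M p"
          using binomial_ge_n_over_k_pow_k[of k0 n, where ?'a = real] n by simp
        show "0 < (real n / real k0) ^ k0" using n k0 by simp
      qed simp
      finally show ?thesis .
    qed (use k0 in \<open>simp only: sum.empty; simp\<close>)
  qed
  also have "\<dots> = (real n + 1)\<^sup>2 * ?b" by (simp add: card_cartesian_product power2_eq_square algebra_simps)
  finally show ?thesis .
qed

lemma vertex_factor_polynomial:
  assumes d: "d \<ge> 3"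
  shows "\<exists>k0\<ge>1. \<exists>C\<ge>0. \<forall>n\<ge>3 * k0.
     vertex_factor n k0 d \<le> C / real n ^ j"
proof -
  obtain k1 where k1: "\<And>k. k \<ge> k1 \<Longrightarrow> ln (2 * real k + 1) \<le> real k / 180"
    using ln_two_times_le by (auto simp: eventually_sequentially)
  \<comment> \<open>The exponent \<open>1 / 5\<close> turns \<open>k0 = 5 * p\<close> into the power
    \<open>p\<close> of \<open>n\<close>. Here \<open>j\<close> is the target, 2 pays for the number
    of sizes, and \<open>k1\<close> makes \<open>k0\<close> large enough for the logarithmic
    estimate.\<close>
  define p where "p = j + 2 + k1"
  define k0 where "k0 = 5 * p"
  have k0: "k1 \<le> k0" "0 < k0" by (simp_all add: k0_def p_def)
  show ?thesis
  proof (intro exI[of _ k0] conjI exI[of _ "4 * real k0 ^ p"] allI impI)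
    fix n assume n: "3 * k0 \<le> n"
    have n0: "n > 0" using n k0 by simp
    define z where "z = real n / real k0"
    have z: "z > 0" using n0 k0 by (simp add: z_def)
    have "(z ^ k0) powr (- 1 / 5) = z powr (real k0 * (- 1 / 5))"
      using z by (simp add: powr_powr flip: powr_realpow)
    also have "real k0 * (- 1 / 5) = - real p" by (simp add: k0_def)
    also have "z powr (- real p) = real k0 ^ p / real n ^ p"
      using z by (simp add: powr_minus powr_realpow) (simp add: z_def power_divide)
    finally have "vertex_factor n k0 d
       \<le> (real n + 1)\<^sup>2 * (real k0 ^ p / real n ^ p)"
      using vertex_factor_le[OF k1 k0 d n] by (simp add: z_def)
    also have "\<dots> \<le> (2 * real n)\<^sup>2 * (real k0 ^ p / real n ^ p)"
      using n0 by (intro mult_right_mono power_mono) auto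
    also have "\<dots> = 4 * real k0 ^ p * (real n ^ 2 / real n ^ p)" by (simp add: power_mult_distrib)
    also have "\<dots> \<le> 4 * real k0 ^ p * (1 / real n ^ j)"
    proof (intro mult_left_mono)
      have "real n ^ (j + 2) \<le> real n ^ p" using n0 by (intro power_increasing) (auto simp: p_def)
      hence "real n ^ 2 / real n ^ p \<le> real n ^ 2 / real n ^ (j + 2)" using n0 by (intro divide_left_mono) auto
      also have "\<dots> = 1 / real n ^ j" using n0 by (simp add: power_add power2_eq_square field_simps)
      finally show "real n ^ 2 / real n ^ p \<le> 1 / real n ^ j" .
    qed simp
    finally show "vertex_factor n k0 d \<le> 4 * real k0 ^ p / real n ^ j"
      by simp
  qed (use k0 in auto)
qed

text \<open>The event to which both ends of the spectrum are reduced, in the form of the union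
  bound: sections label the vertices, and their exactly mapped subsets label the directed
  edges.\<close>

definition structured_assignments :: "('v, 'e) mgraph \<Rightarrow> nat \<Rightarrow> nat \<Rightarrow> bool \<Rightarrow> ('e \<Rightarrow> nat \<Rightarrow> nat) set" where
  "structured_assignments B n k0 sw = {\<sigma> \<in> lift_assignments B n.
     \<exists>x y. (\<forall>v\<in>verts B. x v \<in> admissible_pairs n k0) \<and>
       (\<forall>e\<in>darts B. y e \<in> near_pairs (x (tl B e)) \<and> maps_pair sw (y e) (y (rev B e)) (\<sigma> e))}"

lemma card_structured_assignments:
  assumes wf: "wf_graph B" and conn: "connected_graph B" and reg: "regular B d" and d: "d \<ge> 3"
  shows "\<exists>k0\<ge>1. \<exists>C>0. \<forall>n\<ge>1. \<forall>sw.
    real (card (structured_assignments B n k0 sw)) \<le> C / real n ^ j * real (card (lift_assignments B n))"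
proof -
  obtain k0 C where k0: "k0 \<ge> 1" and C: "C \<ge> 0"
    and le: "\<And>n. n \<ge> 3 * k0 \<Longrightarrow> vertex_factor n k0 d \<le> C / real n ^ j"
    using vertex_factor_polynomial[OF d, of j] by metis
  \<comment> \<open>The power of \<open>3 * k0\<close> makes the claimed bound at least 1, hence
    trivial, for \<open>n < 3 * k0\<close>.\<close>
  define C' where "C' = C + real (3 * k0) ^ j + 1"
  have C': "C' > 0" using C by (auto simp: C'_def intro: add_nonneg_pos)
  show ?thesis
  proof (intro exI[of _ k0] conjI exI[of _ C'] allI impI k0 C')
    fix n :: nat and sw assume n: "n \<ge> 1"
    let ?Z = "structured_assignments B n k0 sw" and ?A = "lift_assignments B n"
    let ?\<rho> = "vertex_factor n k0 d"
    have "card ?Z \<le> card ?A"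
      by (intro card_mono finite_lift_assignments[OF wf]) (auto simp: structured_assignments_def)
    hence ZA: "real (card ?Z) \<le> 1 * real (card ?A)" by simp
    show "real (card ?Z) \<le> C' / real n ^ j * real (card ?A)"
    proof (cases "1 \<le> C' / real n ^ j")
      case True
      show ?thesis by (rule order_trans[OF ZA mult_right_mono[OF True]]) simp
    next
      case False
      have n3: "n \<ge> 3 * k0"
      proof (rule ccontr)
        assume "\<not> ?thesis"
        hence "real n ^ j \<le> real (3 * k0) ^ j" by (intro power_mono) auto
        also have "\<dots> \<le> C'" using C by (simp add: C'_def)
        finally show False using False n by (simp add: divide_simps)
      qed
      have \<rho>: "?\<rho> \<le> C' / real n ^ j"
        using le[OF n3] by (rule order_trans) (auto intro!: divide_right_mono simp: C'_def)
      have \<rho>0: "?\<rho> \<ge> 0" unfolding vertex_factor_def by (intro sum_nonneg zero_le_power set_pair_weight_nonneg)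
      have m: "card (verts B) \<ge> 1" using conn wf by (simp add: connected_graph_def wf_graph_def Suc_le_eq card_gt_0_iff)
      have sub: "fst y \<subseteq> {..<n} \<and> snd y \<subseteq> {..<n} \<and> fst y \<inter> snd y = {}"
        if "x \<in> admissible_pairs n k0" "y \<in> near_pairs x" for x y
        using that by (cases x; cases y) (simp add: admissible_pairs_def near_pairs_def near_subsets_def, blast)
      have "real (card ?Z) \<le> ?\<rho> ^ card (verts B) * real (card ?A)"
        unfolding vertex_factor_def
      proof (rule card_lift_assignments_union_bound[OF wf reg set_pair_weight_nonneg finite_admissible_pairs, where Q = "maps_pair sw"])
        show "finite (near_pairs x)" if "x \<in> admissible_pairs n k0" for x
        proof -
          have "finite (fst x)" "finite (snd x)" using that by (auto simp: admissible_pairs_def intro: finite_subset[of _ "{..<n}"])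
          thus ?thesis unfolding near_pairs_def by (intro finite_cartesian_product finite_near_subsets)
        qed
        show "set_pair_weight n y = set_pair_weight n y'"
          if "x \<in> admissible_pairs n k0" "y \<in> near_pairs x" "\<tau> permutes {..<n}" "maps_pair sw y y' \<tau>" for x y y' \<tau>
          using maps_pair_weight_eq[OF that(3,4)] sub[OF that(1,2)] by blast
        show "real (card {\<tau> \<in> minfix_invols {..<n}. maps_pair sw y y \<tau>}) \<le> set_pair_weight n y * real (card (minfix_invols {..<n}))"
          if "x \<in> admissible_pairs n k0" "y \<in> near_pairs x" for x y
          using card_invols_maps_pair sub[OF that] by blast
        show "real (card {\<tau>. \<tau> permutes {..<n} \<and> maps_pair sw y y' \<tau>}) \<le> (set_pair_weight n y)\<^sup>2 * fact n"
          if "x \<in> admissible_pairs n k0" "y \<in> near_pairs x" for x y y'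
          using card_permutes_maps_pair sub[OF that] by blast
      qed (auto simp: structured_assignments_def)
      \<comment> \<open>The vertex factor is below 1 in this branch, so the contribution of a single
        vertex is already enough.\<close>
      also have "?\<rho> ^ card (verts B) \<le> ?\<rho> ^ 1"
        using \<rho> \<rho>0 False m by (intro power_decreasing) auto
      also have "?\<rho> ^ 1 * real (card ?A) \<le> C' / real n ^ j * real (card ?A)"
        using \<rho> by (intro mult_right_mono) auto
      finally show ?thesis by (simp add: mult_right_mono)
    qed
  qed
qed

section \<open>Edge expansion of lifts\<close>

definition boundary :: "('v, 'e) mgraph \<Rightarrow> 'v set \<Rightarrow> 'e set" where
  "boundary H U = {e \<in> darts H. tl H e \<in> U \<and> hd H e \<notin> U}"

lemma finite_boundary: "finite (darts H) \<Longrightarrow> finite (boundary H U)"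
  by (simp add: boundary_def)

text \<open>By induction on the support of \<open>h\<close>, peeling off its lowest level.\<close>
lemma coarea_inequality:
  fixes h :: "'v \<Rightarrow> real"
  assumes finD: "finite (darts H)" and "finite S" and "\<And>v. h v \<ge> 0" and "{v. h v > 0} = S"
    and "\<And>U. U \<subseteq> S \<Longrightarrow> U \<noteq> {} \<Longrightarrow> \<gamma> * real (card U) \<le> real (card (boundary H U))"
  shows "\<gamma> * (\<Sum>v\<in>S. h v) \<le> (\<Sum>e\<in>darts H. max 0 (h (tl H e) - h (hd H e)))"
  using assms(2-)
proof (induction "card S" arbitrary: S h rule: less_induct)
  case less
  show ?case
  proof (cases "S = {}")
    case True
    thus ?thesis by (simp add: sum_nonneg)
  next
    case False
    define c where "c = Min (h ` S)"
    define h' where "h' = (\<lambda>v. if v \<in> S then h v - c else h v)"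
    have c_le: "c \<le> h v" if "v \<in> S" for v using less.prems(1) that by (simp add: c_def)
    have "c \<in> h ` S" unfolding c_def using less.prems(1) False by (intro Min_in) auto
    then obtain w where w: "w \<in> S" "h w = c" by auto
    hence c0: "c > 0" using less.prems(3) by auto
    have hS: "h v = 0" if "v \<notin> S" for v using that less.prems(2)[of v] less.prems(3) by force
    have h'0: "h' v \<ge> 0" for v using c_le less.prems(2) by (auto simp: h'_def)
    define S' where "S' = {v. h' v > 0}"
    have S': "S' \<subseteq> S" using hS by (auto simp: S'_def h'_def split: if_splits)
    have "w \<notin> S'" using w by (simp add: S'_def h'_def)
    hence "S' \<subset> S" using S' w by blast
    hence "card S' < card S" using less.prems(1) by (rule psubset_card_mono[rotated])
    hence IH: "\<gamma> * (\<Sum>v\<in>S'. h' v) \<le> (\<Sum>e\<in>darts H. max 0 (h' (tl H e) - h' (hd H e)))"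
      using less.prems(1,4) S' h'0 by (intro less.hyps) (auto simp: S'_def intro: finite_subset)
    have "(\<Sum>v\<in>S. h v) = (\<Sum>v\<in>S. h' v + c)" by (intro sum.cong) (auto simp: h'_def)
    also have "\<dots> = (\<Sum>v\<in>S. h' v) + c * real (card S)" by (simp add: sum.distrib)
    also have "(\<Sum>v\<in>S. h' v) = (\<Sum>v\<in>S'. h' v)"
      using S' less.prems(1) h'0 by (intro sum.mono_neutral_right) (auto simp: S'_def order.antisym not_less)
    finally have sumS: "(\<Sum>v\<in>S. h v) = (\<Sum>v\<in>S'. h' v) + c * real (card S)" .
    have "max 0 (h (tl H e) - h (hd H e)) = max 0 (h' (tl H e) - h' (hd H e)) + (if e \<in> boundary H S then c else 0)"
      if "e \<in> darts H" for e
      using that hS[of "tl H e"] hS[of "hd H e"] h'0[of "tl H e"] h'0[of "hd H e"] c0 c_le[of "tl H e"] c_le[of "hd H e"]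
      by (cases "tl H e \<in> S"; cases "hd H e \<in> S") (auto simp: boundary_def h'_def max_def)
    hence "(\<Sum>e\<in>darts H. max 0 (h (tl H e) - h (hd H e)))
       = (\<Sum>e\<in>darts H. max 0 (h' (tl H e) - h' (hd H e)) + (if e \<in> boundary H S then c else 0))"
      by (intro sum.cong) auto
    also have "\<dots> = (\<Sum>e\<in>darts H. max 0 (h' (tl H e) - h' (hd H e))) + c * real (card (boundary H S))"
    proof -
      have "darts H \<inter> boundary H S = boundary H S" by (auto simp: boundary_def)
      thus ?thesis using finD by (simp add: sum.distrib sum.If_cases Int_def[symmetric] mult.commute)
    qed
    finally have sumE: "(\<Sum>e\<in>darts H. max 0 (h (tl H e) - h (hd H e)))
      = (\<Sum>e\<in>darts H. max 0 (h' (tl H e) - h' (hd H e))) + c * real (card (boundary H S))" .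
    have "c * (\<gamma> * real (card S)) \<le> c * real (card (boundary H S))"
      using c0 less.prems(4)[of S] False by (intro mult_left_mono) auto
    thus ?thesis using IH unfolding sumS sumE by (simp add: algebra_simps)
  qed
qed

section \<open>Cheeger's inequality for eigenfunctions\<close>

lemma sum_group_by_tail:
  fixes \<phi> :: "'e \<Rightarrow> real"
  assumes wf: "wf_graph H"
  shows "(\<Sum>e\<in>darts H. \<phi> e) = (\<Sum>v\<in>verts H. \<Sum>e\<in>{e \<in> darts H. tl H e = v}. \<phi> e)"
  using wf wf_graph_rev(5)[OF wf] by (intro sum.group[symmetric]) (auto simp: wf_graph_def)

lemma sum_tail_regular:
  fixes \<phi> :: "'v \<Rightarrow> real"
  assumes wf: "wf_graph H" and reg: "regular H d"
  shows "(\<Sum>e\<in>darts H. \<phi> (tl H e)) = real d * (\<Sum>v\<in>verts H. \<phi> v)"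
proof -
  have "(\<Sum>e\<in>darts H. \<phi> (tl H e)) = (\<Sum>v\<in>verts H. \<Sum>e\<in>{e \<in> darts H. tl H e = v}. \<phi> v)"
    unfolding sum_group_by_tail[OF wf] by (intro sum.cong) auto
  also have "\<dots> = (\<Sum>v\<in>verts H. real d * \<phi> v)"
    using reg by (intro sum.cong) (auto simp: regular_def degree_def)
  finally show ?thesis by (simp add: sum_distrib_left)
qed

lemma sum_darts_rev:
  assumes wf: "wf_graph H"
  shows "(\<Sum>e\<in>darts H. \<phi> (rev H e)) = (\<Sum>e\<in>darts H. \<phi> e)"
  by (rule sum.reindex_bij_witness[of _ "rev H" "rev H"]) (use wf_graph_rev[OF wf] in auto)

lemma sum_head_regular:
  fixes \<phi> :: "'v \<Rightarrow> real"
  assumes wf: "wf_graph H" and reg: "regular H d"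
  shows "(\<Sum>e\<in>darts H. \<phi> (hd H e)) = real d * (\<Sum>v\<in>verts H. \<phi> v)"
proof -
  have "(\<Sum>e\<in>darts H. \<phi> (hd H e)) = (\<Sum>e\<in>darts H. \<phi> (tl H (rev H e)))"
    using wf_graph_rev(3)[OF wf] by (intro sum.cong) auto
  also have "\<dots> = (\<Sum>e\<in>darts H. \<phi> (tl H e))" by (rule sum_darts_rev[OF wf])
  finally show ?thesis using sum_tail_regular[OF wf reg] by simp
qed

text \<open>Cauchy-Schwarz, from expanding the nonnegative sum of
  \<open>(Q * a i - S * b i) ^ 2\<close>. If \<open>Q = 0\<close> all \<open>b i\<close> vanish, and
  sums over infinite index sets are zero.\<close>

lemma sum_mult_square_le:
  fixes a b :: "'i \<Rightarrow> real"
  shows "(\<Sum>i\<in>I. a i * b i)\<^sup>2 \<le> (\<Sum>i\<in>I. (a i)\<^sup>2) * (\<Sum>i\<in>I. (b i)\<^sup>2)"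
proof (cases "finite I \<and> (\<Sum>i\<in>I. (b i)\<^sup>2) \<noteq> 0")
  case True
  define P Q S where "P = (\<Sum>i\<in>I. (a i)\<^sup>2)" and "Q = (\<Sum>i\<in>I. (b i)\<^sup>2)" and "S = (\<Sum>i\<in>I. a i * b i)"
  have "Q \<ge> 0" unfolding Q_def by (intro sum_nonneg) auto
  hence Q: "Q > 0" using True by (simp add: Q_def)
  have "0 \<le> (\<Sum>i\<in>I. (Q * a i - S * b i)\<^sup>2)" by (intro sum_nonneg) auto
  also have "\<dots> = (\<Sum>i\<in>I. Q\<^sup>2 * (a i)\<^sup>2 - 2 * Q * S * (a i * b i) + S\<^sup>2 * (b i)\<^sup>2)"
    by (intro sum.cong refl) (simp add: power2_eq_square algebra_simps)
  also have "\<dots> = Q\<^sup>2 * P - 2 * Q * S * S + S\<^sup>2 * Q"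
    by (simp add: P_def Q_def S_def sum.distrib sum_subtractf sum_distrib_left)
  also have "\<dots> = Q * (P * Q - S\<^sup>2)" by (simp add: power2_eq_square algebra_simps)
  finally have "S\<^sup>2 \<le> P * Q" using Q by (simp add: zero_le_mult_iff)
  thus ?thesis by (simp add: P_def Q_def S_def)
next
  case False
  hence "\<forall>i\<in>I. b i = 0" if "finite I" using that sum_nonneg_eq_0_iff[of I "\<lambda>i. (b i)\<^sup>2"] by simp
  thus ?thesis by (cases "finite I") auto
qed

definition eigenfunction :: "('v, 'e) mgraph \<Rightarrow> real \<Rightarrow> ('v \<Rightarrow> real) \<Rightarrow> bool" where
  "eigenfunction H \<mu> f \<longleftrightarrow> (\<forall>v\<in>verts H. (\<Sum>e\<in>{e \<in> darts H. tl H e = v}. f (hd H e)) = \<mu> * f v)"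

text \<open>The coarea inequality is applied to the square of the positive part \<open>g\<close> of
  \<open>f\<close>. Passing from \<open>f\<close> to \<open>g\<close> can only increase sums over
  neighbours, so \<open>g\<close> has Rayleigh quotient at least \<open>\<mu>\<close> and energy at
  most \<open>2 * \<epsilon> * N\<close>. If no set were sparse, Cauchy-Schwarz with the factors
  \<open>g u - g v\<close> and \<open>g u + g v\<close> would give \<open>\<gamma> ^ 2 * N ^ 2 \<le>
  (2 * \<epsilon> * N) * (4 * d * N)\<close>. Locating \<open>U\<close> in the support of
  \<open>g\<close> is what later limits its size.\<close>

lemma cheeger_eigenfunction:
  fixes f :: "'v \<Rightarrow> real"
  assumes wf: "wf_graph H" and reg: "regular H d" and f: "eigenfunction H \<mu> f"
    and \<mu>: "\<mu> \<ge> real d - \<epsilon>" and pos: "\<exists>v\<in>verts H. f v > 0" and \<gamma>: "\<gamma> \<ge> 0" "8 * real d * \<epsilon> < \<gamma>\<^sup>2"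
  shows "\<exists>U. U \<noteq> {} \<and> U \<subseteq> {v \<in> verts H. f v > 0} \<and> real (card (boundary H U)) < \<gamma> * real (card U)"
proof (rule ccontr)
  assume "\<not> ?thesis"
  hence exp: "\<gamma> * real (card U) \<le> real (card (boundary H U))"
    if "U \<subseteq> {v \<in> verts H. f v > 0}" "U \<noteq> {}" for U using that by (metis not_le)
  have fin: "finite (darts H)" "finite (verts H)" using wf by (simp_all add: wf_graph_def)
  note wfr = wf_graph_rev[OF wf]
  define g where "g = (\<lambda>v. if v \<in> verts H \<and> f v > 0 then f v else 0)"
  have g0: "g v \<ge> 0" for v by (simp add: g_def)
  define N where "N = (\<Sum>v\<in>verts H. (g v)\<^sup>2)"
  have N: "N > 0"
  proof -
    obtain w where w: "w \<in> verts H" "f w > 0" using pos by auto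
    hence "0 < (g w)\<^sup>2" by (simp add: g_def)
    also have "\<dots> \<le> N" unfolding N_def using w fin by (intro member_le_sum) auto
    finally show ?thesis .
  qed
  let ?S = "{v \<in> verts H. f v > 0}"
  have "\<gamma> * (\<Sum>v\<in>?S. (g v)\<^sup>2) \<le> (\<Sum>e\<in>darts H. max 0 ((g (tl H e))\<^sup>2 - (g (hd H e))\<^sup>2))"
    using fin exp by (intro coarea_inequality[where h = "\<lambda>v. (g v)\<^sup>2"]) (auto simp: g_def)
  also have "(\<Sum>v\<in>?S. (g v)\<^sup>2) = N"
    unfolding N_def using fin by (intro sum.mono_neutral_left) (auto simp: g_def)
  also have "(\<Sum>e\<in>darts H. max 0 ((g (tl H e))\<^sup>2 - (g (hd H e))\<^sup>2))
      \<le> (\<Sum>e\<in>darts H. \<bar>g (tl H e) - g (hd H e)\<bar> * (g (tl H e) + g (hd H e)))"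
  proof (rule sum_mono)
    fix e
    have "(g (tl H e))\<^sup>2 - (g (hd H e))\<^sup>2 = (g (tl H e) - g (hd H e)) * (g (tl H e) + g (hd H e))"
      by (simp add: power2_eq_square algebra_simps)
    also have "\<dots> \<le> \<bar>g (tl H e) - g (hd H e)\<bar> * (g (tl H e) + g (hd H e))"
      using g0 by (intro mult_right_mono) (auto intro: add_nonneg_nonneg)
    finally show "max 0 ((g (tl H e))\<^sup>2 - (g (hd H e))\<^sup>2) \<le> \<bar>g (tl H e) - g (hd H e)\<bar> * (g (tl H e) + g (hd H e))"
      using g0 by (auto intro!: mult_nonneg_nonneg add_nonneg_nonneg)
  qed
  finally have "(\<gamma> * N)\<^sup>2 \<le> (\<Sum>e\<in>darts H. \<bar>g (tl H e) - g (hd H e)\<bar> * (g (tl H e) + g (hd H e)))\<^sup>2"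
    using \<gamma>(1) N by (intro power_mono) auto
  also have "\<dots> \<le> (\<Sum>e\<in>darts H. \<bar>g (tl H e) - g (hd H e)\<bar>\<^sup>2) * (\<Sum>e\<in>darts H. (g (tl H e) + g (hd H e))\<^sup>2)"
    by (rule sum_mult_square_le)
  also have "\<dots> \<le> (2 * \<epsilon> * N) * (4 * real d * N)"
  proof (rule mult_mono)
    have gtl: "(\<Sum>e\<in>darts H. (g (tl H e))\<^sup>2) = real d * N" "(\<Sum>e\<in>darts H. (g (hd H e))\<^sup>2) = real d * N"
      unfolding N_def by (rule sum_tail_regular[OF wf reg], rule sum_head_regular[OF wf reg])
    have "\<mu> * N = (\<Sum>v\<in>verts H. g v * (\<mu> * f v))"
      unfolding N_def by (simp add: sum_distrib_left) (intro sum.cong, auto simp: g_def power2_eq_square)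
    also have "\<dots> = (\<Sum>v\<in>verts H. g v * (\<Sum>e\<in>{e \<in> darts H. tl H e = v}. f (hd H e)))"
      using f by (intro sum.cong) (auto simp: eigenfunction_def)
    also have "\<dots> \<le> (\<Sum>v\<in>verts H. g v * (\<Sum>e\<in>{e \<in> darts H. tl H e = v}. g (hd H e)))"
      using wfr g0 by (intro sum_mono mult_left_mono) (auto simp: g_def)
    also have "\<dots> = (\<Sum>e\<in>darts H. g (tl H e) * g (hd H e))"
      unfolding sum_group_by_tail[OF wf, of "\<lambda>e. g (tl H e) * g (hd H e)"] by (simp add: sum_distrib_left)
    finally have cross: "\<mu> * N \<le> (\<Sum>e\<in>darts H. g (tl H e) * g (hd H e))" .
    have "(\<Sum>e\<in>darts H. \<bar>g (tl H e) - g (hd H e)\<bar>\<^sup>2)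
        = (\<Sum>e\<in>darts H. (g (tl H e))\<^sup>2 + (g (hd H e))\<^sup>2 - 2 * (g (tl H e) * g (hd H e)))"
      by (intro sum.cong) (auto simp: power2_diff)
    also have "\<dots> = 2 * real d * N - 2 * (\<Sum>e\<in>darts H. g (tl H e) * g (hd H e))"
      by (simp add: sum.distrib sum_subtractf gtl sum_distrib_left)
    also have "\<dots> \<le> 2 * real d * N - 2 * (\<mu> * N)" using cross by simp
    also have "\<dots> = 2 * (real d - \<mu>) * N" by (simp add: algebra_simps)
    also have "\<dots> \<le> 2 * \<epsilon> * N" using \<mu> N by (intro mult_right_mono) auto
    finally show D: "(\<Sum>e\<in>darts H. \<bar>g (tl H e) - g (hd H e)\<bar>\<^sup>2) \<le> 2 * \<epsilon> * N" .
    have "0 \<le> (\<Sum>e\<in>darts H. \<bar>g (tl H e) - g (hd H e)\<bar>\<^sup>2)" by (intro sum_nonneg) auto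
    thus "0 \<le> 2 * \<epsilon> * N" using D by linarith
    have "(\<Sum>e\<in>darts H. (g (tl H e) + g (hd H e))\<^sup>2) \<le> (\<Sum>e\<in>darts H. 2 * (g (tl H e))\<^sup>2 + 2 * (g (hd H e))\<^sup>2)"
    proof (rule sum_mono)
      fix e
      have "0 \<le> (g (tl H e) - g (hd H e))\<^sup>2" by simp
      thus "(g (tl H e) + g (hd H e))\<^sup>2 \<le> 2 * (g (tl H e))\<^sup>2 + 2 * (g (hd H e))\<^sup>2"
        by (simp add: power2_sum power2_diff)
    qed
    also have "\<dots> = 4 * real d * N" by (simp add: sum.distrib gtl flip: sum_distrib_left)
    finally show "(\<Sum>e\<in>darts H. (g (tl H e) + g (hd H e))\<^sup>2) \<le> 4 * real d * N" .
  qed (auto intro: sum_nonneg)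
  finally have "\<gamma>\<^sup>2 * N\<^sup>2 \<le> (8 * real d * \<epsilon>) * N\<^sup>2" by (simp add: power_mult_distrib power2_eq_square mult_ac)
  hence "\<gamma>\<^sup>2 \<le> 8 * real d * \<epsilon>" using N by simp
  thus False using \<gamma>(2) by linarith
qed

section \<open>Sections of a vertex set in a lift\<close>

definition compatible_perms :: "('v, 'e) mgraph \<Rightarrow> nat \<Rightarrow> ('e \<Rightarrow> nat \<Rightarrow> nat) \<Rightarrow> bool" where
  "compatible_perms H n \<sigma> \<longleftrightarrow>
     (\<forall>e\<in>darts H. \<sigma> e permutes {..<n} \<and> \<sigma> (rev H e) = Hilbert_Choice.inv (\<sigma> e))"

lemma lift_sel [simp]:
  "verts (lift B n \<sigma>) = verts B \<times> {..<n}" "darts (lift B n \<sigma>) = darts B \<times> {..<n}"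
  "tl (lift B n \<sigma>) = (\<lambda>(e, i). (tl B e, i))" "hd (lift B n \<sigma>) = (\<lambda>(e, i). (hd B e, \<sigma> e i))"
  "rev (lift B n \<sigma>) = (\<lambda>(e, i). (rev B e, \<sigma> e i))"
  by (simp_all add: lift_def)

lemma compatible_perms_rev:
  assumes "compatible_perms H n \<sigma>" "e \<in> darts H"
  shows "\<sigma> (rev H e) (\<sigma> e i) = i" "\<sigma> e i \<in> {..<n} \<longleftrightarrow> i \<in> {..<n}"
  using assms permutes_in_image[of "\<sigma> e" "{..<n}" i]
  by (auto simp: compatible_perms_def permutes_inverses)

lemma wf_graph_lift:
  assumes wf: "wf_graph H" and \<sigma>: "compatible_perms H n \<sigma>"
  shows "wf_graph (lift H n \<sigma>)"
  using wf compatible_perms_rev[OF \<sigma>] unfolding wf_graph_def by auto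

lemma regular_lift:
  assumes "regular H d"
  shows "regular (lift H n \<sigma>) d"
proof -
  have "{x \<in> darts H \<times> {..<n}. (case x of (e, i) \<Rightarrow> (tl H e, i)) = (v, j)} = {e \<in> darts H. tl H e = v} \<times> {j}"
    if "j < n" for v j using that by auto
  thus ?thesis using assms by (auto simp: regular_def degree_def card_cartesian_product)
qed

definition fiber_section :: "('v \<times> nat) set \<Rightarrow> 'v \<Rightarrow> nat set" where
  "fiber_section U v = {i. (v, i) \<in> U}"

definition inner_section :: "('v, 'e) mgraph \<Rightarrow> ('e \<Rightarrow> nat \<Rightarrow> nat) \<Rightarrow> ('v \<times> nat) set \<Rightarrow> 'e \<Rightarrow> nat set" where
  "inner_section H \<sigma> U e = {i. (tl H e, i) \<in> U \<and> (hd H e, \<sigma> e i) \<in> U}"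

lemma inner_section_subset: "inner_section H \<sigma> U e \<subseteq> fiber_section U (tl H e)"
  by (auto simp: inner_section_def fiber_section_def)

lemma fiber_section_subset: "U \<subseteq> verts (lift H n \<sigma>) \<Longrightarrow> fiber_section U v \<subseteq> {..<n}"
  by (auto simp: fiber_section_def)

text \<open>An edge with both ends in \<open>U\<close> keeps them when reversed. This yields the
  exact equalities demanded by \<open>maps_pair\<close>, although \<open>\<sigma> e\<close> maps the
  full sections onto each other only approximately.\<close>

lemma inner_section_rev:
  assumes wf: "wf_graph H" and \<sigma>: "compatible_perms H n \<sigma>" and e: "e \<in> darts H"
  shows "\<sigma> e ` inner_section H \<sigma> U e = inner_section H \<sigma> U (rev H e)"
proof -
  have sub: "\<sigma> e ` inner_section H \<sigma> U e \<subseteq> inner_section H \<sigma> U (rev H e)" if "e \<in> darts H" for e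
    using wf_graph_rev[OF wf that] compatible_perms_rev[OF \<sigma> that] by (auto simp: inner_section_def)
  note r = wf_graph_rev[OF wf e]
  have "inner_section H \<sigma> U (rev H e) \<subseteq> \<sigma> e ` inner_section H \<sigma> U e"
  proof
    fix i assume "i \<in> inner_section H \<sigma> U (rev H e)"
    hence "\<sigma> (rev H e) i \<in> inner_section H \<sigma> U e" using sub[OF r(1)] r by auto
    moreover have "i = \<sigma> e (\<sigma> (rev H e) i)" using compatible_perms_rev(1)[OF \<sigma> r(1)] r by simp
    ultimately show "i \<in> \<sigma> e ` inner_section H \<sigma> U e" by blast
  qed
  thus ?thesis using sub[OF e] by blast
qed

lemma card_outer_section_le:
  assumes fin: "finite (darts H)" and U: "U \<subseteq> verts (lift H n \<sigma>)" and e: "e \<in> darts H"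
  shows "card (fiber_section U (tl H e) - inner_section H \<sigma> U e) \<le> card (boundary (lift H n \<sigma>) U)"
proof (rule card_inj_on_le[where f = "\<lambda>i. (e, i)"])
  show "(\<lambda>i. (e, i)) ` (fiber_section U (tl H e) - inner_section H \<sigma> U e) \<subseteq> boundary (lift H n \<sigma>) U"
    using U e by (auto simp: boundary_def fiber_section_def inner_section_def)
  show "finite (boundary (lift H n \<sigma>) U)" using fin by (intro finite_boundary) simp
qed (auto simp: inj_on_def)

text \<open>Points of the section at \<open>u\<close> either stay in \<open>U\<close> along the
  edge, and then inject into the section at \<open>v\<close>, or give distinct boundary
  edges.\<close>

lemma card_fiber_section_adj:
  assumes wf: "wf_graph H" and \<sigma>: "compatible_perms H n \<sigma>" and U: "U \<subseteq> verts (lift H n \<sigma>)"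
    and adj: "adj H u v"
  shows "card (fiber_section U u) \<le> card (fiber_section U v) + card (boundary (lift H n \<sigma>) U)"
proof -
  obtain e where e: "e \<in> darts H" "tl H e = u" "hd H e = v" using adj by (auto simp: adj_def)
  have finu: "finite (fiber_section U w)" for w using fiber_section_subset[OF U] by (rule finite_subset) simp
  let ?I = "inner_section H \<sigma> U e"
  have "card ?I \<le> card (fiber_section U v)"
  proof (rule card_inj_on_le[where f = "\<sigma> e"])
    show "inj_on (\<sigma> e) ?I" using \<sigma> e by (auto simp: compatible_perms_def intro: inj_on_subset[OF permutes_inj])
    show "\<sigma> e ` ?I \<subseteq> fiber_section U v" using e by (auto simp: inner_section_def fiber_section_def)
  qed (rule finu)
  moreover have "card (fiber_section U u) = card ?I + card (fiber_section U u - ?I)"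
    using inner_section_subset[of H \<sigma> U e] e finu[of u]
    by (metis card_Diff_subset card_mono finite_subset le_add_diff_inverse)
  moreover have "card (fiber_section U u - ?I) \<le> card (boundary (lift H n \<sigma>) U)"
    using card_outer_section_le[OF _ U e(1)] wf e by (simp add: wf_graph_def)
  ultimately show ?thesis by linarith
qed

lemma card_fiber_section_path:
  assumes wf: "wf_graph H" and \<sigma>: "compatible_perms H n \<sigma>" and U: "U \<subseteq> verts (lift H n \<sigma>)"
    and path: "(adj H ^^ k) u v"
  shows "card (fiber_section U u) \<le> card (fiber_section U v) + k * card (boundary (lift H n \<sigma>) U)"
  using path
proof (induction k arbitrary: v)
  case (Suc k)
  then obtain w where "(adj H ^^ k) u w" "adj H w v" by auto
  with Suc.IH[of w] card_fiber_section_adj[OF wf \<sigma> U, of w v] show ?case by simp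
qed auto

lemma connected_graph_bounded_paths:
  assumes wf: "wf_graph H" and conn: "connected_graph H"
  obtains L :: nat where "\<And>u v. u \<in> verts H \<Longrightarrow> v \<in> verts H \<Longrightarrow> \<exists>k\<le>L. (adj H ^^ k) u v"
proof -
  have "\<exists>k. (adj H ^^ k) u v" if "u \<in> verts H" "v \<in> verts H" for u v
    using conn that by (metis connected_graph_def rtranclp_imp_relpowp)
  then obtain K where K: "\<And>u v. u \<in> verts H \<Longrightarrow> v \<in> verts H \<Longrightarrow> (adj H ^^ K u v) u v" by metis
  let ?S = "(\<lambda>(u, v). K u v) ` (verts H \<times> verts H)"
  have "finite ?S" using wf by (simp add: wf_graph_def)
  hence "K u v \<le> Max ?S" if "u \<in> verts H" "v \<in> verts H" for u v using that by (intro Max_ge) auto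
  thus ?thesis using K by (intro that[of "Max ?S"]) blast
qed

lemma card_eq_sum_fiber_sections:
  assumes fin: "finite (verts H)" and U: "U \<subseteq> verts (lift H n \<sigma>)"
  shows "card U = (\<Sum>v\<in>verts H. card (fiber_section U v))"
proof -
  have "U = (SIGMA v : verts H. fiber_section U v)" using U by (auto simp: fiber_section_def)
  moreover have "finite (fiber_section U v)" for v using fiber_section_subset[OF U] by (rule finite_subset) simp
  ultimately show ?thesis using card_SigmaI[OF fin, of "fiber_section U"] by metis
qed

definition nearly_invariant :: "('v, 'e) mgraph \<Rightarrow> nat \<Rightarrow> ('e \<Rightarrow> nat \<Rightarrow> nat) \<Rightarrow> nat \<Rightarrow> ('v \<times> nat) set \<Rightarrow> bool" where
  "nearly_invariant H n \<sigma> k0 U \<longleftrightarrow>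
     (\<forall>v\<in>verts H. k0 \<le> card (fiber_section U v) \<and> 3 * card (fiber_section U v) \<le> 2 * n) \<and>
     (\<forall>e\<in>darts H. inner_section H \<sigma> U e \<in> near_subsets (fiber_section U (tl H e)))"

text \<open>The thresholds \<open>\<gamma>\<close> and \<open>r\<close> depend on \<open>H\<close>
  and \<open>k0\<close> but not on \<open>n\<close> and \<open>\<sigma>\<close>, as the theorem
  requires. A lower bound on \<open>card U\<close> is demanded only for an empty boundary, where the
  bound on component sizes supplies it.\<close>

definition sparse_sets_nearly_invariant :: "('v, 'e) mgraph \<Rightarrow> nat \<Rightarrow> real \<Rightarrow> nat \<Rightarrow> bool" where
  "sparse_sets_nearly_invariant H k0 \<gamma> r \<longleftrightarrow>
     (\<forall>n \<sigma> U. compatible_perms H n \<sigma> \<longrightarrow> U \<subseteq> verts (lift H n \<sigma>) \<longrightarrow> U \<noteq> {} \<longrightarrow>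
       2 * card U \<le> card (verts H) * n \<longrightarrow> real (card (boundary (lift H n \<sigma>) U)) \<le> \<gamma> * real (card U) \<longrightarrow>
       (boundary (lift H n \<sigma>) U = {} \<longrightarrow> r \<le> card U) \<longrightarrow> nearly_invariant H n \<sigma> k0 U)"

lemma sparse_sets_nearly_invariantD:
  assumes "sparse_sets_nearly_invariant H k0 \<gamma> r" "compatible_perms H n \<sigma>" "U \<subseteq> verts (lift H n \<sigma>)" "U \<noteq> {}"
    "2 * card U \<le> card (verts (lift H n \<sigma>))" "real (card (boundary (lift H n \<sigma>) U)) \<le> \<gamma>' * real (card U)" "\<gamma>' \<le> \<gamma>"
    "boundary (lift H n \<sigma>) U = {} \<Longrightarrow> r \<le> card U"
  shows "nearly_invariant H n \<sigma> k0 U"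
proof -
  have "\<gamma>' * real (card U) \<le> \<gamma> * real (card U)" using assms(7) by (intro mult_right_mono) auto
  hence "real (card (boundary (lift H n \<sigma>) U)) \<le> \<gamma> * real (card U)" using assms(6) by linarith
  moreover have "2 * card U \<le> card (verts H) * n" using assms(5) by (simp add: card_cartesian_product)
  ultimately show ?thesis using assms(1-4,8) unfolding sparse_sets_nearly_invariant_def by blast
qed

text \<open>Along a path of length at most \<open>L\<close>, section sizes change by at most
  \<open>L\<close> times the boundary, which is at most a quarter of the average
  \<open>K / m\<close>. Every section thus has between 3/4 and 5/4 of the average size, hence at
  most \<open>5 * n / 8\<close> points, and the points lost along one edge are few compared with any
  section.\<close>

lemma connected_sparse_sets_nearly_invariant:
  assumes wf: "wf_graph H" and conn: "connected_graph H" and k0: "k0 \<ge> 1"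
  shows "\<exists>\<gamma>>0. \<exists>r. sparse_sets_nearly_invariant H k0 \<gamma> r"
proof -
  obtain L where L: "\<And>u v. u \<in> verts H \<Longrightarrow> v \<in> verts H \<Longrightarrow> \<exists>k\<le>L. (adj H ^^ k) u v"
    using connected_graph_bounded_paths[OF wf conn] by metis
  have fin: "finite (verts H)" "finite (darts H)" using wf by (simp_all add: wf_graph_def)
  define m where "m = card (verts H)"
  have m: "m \<ge> 1" using conn fin by (simp add: m_def connected_graph_def Suc_le_eq card_gt_0_iff)
  \<comment> \<open>With \<open>K \<ge> r\<close> the lower bound on a section becomes
    \<open>3 * r / (4 * m) = 3 * k0 / 2\<close>.\<close>
  define r where "r = 2 * m * k0"
  have r: "r \<ge> 1" using m k0 by (simp add: r_def)
  \<comment> \<open>The factor \<open>r\<close> gives \<open>\<gamma> * r \<le> 1\<close>, the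
    factor \<open>L + 1\<close> pays for paths and for a single edge even if \<open>L = 0\<close>,
    and \<open>slack / (4 * m)\<close> measures the loss against a quarter of the average
    section.\<close>
  define \<gamma> where "\<gamma> = slack / (4 * real m * real (L + 1) * real r)"
  have sl: "0 < slack" "slack \<le> 1" by (simp_all add: slack_def)
  have \<gamma>: "\<gamma> > 0" using sl m r by (simp add: \<gamma>_def)
  have one_le: "1 \<le> real x" if "x \<ge> 1" for x :: nat using that by simp
  have \<gamma>r: "\<gamma> * real r \<le> 1"
  proof -
    have "\<gamma> * real r = slack / (4 * real m * real (L + 1))" using r by (simp add: \<gamma>_def)
    also have "\<dots> \<le> 1 / 1" using sl m by (intro frac_le) (auto intro: mult_ge1_I)
    finally show ?thesis by simp
  qed
  have \<gamma>L: "(real L + 1) * \<gamma> \<le> slack / (4 * real m)"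
  proof -
    define l where "l = real L + 1"
    have l: "l > 0" "\<gamma> = slack / (4 * real m * l * real r)" by (simp_all add: l_def \<gamma>_def add.commute)
    have "(real L + 1) * \<gamma> = slack / (4 * real m * real r)"
      unfolding l_def[symmetric] l(2) using l(1) by simp
    also have "\<dots> \<le> slack / (4 * real m * 1)" using sl m r by (intro divide_left_mono mult_left_mono) auto
    finally show ?thesis by simp
  qed
  show ?thesis unfolding sparse_sets_nearly_invariant_def
  proof (rule exI[of _ \<gamma>], rule conjI[OF \<gamma>], rule exI[of _ r], intro allI impI)
    fix n \<sigma> U
    assume \<sigma>: "compatible_perms H n \<sigma>" and U: "U \<subseteq> verts (lift H n \<sigma>)" and ne: "U \<noteq> {}"
      and half: "2 * card U \<le> card (verts H) * n"
      and bd: "real (card (boundary (lift H n \<sigma>) U)) \<le> \<gamma> * real (card U)"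
      and comp: "boundary (lift H n \<sigma>) U = {} \<longrightarrow> r \<le> card U"
    define K where "K = real (card U)"
    define s where "s = real (card (boundary (lift H n \<sigma>) U))"
    define c where "c = (\<lambda>v. real (card (fiber_section U v)))"
    have sK: "s \<le> \<gamma> * K" using bd by (simp add: s_def K_def)
    have s0: "s \<ge> 0" by (simp add: s_def)
    have K0: "K \<ge> 0" by (simp add: K_def)
    \<comment> \<open>A nonempty boundary has at least one element, and then sparsity together with
      \<open>\<gamma> * r \<le> 1\<close> already forces \<open>U\<close> to be large.\<close>
    have Kr: "K \<ge> real r"
    proof (cases "boundary (lift H n \<sigma>) U = {}")
      case True thus ?thesis using comp by (simp add: K_def)
    next
      case False
      have "finite (boundary (lift H n \<sigma>) U)" using fin by (intro finite_boundary) simp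
      hence "1 \<le> card (boundary (lift H n \<sigma>) U)" using False by (simp add: Suc_le_eq card_gt_0_iff)
      hence "1 \<le> s" by (simp add: s_def)
      hence "\<gamma> * real r \<le> \<gamma> * K" using sK \<gamma>r by linarith
      thus ?thesis using \<gamma> by simp
    qed
    have K: "K = (\<Sum>v\<in>verts H. c v)"
      unfolding K_def c_def card_eq_sum_fiber_sections[OF fin(1) U] by simp
    have Ls: "(real L + 1) * s \<le> slack * K / (4 * real m)"
    proof -
      have "(real L + 1) * s \<le> (real L + 1) * (\<gamma> * K)" using sK by (intro mult_left_mono) auto
      also have "\<dots> \<le> slack / (4 * real m) * K" using mult_right_mono[OF \<gamma>L K0] by (simp add: mult_ac)
      finally show ?thesis by simp
    qed
    have Ls': "real L * s \<le> K / (4 * real m)"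
    proof -
      have "real L * s \<le> (real L + 1) * s" using s0 by (intro mult_right_mono) auto
      also have "\<dots> \<le> slack * K / (4 * real m)" by (rule Ls)
      also have "\<dots> \<le> K / (4 * real m)" using sl K0 m by (intro divide_right_mono) (auto intro: mult_left_le_one_le)
      finally show ?thesis .
    qed
    have cmp: "c u \<le> c v + K / (4 * real m)" if "u \<in> verts H" "v \<in> verts H" for u v
    proof -
      note uv = that
      obtain k where k: "k \<le> L" "(adj H ^^ k) u v" using L[OF uv] by auto
      have "card (fiber_section U u) \<le> card (fiber_section U v) + k * card (boundary (lift H n \<sigma>) U)"
        by (rule card_fiber_section_path[OF wf \<sigma> U k(2)])
      hence "real (card (fiber_section U u)) \<le> real (card (fiber_section U v) + k * card (boundary (lift H n \<sigma>) U))"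
        by (rule of_nat_mono)
      hence "c u \<le> c v + real k * s" by (simp add: c_def s_def)
      also have "real k * s \<le> real L * s" using k s0 by (intro mult_right_mono) auto
      finally show ?thesis using Ls' by linarith
    qed
    have mK: "real m * (K / (4 * real m)) = K / 4" using m by simp
    have low: "3 * K / (4 * real m) \<le> c v" if v: "v \<in> verts H" for v
    proof -
      have "K = (\<Sum>u\<in>verts H. c u)" by (rule K)
      also have "\<dots> \<le> (\<Sum>u\<in>verts H. c v + K / (4 * real m))"
        using cmp v by (intro sum_mono) auto
      also have "\<dots> = real m * c v + K / 4" using mK by (simp add: m_def algebra_simps)
      finally have "3 * K / 4 \<le> real m * c v" by simp
      thus ?thesis using m by (simp add: field_simps)
    qed
    have up: "c u \<le> 5 * K / (4 * real m)" if u: "u \<in> verts H" for u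
    proof -
      have "(\<Sum>v\<in>verts H. c u) \<le> (\<Sum>v\<in>verts H. c v + K / (4 * real m))" using cmp u by (intro sum_mono) auto
      also have "\<dots> = K + K / 4" using mK by (simp add: sum.distrib K[symmetric] m_def)
      finally have "real m * c u \<le> 5 * K / 4" by (simp add: m_def)
      thus ?thesis using m by (simp add: field_simps)
    qed
    have Kn: "K \<le> real m * real n / 2"
    proof -
      have "real (2 * card U) \<le> real (card (verts H) * n)" using half by (rule of_nat_mono)
      thus ?thesis by (simp add: K_def m_def)
    qed
    have "k0 \<le> card (fiber_section U v) \<and> 3 * card (fiber_section U v) \<le> 2 * n" if v: "v \<in> verts H" for v
    proof
      have "real k0 \<le> 3 * real r / (4 * real m)" using m by (simp add: r_def)
      also have "\<dots> \<le> 3 * K / (4 * real m)" using Kr m by (intro divide_right_mono) auto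
      also have "\<dots> \<le> c v" by (rule low[OF v])
      finally show "k0 \<le> card (fiber_section U v)" by (simp add: c_def)
      have "c v \<le> 5 * K / (4 * real m)" by (rule up[OF v])
      also have "\<dots> \<le> 5 * (real m * real n / 2) / (4 * real m)" using Kn m by (intro divide_right_mono) auto
      also have "\<dots> = 5 * real n / 8" using m by simp
      finally have "3 * c v \<le> 2 * real n" by simp
      hence "real (3 * card (fiber_section U v)) \<le> real (2 * n)" by (simp add: c_def)
      thus "3 * card (fiber_section U v) \<le> 2 * n" by (simp only: of_nat_le_iff)
    qed
    moreover have "inner_section H \<sigma> U e \<in> near_subsets (fiber_section U (tl H e))" if e: "e \<in> darts H" for e
    proof -
      have "real (card (fiber_section U (tl H e) - inner_section H \<sigma> U e)) \<le> s"
        unfolding s_def using card_outer_section_le[OF fin(2) U e] by (rule of_nat_mono)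
      also have "s \<le> (real L + 1) * s" using s0 by (simp add: algebra_simps)
      also have "\<dots> \<le> slack * K / (4 * real m)" by (rule Ls)
      also have "\<dots> \<le> slack * (3 * K / (4 * real m))" using sl K0 m by (simp add: field_simps)
      also have "\<dots> \<le> slack * c (tl H e)" using sl low wf_graph_rev(5)[OF wf e] by (intro mult_left_mono) auto
      finally show ?thesis by (simp add: near_subsets_def c_def inner_section_subset)
    qed
    ultimately show "nearly_invariant H n \<sigma> k0 U" unfolding nearly_invariant_def by blast
  qed
qed

section \<open>Deflating symmetric matrices\<close>

lemma sum_upt_Suc_shift: "(\<Sum>i\<in>{0..<Suc k}. f i) = f 0 + (\<Sum>i\<in>{0..<k}. f (Suc i))"
  by (simp add: sum.atLeast0_lessThan_Suc_shift comp_def del: sum.op_ivl_Suc)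

lemma mult_mat_zero_vec: "(P :: real mat) \<in> carrier_mat n n \<Longrightarrow> P *\<^sub>v 0\<^sub>v n = 0\<^sub>v n"
  by (rule eq_vecI) auto

lemma mult_mat_vec_involution:
  fixes P :: "real mat"
  assumes "P \<in> carrier_mat n n" "P * P = 1\<^sub>m n" "x \<in> carrier_vec n"
  shows "P *\<^sub>v (P *\<^sub>v x) = x"
  using assms by (subst assoc_mult_mat_vec[symmetric, of P n n P n]) auto

lemma symmetric_mat_scalar_prod:
  fixes P :: "real mat"
  assumes "P \<in> carrier_mat n n" "P\<^sup>T = P" "x \<in> carrier_vec n" "z \<in> carrier_vec n"
  shows "(P *\<^sub>v x) \<bullet> z = x \<bullet> (P *\<^sub>v z)"
  using transpose_vec_mult_scalar[OF assms(1,3,4)] assms by (metis comm_scalar_prod mult_mat_vec_carrier)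

definition pad_zero :: "real vec \<Rightarrow> real vec" where
  "pad_zero y = vec (Suc (dim_vec y)) (\<lambda>i. if i = 0 then 0 else y $ (i - 1))"

text \<open>The reflection exchanging a unit vector \<open>u\<close> with \<open>e\<^sub>0\<close>; for \<open>u = e\<^sub>0\<close> the quotient is \<open>0 / 0 = 0\<close>
  and this is the identity.\<close>
definition householder :: "nat \<Rightarrow> real vec \<Rightarrow> real mat" where
  "householder n u = mat n n (\<lambda>(i, j). (if i = j then 1 else 0)
     + (u $ i - (if i = 0 then 1 else 0)) * (u $ j - (if j = 0 then 1 else 0)) / (u $ 0 - 1))"

text \<open>For \<open>w = u - e0\<close>, with \<open>e0\<close> the first unit vector, the squared
  norm of \<open>w\<close> is \<open>- 2 * w 0\<close>, so \<open>w i * w j / w 0\<close> is the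
  usual reflection term. If \<open>w 0 = 0\<close>, the norm vanishes and hence all of
  \<open>w\<close>, so the division by zero is harmless.\<close>

lemma householder_properties:
  assumes u: "u \<in> carrier_vec (Suc k)" "u \<bullet> u = 1"
  defines "P \<equiv> householder (Suc k) u"
  shows "P \<in> carrier_mat (Suc k) (Suc k)" "P\<^sup>T = P" "P * P = 1\<^sub>m (Suc k)" "col P 0 = u"
proof -
  let ?n = "Suc k"
  define w where "w = (\<lambda>i. u $ i - (if i = 0 then 1 else 0 :: real))"
  have dim[simp]: "dim_vec u = ?n" using u by auto
  have P: "P = mat ?n ?n (\<lambda>(i, j). (if i = j then 1 else 0) + w i * w j / w 0)"
    by (simp add: P_def householder_def w_def)
  have "1 = (\<Sum>i\<in>{0..<?n}. u $ i * u $ i)" using u by (simp add: scalar_prod_def)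
  also have "\<dots> = u $ 0 * u $ 0 + (\<Sum>i\<in>{0..<k}. u $ Suc i * u $ Suc i)"
    by (rule sum_upt_Suc_shift)
  finally have us: "(\<Sum>i\<in>{0..<k}. u $ Suc i * u $ Suc i) = 1 - u $ 0 * u $ 0" by simp
  have "(\<Sum>i\<in>{0..<?n}. w i * w i) = w 0 * w 0 + (\<Sum>i\<in>{0..<k}. w (Suc i) * w (Suc i))"
    by (rule sum_upt_Suc_shift)
  also have "\<dots> = - 2 * w 0" using us by (simp add: w_def algebra_simps)
  finally have ws: "(\<Sum>i\<in>{0..<?n}. w i * w i) = - 2 * w 0" .
  have w0: "w i = 0" if "w 0 = 0" "i < ?n" for i
  proof -
    have "(\<Sum>i\<in>{0..<?n}. w i * w i) = 0" using ws that by simp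
    hence "\<forall>i\<in>{0..<?n}. w i * w i = 0" by (subst (asm) sum_nonneg_eq_0_iff) auto
    thus ?thesis using that by auto
  qed
  show c: "P \<in> carrier_mat ?n ?n" by (simp add: P)
  show "P\<^sup>T = P" by (rule eq_matI) (auto simp: P)
  show "col P 0 = u"
  proof (rule eq_vecI)
    fix i assume "i < dim_vec u"
    hence i: "i < ?n" by simp
    have "col P 0 $ i = (if i = 0 then 1 else 0) + w i * w 0 / w 0" using i by (simp add: P)
    also have "\<dots> = (if i = 0 then 1 else 0) + w i" using w0[OF _ i] by auto
    finally show "col P 0 $ i = u $ i" by (simp add: w_def)
  qed (simp add: P)
  show "P * P = 1\<^sub>m ?n"
  proof (rule eq_matI)
    fix i j assume "i < dim_row (1\<^sub>m ?n :: real mat)" "j < dim_col (1\<^sub>m ?n :: real mat)"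
    hence ij: "i < ?n" "j < ?n" by auto
    let ?d = "\<lambda>a b. if a = b then 1 else 0 :: real"
    have "(P * P) $$ (i, j) = (\<Sum>l\<in>{0..<?n}. (?d i l + w i * w l / w 0) * (?d l j + w l * w j / w 0))"
      using ij by (simp add: P scalar_prod_def)
    also have "\<dots> = (\<Sum>l\<in>{0..<?n}. ?d i l * ?d l j + ?d i l * (w l * w j / w 0) + ?d l j * (w i * w l / w 0) + (w i * w j / (w 0 * w 0)) * (w l * w l))"
      by (intro sum.cong refl) (simp add: algebra_simps)
    also have "\<dots> = (\<Sum>l\<in>{0..<?n}. ?d i l * ?d l j) + (\<Sum>l\<in>{0..<?n}. ?d i l * (w l * w j / w 0))
        + (\<Sum>l\<in>{0..<?n}. ?d l j * (w i * w l / w 0)) + (w i * w j / (w 0 * w 0)) * (\<Sum>l\<in>{0..<?n}. w l * w l)"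
      by (simp only: sum.distrib sum_distrib_left)
    also have "(\<Sum>l\<in>{0..<?n}. ?d i l * ?d l j) = ?d i j"
      using ij by (subst sum.remove[of _ i]) (auto intro!: sum.neutral)
    also have "(\<Sum>l\<in>{0..<?n}. ?d i l * (w l * w j / w 0)) = w i * w j / w 0"
      using ij by (subst sum.remove[of _ i]) (auto intro!: sum.neutral)
    also have "(\<Sum>l\<in>{0..<?n}. ?d l j * (w i * w l / w 0)) = w i * w j / w 0"
      using ij by (subst sum.remove[of _ j]) (auto intro!: sum.neutral)
    also have "?d i j + w i * w j / w 0 + w i * w j / w 0 + (w i * w j / (w 0 * w 0)) * (\<Sum>l\<in>{0..<?n}. w l * w l) = ?d i j"
      unfolding ws using w0[OF _ ij(1)] by (cases "w 0 = 0") auto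
    finally show "(P * P) $$ (i, j) = 1\<^sub>m ?n $$ (i, j)" using ij by simp
  qed (simp_all add: P)
qed

text \<open>\<open>A'\<close> is \<open>A\<close> on the orthogonal complement of \<open>v\<close>,
  in the coordinates given by \<open>P\<close> and \<open>pad_zero\<close>. The factorisation of the
  characteristic polynomial accounts for multiplicities; the coordinates are recorded so that
  eigenvectors of \<open>A'\<close> can be carried back and a second eigenvector of \<open>A\<close>
  carried over.\<close>

definition deflation :: "nat \<Rightarrow> real mat \<Rightarrow> real vec \<Rightarrow> real \<Rightarrow> real mat \<Rightarrow> real mat \<Rightarrow> bool" where
  "deflation k A v c A' P \<longleftrightarrow> A' \<in> carrier_mat k k \<and> A'\<^sup>T = A' \<and> char_poly A = [:- c, 1:] * char_poly A' \<and>
     P \<in> carrier_mat (Suc k) (Suc k) \<and> P\<^sup>T = P \<and> P * P = 1\<^sub>m (Suc k) \<and>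
     (\<forall>y\<in>carrier_vec k. A *\<^sub>v (P *\<^sub>v pad_zero y) = P *\<^sub>v pad_zero (A' *\<^sub>v y) \<and> (P *\<^sub>v pad_zero y) \<bullet> v = 0) \<and>
     (\<forall>x\<in>carrier_vec (Suc k). x \<bullet> v = 0 \<longrightarrow> (\<exists>y\<in>carrier_vec k. x = P *\<^sub>v pad_zero y))"

lemma pad_zero_carrier: "y \<in> carrier_vec k \<Longrightarrow> pad_zero y \<in> carrier_vec (Suc k)"
  by (simp add: pad_zero_def)

text \<open>Conjugating with the reflection that sends the normalised \<open>v\<close> to the first
  unit vector puts \<open>c\<close> in the corner and zeros below it. Symmetry clears the first row
  as well, and the remaining block is \<open>A'\<close>.\<close>

lemma deflate_symmetric:
  fixes A :: "real mat"
  assumes A: "A \<in> carrier_mat (Suc k) (Suc k)" "A\<^sup>T = A"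
    and v: "v \<in> carrier_vec (Suc k)" "v \<noteq> 0\<^sub>v (Suc k)" "A *\<^sub>v v = c \<cdot>\<^sub>v v"
  shows "\<exists>A' P. deflation k A v c A' P"
proof -
  let ?n = "Suc k"
  have vv: "v \<bullet> v > 0"
  proof -
    have "v \<bullet> v \<noteq> 0"
    proof
      assume "v \<bullet> v = 0"
      hence "\<forall>i\<in>{0..<?n}. v $ i * v $ i = 0"
        using v(1) by (subst (asm) scalar_prod_def, subst (asm) sum_nonneg_eq_0_iff) auto
      hence "v = 0\<^sub>v ?n" using v(1) by (intro eq_vecI) auto
      thus False using v(2) by simp
    qed
    moreover have "v \<bullet> v \<ge> 0" by (simp add: scalar_prod_def sum_nonneg)
    ultimately show ?thesis by simp
  qed
  define s where "s = sqrt (v \<bullet> v)"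
  have s: "s > 0" "s * s = v \<bullet> v" using vv by (simp_all add: s_def)
  define u where "u = (1 / s) \<cdot>\<^sub>v v"
  have u: "u \<in> carrier_vec ?n" using v by (simp add: u_def)
  have vu: "v = s \<cdot>\<^sub>v u" using s by (simp add: u_def smult_smult_assoc)
  have uu: "u \<bullet> u = 1" using v(1) s vv by (simp add: u_def divide_simps)
  have Au: "A *\<^sub>v u = c \<cdot>\<^sub>v u"
    using v A by (simp add: u_def mult_mat_vec[of A ?n ?n] smult_smult_assoc mult.commute)
  define P where "P = householder ?n u"
  note P = householder_properties[OF u uu, folded P_def]
  define B where "B = P * A * P"
  have B: "B \<in> carrier_mat ?n ?n" using P A by (simp add: B_def)
  have Bsym: "B\<^sup>T = B"
    unfolding B_def using P(1,2) A by (simp add: transpose_mult[of _ ?n ?n _ ?n] assoc_mult_mat[of _ ?n ?n _ ?n _ ?n])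
  have PB: "P * B = A * P"
  proof -
    have "P * B = (P * P) * (A * P)" unfolding B_def using P(1) A by (simp add: assoc_mult_mat[of _ ?n ?n _ ?n _ ?n])
    also have "\<dots> = A * P" using P A by (simp del: assoc_mult_mat)
    finally show ?thesis .
  qed
  have PBP: "A = P * B * P"
  proof -
    have "P * B * P = A * (P * P)" unfolding PB using P(1) A by (simp add: assoc_mult_mat[of _ ?n ?n _ ?n _ ?n])
    also have "\<dots> = A" using P A by simp
    finally show ?thesis ..
  qed
  have Pu: "P *\<^sub>v u = unit_vec ?n 0"
  proof -
    have "P *\<^sub>v u = P *\<^sub>v col P 0" by (simp add: P)
    also have "\<dots> = col (P * P) 0" using P(1) by (subst col_mult2[of P ?n ?n P ?n]) auto
    also have "\<dots> = unit_vec ?n 0" using P(3) by simp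
    finally show ?thesis .
  qed
  have colB: "col B 0 = c \<cdot>\<^sub>v unit_vec ?n 0"
  proof -
    have "col B 0 = (P * A) *\<^sub>v u" unfolding B_def using P A by (subst col_mult2[of _ ?n ?n P ?n]) auto
    also have "\<dots> = P *\<^sub>v (A *\<^sub>v u)" using P(1) A u by (intro assoc_mult_mat_vec) auto
    also have "\<dots> = c \<cdot>\<^sub>v unit_vec ?n 0" unfolding Au using P(1) u Pu by (simp add: mult_mat_vec[of P ?n ?n])
    finally show ?thesis .
  qed
  have Bi0: "B $$ (i, 0) = (if i = 0 then c else 0)" if "i < ?n" for i
  proof -
    have "B $$ (i, 0) = col B 0 $ i" using B that by simp
    thus ?thesis unfolding colB using that by simp
  qed
  have B0i: "B $$ (0, i) = (if i = 0 then c else 0)" if "i < ?n" for i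
  proof -
    have "B $$ (0, i) = B\<^sup>T $$ (i, 0)" using B that by simp
    thus ?thesis unfolding Bsym using Bi0[OF that] by simp
  qed
  define A' where "A' = mat k k (\<lambda>(i, j). B $$ (Suc i, Suc j))"
  have A': "A' \<in> carrier_mat k k" by (simp add: A'_def)
  have A'sym: "A'\<^sup>T = A'"
  proof (rule eq_matI)
    fix i j assume "i < dim_row A'" "j < dim_col A'"
    hence ij: "i < k" "j < k" by (simp_all add: A'_def)
    have "B $$ (Suc j, Suc i) = B\<^sup>T $$ (Suc i, Suc j)" using B ij by simp
    thus "A'\<^sup>T $$ (i, j) = A' $$ (i, j)" using ij by (simp add: A'_def Bsym)
  qed (simp_all add: A'_def)
  have Bblock: "B = four_block_mat (mat 1 1 (\<lambda>_. c)) (0\<^sub>m 1 k) (0\<^sub>m k 1) A'"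
  proof (rule eq_matI)
    fix i j assume "i < dim_row (four_block_mat (mat 1 1 (\<lambda>_. c)) (0\<^sub>m 1 k) (0\<^sub>m k 1) A')"
      "j < dim_col (four_block_mat (mat 1 1 (\<lambda>_. c)) (0\<^sub>m 1 k) (0\<^sub>m k 1) A')"
    hence ij: "i < ?n" "j < ?n" by (simp_all add: A'_def)
    show "B $$ (i, j) = four_block_mat (mat 1 1 (\<lambda>_. c)) (0\<^sub>m 1 k) (0\<^sub>m k 1) A' $$ (i, j)"
      using ij Bi0[of i] B0i[of j] by (cases i; cases j) (auto simp: A'_def)
  qed (use B in \<open>simp_all add: A'_def\<close>)
  have "similar_mat A B" by (rule similar_matI[of _ _ P P ?n]) (use A B P PBP in auto)
  hence "char_poly A = char_poly B" by (rule char_poly_similar)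
  also have "\<dots> = char_poly (mat 1 1 (\<lambda>_. c)) * char_poly A'"
    unfolding Bblock by (rule char_poly_four_block_zeros_col) (use A' in auto)
  also have "char_poly (mat 1 1 (\<lambda>_. c)) = [:- c, 1:]"
    by (simp add: char_poly_defs det_single)
  finally have cp: "char_poly A = [:- c, 1:] * char_poly A'" .
  note pad = pad_zero_carrier
  have Bpad: "B *\<^sub>v pad_zero y = pad_zero (A' *\<^sub>v y)" if y: "y \<in> carrier_vec k" for y
  proof (rule eq_vecI)
    fix i assume "i < dim_vec (pad_zero (A' *\<^sub>v y))"
    hence i: "i < ?n" by (simp add: pad_zero_def A'_def)
    have "(B *\<^sub>v pad_zero y) $ i = (\<Sum>j\<in>{0..<?n}. B $$ (i, j) * pad_zero y $ j)"
      using B i y by (simp add: scalar_prod_def pad_zero_def)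
    also have "\<dots> = B $$ (i, 0) * pad_zero y $ 0 + (\<Sum>j\<in>{0..<k}. B $$ (i, Suc j) * pad_zero y $ Suc j)"
      by (rule sum_upt_Suc_shift)
    also have "\<dots> = (\<Sum>j\<in>{0..<k}. B $$ (i, Suc j) * y $ j)" using y by (simp add: pad_zero_def)
    also have "\<dots> = pad_zero (A' *\<^sub>v y) $ i"
    proof (cases i)
      case 0 thus ?thesis using B0i y by (simp add: pad_zero_def A'_def)
    next
      case (Suc i') thus ?thesis using i y by (simp add: pad_zero_def A'_def scalar_prod_def)
    qed
    finally show "(B *\<^sub>v pad_zero y) $ i = pad_zero (A' *\<^sub>v y) $ i" .
  qed (use B in \<open>simp add: pad_zero_def A'_def\<close>)
  note PP = mult_mat_vec_involution[OF P(1,3)] and adjP = symmetric_mat_scalar_prod[OF P(1,2)]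
  have "deflation k A v c A' P" unfolding deflation_def
  proof (intro conjI ballI impI A' A'sym cp P(1-3))
    fix y :: "real vec" assume y: "y \<in> carrier_vec k"
    have "A *\<^sub>v (P *\<^sub>v pad_zero y) = (A * P) *\<^sub>v pad_zero y"
      using A P(1) pad[OF y] by (intro assoc_mult_mat_vec[symmetric]) auto
    also have "\<dots> = P *\<^sub>v (B *\<^sub>v pad_zero y)" unfolding PB[symmetric]
      using B P(1) pad[OF y] by (intro assoc_mult_mat_vec) auto
    finally show "A *\<^sub>v (P *\<^sub>v pad_zero y) = P *\<^sub>v pad_zero (A' *\<^sub>v y)" using Bpad[OF y] by simp
    have "(P *\<^sub>v pad_zero y) \<bullet> v = pad_zero y \<bullet> (P *\<^sub>v v)" using pad[OF y] v by (intro adjP) auto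
    also have "P *\<^sub>v v = s \<cdot>\<^sub>v unit_vec ?n 0" unfolding vu using P(1) u Pu by (simp add: mult_mat_vec[of P ?n ?n])
    also have "pad_zero y \<bullet> (s \<cdot>\<^sub>v unit_vec ?n 0) = s * pad_zero y $ 0"
      using pad[OF y] by simp
    also have "\<dots> = 0" by (simp add: pad_zero_def)
    finally show "(P *\<^sub>v pad_zero y) \<bullet> v = 0" .
  next
    fix x :: "real vec" assume x: "x \<in> carrier_vec ?n" and xv: "x \<bullet> v = 0"
    define z where "z = P *\<^sub>v x"
    have z: "z \<in> carrier_vec ?n" using P(1) x by (simp add: z_def)
    have "x \<bullet> u = 0" using xv x v by (simp add: u_def)
    hence "z \<bullet> (P *\<^sub>v u) = 0" using adjP[OF x, of "P *\<^sub>v u"] PP[OF u] P(1) u by (simp add: z_def)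
    hence z0: "z $ 0 = 0" unfolding Pu using z by simp
    define y where "y = vec k (\<lambda>i. z $ Suc i)"
    have "z = pad_zero y" by (rule eq_vecI) (use z z0 in \<open>auto simp: pad_zero_def y_def\<close>)
    moreover have "x = P *\<^sub>v z" unfolding z_def by (rule PP[OF x, symmetric])
    ultimately show "\<exists>y\<in>carrier_vec k. x = P *\<^sub>v pad_zero y" by (intro bexI[of _ y]) (auto simp: y_def)
  qed
  thus ?thesis by blast
qed

lemma pad_zero_inject: "pad_zero y = pad_zero z \<Longrightarrow> y = z"
proof (rule eq_vecI)
  assume eq: "pad_zero y = pad_zero z"
  show dim: "dim_vec y = dim_vec z" using arg_cong[OF eq, of dim_vec] by (simp add: pad_zero_def)
  fix i assume "i < dim_vec z"
  thus "y $ i = z $ i" using arg_cong[OF eq, of "\<lambda>x. x $ Suc i"] dim by (simp add: pad_zero_def)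
qed

lemma pad_zero_smult: "pad_zero (a \<cdot>\<^sub>v y) = a \<cdot>\<^sub>v pad_zero y"
  by (rule eq_vecI) (auto simp: pad_zero_def)

lemma pad_zero_scalar_prod:
  assumes "dim_vec y = dim_vec z"
  shows "pad_zero y \<bullet> pad_zero z = y \<bullet> z"
proof -
  have "pad_zero y \<bullet> pad_zero z = (\<Sum>i\<in>{0..<Suc (dim_vec z)}. pad_zero y $ i * pad_zero z $ i)"
    by (simp add: scalar_prod_def pad_zero_def)
  also have "\<dots> = pad_zero y $ 0 * pad_zero z $ 0 + (\<Sum>i\<in>{0..<dim_vec z}. pad_zero y $ Suc i * pad_zero z $ Suc i)"
    by (rule sum_upt_Suc_shift)
  also have "\<dots> = y \<bullet> z" using assms by (simp add: scalar_prod_def pad_zero_def)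
  finally show ?thesis .
qed

section \<open>Multiplicities after removing known eigenvectors\<close>

lemma char_poly_nonzero: "(A :: real mat) \<in> carrier_mat n n \<Longrightarrow> char_poly A \<noteq> 0"
  using degree_monic_char_poly[of A n] by auto

lemma proots_deflation:
  assumes A: "A \<in> carrier_mat k k" and cp: "p = [:- c, 1:] * char_poly (A :: real mat)"
  shows "proots p = add_mset c (proots (char_poly A))"
  unfolding cp using char_poly_nonzero[OF A] by (subst proots_mult) auto

lemma proots_char_poly_eigenvector:
  assumes A: "(A :: real mat) \<in> carrier_mat k k" and \<mu>: "\<mu> \<in># proots (char_poly A)"
  obtains y where "y \<in> carrier_vec k" "y \<noteq> 0\<^sub>v k" "A *\<^sub>v y = \<mu> \<cdot>\<^sub>v y"
proof -
  have "poly (char_poly A) \<mu> = 0" using \<mu> char_poly_nonzero[OF A] by simp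
  hence "eigenvalue A \<mu>" using eigenvalue_root_char_poly[OF A] by simp
  thus ?thesis using that A by (auto simp: eigenvalue_def eigenvector_def)
qed

lemma deflated_eigenvector:
  assumes D: "deflation k A v c A' P"
    and y: "y \<in> carrier_vec k" "y \<noteq> 0\<^sub>v k" "A' *\<^sub>v y = \<mu> \<cdot>\<^sub>v y"
  shows "P *\<^sub>v pad_zero y \<in> carrier_vec (Suc k)" "P *\<^sub>v pad_zero y \<noteq> 0\<^sub>v (Suc k)"
    "A *\<^sub>v (P *\<^sub>v pad_zero y) = \<mu> \<cdot>\<^sub>v (P *\<^sub>v pad_zero y)" "(P *\<^sub>v pad_zero y) \<bullet> v = 0"
proof -
  have P: "P \<in> carrier_mat (Suc k) (Suc k)" "P * P = 1\<^sub>m (Suc k)" using D by (simp_all add: deflation_def)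
  note pad = pad_zero_carrier[OF y(1)]
  show "P *\<^sub>v pad_zero y \<in> carrier_vec (Suc k)" using P pad by simp
  show "(P *\<^sub>v pad_zero y) \<bullet> v = 0" using D y(1) by (simp add: deflation_def)
  have "A *\<^sub>v (P *\<^sub>v pad_zero y) = P *\<^sub>v pad_zero (A' *\<^sub>v y)" using D y(1) by (simp add: deflation_def)
  thus "A *\<^sub>v (P *\<^sub>v pad_zero y) = \<mu> \<cdot>\<^sub>v (P *\<^sub>v pad_zero y)"
    using y(3) pad P(1) by (simp add: pad_zero_smult mult_mat_vec[of P "Suc k" "Suc k"])
  show "P *\<^sub>v pad_zero y \<noteq> 0\<^sub>v (Suc k)"
  proof
    assume "P *\<^sub>v pad_zero y = 0\<^sub>v (Suc k)"
    hence "pad_zero y = 0\<^sub>v (Suc k)"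
      using mult_mat_vec_involution[OF P pad] mult_mat_zero_vec[OF P(1)] by simp
    moreover have "0\<^sub>v (Suc k) = pad_zero (0\<^sub>v k)" by (rule eq_vecI) (auto simp: pad_zero_def)
    ultimately have "pad_zero y = pad_zero (0\<^sub>v k)" by (rule trans)
    hence "y = 0\<^sub>v k" by (rule pad_zero_inject)
    thus False using y by simp
  qed
qed

lemma deflation_exists:
  fixes A :: "real mat"
  assumes A: "A \<in> carrier_mat n n" "A\<^sup>T = A"
    and v: "v \<in> carrier_vec n" "v \<noteq> 0\<^sub>v n" "A *\<^sub>v v = c \<cdot>\<^sub>v v"
  shows "\<exists>k A' P. n = Suc k \<and> deflation k A v c A' P"
proof -
  have "n \<noteq> 0" using v by (metis carrier_vecD eq_vecI index_zero_vec(2) not_less_zero)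
  then obtain k where n: "n = Suc k" by (cases n) auto
  from deflate_symmetric[OF A(1)[unfolded n] A(2) v(1)[unfolded n] v(2)[unfolded n] v(3)] n
  show ?thesis by blast
qed

text \<open>The spectrum is a multiset, so \<open>c\<close> may occur again in \<open>R\<close>.
  Taking \<open>R\<close> from the deflated matrix provides an eigenvector orthogonal to
  \<open>v\<close> for such a repeated value too.\<close>

lemma proots_remove_eigenvector:
  fixes A :: "real mat"
  assumes A: "A \<in> carrier_mat n n" "A\<^sup>T = A"
    and v: "v \<in> carrier_vec n" "v \<noteq> 0\<^sub>v n" "A *\<^sub>v v = c \<cdot>\<^sub>v v"
  shows "\<exists>R. proots (char_poly A) = add_mset c R \<and>
     (\<forall>\<mu>\<in>#R. \<exists>x\<in>carrier_vec n. x \<noteq> 0\<^sub>v n \<and> A *\<^sub>v x = \<mu> \<cdot>\<^sub>v x \<and> x \<bullet> v = 0)"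
proof -
  obtain k A' P where n: "n = Suc k" and D: "deflation k A v c A' P" using deflation_exists[OF A v] by blast
  have A': "A' \<in> carrier_mat k k" "char_poly A = [:- c, 1:] * char_poly A'" using D by (simp_all add: deflation_def)
  show ?thesis
  proof (intro exI[of _ "proots (char_poly A')"] conjI ballI)
    show "proots (char_poly A) = add_mset c (proots (char_poly A'))" by (rule proots_deflation[OF A'])
    fix \<mu> assume "\<mu> \<in># proots (char_poly A')"
    then obtain y where y: "y \<in> carrier_vec k" "y \<noteq> 0\<^sub>v k" "A' *\<^sub>v y = \<mu> \<cdot>\<^sub>v y"
      using proots_char_poly_eigenvector[OF A'(1)] by metis
    show "\<exists>x\<in>carrier_vec n. x \<noteq> 0\<^sub>v n \<and> A *\<^sub>v x = \<mu> \<cdot>\<^sub>v x \<and> x \<bullet> v = 0"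
      using deflated_eigenvector[OF D y] unfolding n by blast
  qed
qed

text \<open>Being orthogonal to \<open>v\<close>, the vector \<open>w\<close> comes from an
  eigenvector \<open>w'\<close> of the deflated matrix, which is deflated once more. Scalar products
  survive the way back because \<open>P\<close> is a symmetric involution.\<close>

lemma proots_remove_two_eigenvectors:
  fixes A :: "real mat"
  assumes A: "A \<in> carrier_mat n n" "A\<^sup>T = A"
    and v: "v \<in> carrier_vec n" "v \<noteq> 0\<^sub>v n" "A *\<^sub>v v = c \<cdot>\<^sub>v v"
    and w: "w \<in> carrier_vec n" "w \<noteq> 0\<^sub>v n" "A *\<^sub>v w = c' \<cdot>\<^sub>v w" "w \<bullet> v = 0"
  shows "\<exists>R. proots (char_poly A) = add_mset c (add_mset c' R) \<and>
     (\<forall>\<mu>\<in>#R. \<exists>x\<in>carrier_vec n. x \<noteq> 0\<^sub>v n \<and> A *\<^sub>v x = \<mu> \<cdot>\<^sub>v x \<and> x \<bullet> v = 0 \<and> x \<bullet> w = 0)"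
proof -
  obtain k A' P where n: "n = Suc k" and D: "deflation k A v c A' P" using deflation_exists[OF A v] by blast
  have A': "A' \<in> carrier_mat k k" "A'\<^sup>T = A'" "char_poly A = [:- c, 1:] * char_poly A'"
    and P: "P \<in> carrier_mat n n" "P\<^sup>T = P" "P * P = 1\<^sub>m n" using D by (simp_all add: deflation_def n)
  note pad = pad_zero_carrier[where k = k, folded n]
  note PP = mult_mat_vec_involution[OF P(1,3)]
  obtain w' where w': "w' \<in> carrier_vec k" "w = P *\<^sub>v pad_zero w'" using D w(1,4) unfolding deflation_def n by blast
  have Pw: "P *\<^sub>v w = pad_zero w'" unfolding w'(2) by (rule PP[OF pad[OF w'(1)]])
  have "P *\<^sub>v pad_zero (A' *\<^sub>v w') = A *\<^sub>v w" using D w' by (simp add: deflation_def)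
  hence "P *\<^sub>v (P *\<^sub>v pad_zero (A' *\<^sub>v w')) = P *\<^sub>v (c' \<cdot>\<^sub>v w)" by (simp add: w(3))
  hence "pad_zero (A' *\<^sub>v w') = pad_zero (c' \<cdot>\<^sub>v w')"
    using A'(1) w'(1) w(1) P(1) by (simp add: PP pad Pw pad_zero_smult mult_mat_vec[of P n n])
  hence A'w: "A' *\<^sub>v w' = c' \<cdot>\<^sub>v w'" by (rule pad_zero_inject)
  have w'0: "w' \<noteq> 0\<^sub>v k"
  proof
    assume "w' = 0\<^sub>v k"
    hence "pad_zero w' = 0\<^sub>v n" by (intro eq_vecI) (auto simp: pad_zero_def n)
    thus False using w'(2) w(2) mult_mat_zero_vec[OF P(1)] by simp
  qed
  obtain R where R: "proots (char_poly A') = add_mset c' R"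
    "\<forall>\<mu>\<in>#R. \<exists>x\<in>carrier_vec k. x \<noteq> 0\<^sub>v k \<and> A' *\<^sub>v x = \<mu> \<cdot>\<^sub>v x \<and> x \<bullet> w' = 0"
    using proots_remove_eigenvector[OF A'(1,2) w'(1) w'0 A'w] by metis
  show ?thesis
  proof (intro exI[of _ R] conjI ballI)
    show "proots (char_poly A) = add_mset c (add_mset c' R)" using proots_deflation[OF A'(1,3)] R(1) by simp
    fix \<mu> assume "\<mu> \<in># R"
    then obtain y where y: "y \<in> carrier_vec k" "y \<noteq> 0\<^sub>v k" "A' *\<^sub>v y = \<mu> \<cdot>\<^sub>v y" "y \<bullet> w' = 0" using R(2) by auto
    have "(P *\<^sub>v pad_zero y) \<bullet> w = pad_zero y \<bullet> pad_zero w'"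
      using symmetric_mat_scalar_prod[OF P(1,2) pad[OF y(1)] w(1)] by (simp add: Pw)
    also have "\<dots> = 0" using y w'(1) by (simp add: pad_zero_scalar_prod)
    finally show "\<exists>x\<in>carrier_vec n. x \<noteq> 0\<^sub>v n \<and> A *\<^sub>v x = \<mu> \<cdot>\<^sub>v x \<and> x \<bullet> v = 0 \<and> x \<bullet> w = 0"
      using deflated_eigenvector[OF D y(1-3)] unfolding n by blast
  qed
qed

section \<open>The spectrum of a lift\<close>

lemma vert_list_spec:
  assumes "finite (verts G)"
  shows "distinct (vert_list G)" "set (vert_list G) = verts G"
proof -
  have "\<exists>xs. distinct xs \<and> set xs = verts G" using finite_distinct_list[OF assms] by auto
  hence "distinct (vert_list G) \<and> set (vert_list G) = verts G" unfolding vert_list_def by (rule someI_ex)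
  thus "distinct (vert_list G)" "set (vert_list G) = verts G" by auto
qed

definition vertex_vec :: "('v, 'e) mgraph \<Rightarrow> ('v \<Rightarrow> real) \<Rightarrow> real vec" where
  "vertex_vec G f = vec (length (vert_list G)) (\<lambda>i. f (vert_list G ! i))"

lemma sum_vert_list:
  assumes "finite (verts G)"
  shows "(\<Sum>i\<in>{0..<length (vert_list G)}. \<phi> (vert_list G ! i)) = (\<Sum>v\<in>verts G. \<phi> v)"
  by (rule sum.reindex_bij_betw)
     (use bij_betw_nth[OF vert_list_spec(1)[OF assms], of "{0..<length (vert_list G)}" "verts G"] vert_list_spec(2)[OF assms]
      in \<open>auto simp: atLeast0LessThan\<close>)

lemma vertex_vec_scalar_prod:
  assumes "finite (verts G)"
  shows "vertex_vec G f \<bullet> vertex_vec G g = (\<Sum>v\<in>verts G. f v * g v)"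
  unfolding sum_vert_list[OF assms, symmetric] by (simp add: vertex_vec_def scalar_prod_def)

lemma vertex_vec_surj:
  assumes fin: "finite (verts G)" and x: "x \<in> carrier_vec (length (vert_list G))"
  obtains f where "x = vertex_vec G f"
proof -
  let ?vs = "vert_list G"
  have inj: "inj_on ((!) ?vs) {..<length ?vs}"
    using vert_list_spec(1)[OF fin] by (simp add: inj_on_nth)
  have "x = vertex_vec G (\<lambda>v. x $ (inv_into {..<length ?vs} ((!) ?vs) v))"
    by (rule eq_vecI) (use x inj in \<open>auto simp: vertex_vec_def inv_into_f_f\<close>)
  thus ?thesis by (rule that)
qed

lemma vertex_vec_eq_iff:
  assumes "finite (verts G)"
  shows "vertex_vec G f = vertex_vec G g \<longleftrightarrow> (\<forall>v\<in>verts G. f v = g v)"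
proof
  assume eq: "vertex_vec G f = vertex_vec G g"
  show "\<forall>v\<in>verts G. f v = g v"
  proof
    fix v assume "v \<in> verts G"
    then obtain i where i: "i < length (vert_list G)" "vert_list G ! i = v"
      using vert_list_spec(2)[OF assms] by (metis in_set_conv_nth)
    thus "f v = g v" using arg_cong[OF eq, of "\<lambda>x. x $ i"] by (simp add: vertex_vec_def)
  qed
next
  assume "\<forall>v\<in>verts G. f v = g v"
  thus "vertex_vec G f = vertex_vec G g"
    using vert_list_spec(2)[OF assms] by (intro eq_vecI) (auto simp: vertex_vec_def)
qed

lemma adj_mat_carrier: "adj_mat G \<in> carrier_mat (length (vert_list G)) (length (vert_list G))"
  by (simp add: adj_mat_def Let_def)

lemma adj_mat_symmetric:
  assumes wf: "wf_graph G"
  shows "(adj_mat G)\<^sup>T = adj_mat G"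
proof (rule eq_matI)
  fix i j assume "i < dim_row (adj_mat G)" "j < dim_col (adj_mat G)"
  hence ij: "i < length (vert_list G)" "j < length (vert_list G)" by (simp_all add: adj_mat_def Let_def)
  have "card {e \<in> darts G. tl G e = u \<and> hd G e = v} = card {e \<in> darts G. tl G e = v \<and> hd G e = u}" for u v
    by (rule bij_betw_same_card[of "rev G"], rule bij_betw_byWitness[where f' = "rev G"])
       (use wf_graph_rev[OF wf] in auto)
  thus "(adj_mat G)\<^sup>T $$ (i, j) = adj_mat G $$ (i, j)" using ij by (simp add: adj_mat_def Let_def)
qed (simp_all add: adj_mat_def Let_def)

lemma adj_mat_mult_vertex_vec:
  assumes wf: "wf_graph G"
  shows "adj_mat G *\<^sub>v vertex_vec G f = vertex_vec G (\<lambda>u. \<Sum>e\<in>{e \<in> darts G. tl G e = u}. f (hd G e))"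
proof (rule eq_vecI)
  let ?vs = "vert_list G"
  have fin: "finite (verts G)" "finite (darts G)" using wf by (simp_all add: wf_graph_def)
  fix i assume "i < dim_vec (vertex_vec G (\<lambda>u. \<Sum>e\<in>{e \<in> darts G. tl G e = u}. f (hd G e)))"
  hence i: "i < length ?vs" by (simp add: vertex_vec_def)
  let ?E = "{e \<in> darts G. tl G e = ?vs ! i}"
  have "(adj_mat G *\<^sub>v vertex_vec G f) $ i
      = (\<Sum>j\<in>{0..<length ?vs}. (\<lambda>v. real (card {e \<in> darts G. tl G e = ?vs ! i \<and> hd G e = v}) * f v) (?vs ! j))"
    using i by (simp add: adj_mat_def Let_def vertex_vec_def scalar_prod_def)
  also have "\<dots> = (\<Sum>v\<in>verts G. real (card {e \<in> darts G. tl G e = ?vs ! i \<and> hd G e = v}) * f v)"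
    by (rule sum_vert_list[OF fin(1)])
  also have "\<dots> = (\<Sum>v\<in>verts G. \<Sum>e\<in>{e \<in> ?E. hd G e = v}. f (hd G e))"
    by (intro sum.cong refl) (auto simp: conj_ac intro!: arg_cong[of _ _ card])
  also have "\<dots> = (\<Sum>e\<in>?E. f (hd G e))"
    using fin wf_graph_rev(6)[OF wf] by (intro sum.group) auto
  finally show "(adj_mat G *\<^sub>v vertex_vec G f) $ i = vertex_vec G (\<lambda>u. \<Sum>e\<in>{e \<in> darts G. tl G e = u}. f (hd G e)) $ i"
    using i by (simp add: vertex_vec_def)
qed (simp add: adj_mat_def Let_def vertex_vec_def)

lemma eigenfunction_iff_vertex_vec:
  assumes wf: "wf_graph G"
  shows "eigenfunction G \<mu> f \<longleftrightarrow> adj_mat G *\<^sub>v vertex_vec G f = \<mu> \<cdot>\<^sub>v vertex_vec G f"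
proof -
  have fin: "finite (verts G)" using wf by (simp add: wf_graph_def)
  have "\<mu> \<cdot>\<^sub>v vertex_vec G f = vertex_vec G (\<lambda>v. \<mu> * f v)" by (rule eq_vecI) (auto simp: vertex_vec_def)
  thus ?thesis unfolding adj_mat_mult_vertex_vec[OF wf] eigenfunction_def
    by (simp add: vertex_vec_eq_iff[OF fin])
qed

lemma eigenfunction_const:
  assumes "regular G d"
  shows "eigenfunction G (real d) (\<lambda>_. 1)"
  using assms by (simp add: eigenfunction_def regular_def degree_def)

lemma eigenfunction_sign:
  assumes "regular G d" and \<chi>: "\<And>e. e \<in> darts G \<Longrightarrow> tl G e \<in> S \<longleftrightarrow> hd G e \<notin> S"
  shows "eigenfunction G (- real d) (\<lambda>v. if v \<in> S then 1 else - 1)"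
  unfolding eigenfunction_def
proof
  fix v assume v: "v \<in> verts G"
  have "(\<Sum>e\<in>{e \<in> darts G. tl G e = v}. if hd G e \<in> S then 1 else - 1 :: real)
     = (\<Sum>e\<in>{e \<in> darts G. tl G e = v}. if v \<in> S then - 1 else 1)"
    using \<chi> by (intro sum.cong) auto
  thus "(\<Sum>e\<in>{e \<in> darts G. tl G e = v}. if hd G e \<in> S then 1 else - 1 :: real) = - real d * (if v \<in> S then 1 else - 1)"
    using assms(1) v by (simp add: regular_def degree_def)
qed

section \<open>Locating nontrivial entries in the ordered spectrum\<close>

lemma mset_eigs: "mset (eigs G) = proots (char_poly (adj_mat G))"
  by (simp add: eigs_def)

lemma eigs_antimono: "i \<le> j \<Longrightarrow> j < length (eigs G) \<Longrightarrow> eigs G ! j \<le> eigs G ! i"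
  unfolding eigs_def by (simp add: rev_nth sorted_nth_mono)

text \<open>If the first entry is \<open>d\<close>, the later entries make up \<open>R\<close>.
  Otherwise it belongs to \<open>R\<close>, and as the largest entry of a list that contains
  \<open>d\<close> it is itself a witness.\<close>

lemma eigs_spectral_gap_witness:
  assumes ms: "proots (char_poly (adj_mat G)) = add_mset (real d) R"
    and i: "1 \<le> i" "i < length (eigs G)" "\<bar>eigs G ! i\<bar> \<ge> real d - \<epsilon>" and \<epsilon>: "\<epsilon> \<ge> 0"
  shows "\<exists>\<mu>\<in>#R. \<bar>\<mu>\<bar> \<ge> real d - \<epsilon>"
proof -
  obtain x ys where xs: "eigs G = x # ys" using i by (cases "eigs G") auto
  have m: "add_mset x (mset ys) = add_mset (real d) R" using mset_eigs[of G] ms xs by simp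
  show ?thesis
  proof (cases "x = real d")
    case True
    hence "mset ys = R" using m by simp
    moreover have "eigs G ! i \<in> set ys" using i xs by (cases i) auto
    ultimately show ?thesis using i(3) by (metis set_mset_mset)
  next
    case False
    have "x \<in># add_mset (real d) R" using m by (metis union_single_eq_member)
    hence "x \<in># R" using False by simp
    have "real d \<in> set (eigs G)" using mset_eigs[of G] ms by (metis set_mset_mset union_single_eq_member)
    then obtain k where "k < length (eigs G)" "eigs G ! k = real d" by (metis in_set_conv_nth)
    hence "real d \<le> x" using eigs_antimono[of 0 k G] xs by simp
    thus ?thesis using \<open>x \<in># R\<close> \<epsilon> by (intro bexI[of _ x]) auto
  qed
qed

text \<open>The same exchange at both ends of the list: an end entry other than \<open>d\<close> or
  \<open>- d\<close> lies in \<open>R\<close> and is at least \<open>d\<close> in absolute value. If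
  both ends are as expected, the entries strictly between them make up \<open>R\<close>, and
  \<open>i + 1 < length (eigs G)\<close> places entry \<open>i\<close> among these.\<close>

lemma eigs_spectral_gap_witness_bipartite:
  assumes ms: "proots (char_poly (adj_mat G)) = add_mset (real d) (add_mset (- real d) R)"
    and i: "1 \<le> i" "i + 1 < length (eigs G)" "\<bar>eigs G ! i\<bar> \<ge> real d - \<epsilon>" and \<epsilon>: "\<epsilon> \<ge> 0" and d: "d > 0"
  shows "\<exists>\<mu>\<in>#R. \<bar>\<mu>\<bar> \<ge> real d - \<epsilon>"
proof -
  obtain x ys where xs: "eigs G = x # ys" using i by (cases "eigs G") auto
  have "ys \<noteq> []" using i xs by auto
  then obtain zs z where ys: "ys = zs @ [z]" by (metis append_butlast_last_id)
  have m: "add_mset x (add_mset z (mset zs)) = add_mset (real d) (add_mset (- real d) R)"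
    using mset_eigs[of G] ms xs ys by simp
  have in_eigs: "a \<in> set (eigs G)" if "a \<in># add_mset (real d) (add_mset (- real d) R)" for a
    using that mset_eigs[of G] ms by (metis set_mset_mset)
  have eq: "eigs G = x # zs @ [z]" using xs ys by simp
  have bounds: "a \<le> x" "z \<le> a" if a: "a \<in> set (eigs G)" for a
  proof -
    obtain k where k: "k < length (eigs G)" "eigs G ! k = a" using a by (metis in_set_conv_nth)
    show "a \<le> x" using eigs_antimono[of 0 k G] k eq by simp
    show "z \<le> a" using eigs_antimono[of k "length zs + 1" G] k eq by simp
  qed
  have dx: "real d \<le> x" and zd: "z \<le> - real d" using bounds in_eigs by auto
  have x_in: "x \<in># add_mset (real d) (add_mset (- real d) R)" using m by (metis union_single_eq_member)
  have z_in: "z \<in># add_mset (real d) (add_mset (- real d) R)" using m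
    by (metis insert_iff set_mset_add_mset_insert)
  show ?thesis
  proof (cases "x = real d")
    case False
    hence "x \<in># R" using x_in dx d by auto
    thus ?thesis using dx \<epsilon> by (intro bexI[of _ x]) auto
  next
    case x: True
    show ?thesis
    proof (cases "z = - real d")
      case False
      hence "z \<in># R" using z_in zd d by auto
      thus ?thesis using zd \<epsilon> by (intro bexI[of _ z]) auto
    next
      case True
      hence "mset zs = R" using m x by simp
      moreover have "eigs G ! i \<in> set zs" using i eq by (cases i) (auto simp: nth_append)
      ultimately show ?thesis using i(3) by (metis set_mset_mset)
    qed
  qed
qed

lemma vertex_vec_nonzero:
  assumes fin: "finite (verts G)" and "v \<in> verts G" "f v \<noteq> 0"
  shows "vertex_vec G f \<noteq> 0\<^sub>v (length (vert_list G))"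
proof
  assume z: "vertex_vec G f = 0\<^sub>v (length (vert_list G))"
  have "0\<^sub>v (length (vert_list G)) = vertex_vec G (\<lambda>_. 0)" by (rule eq_vecI) (auto simp: vertex_vec_def)
  thus False using z vertex_vec_eq_iff[OF fin, of f "\<lambda>_. 0"] assms by simp
qed

lemma vertex_vec_carrier: "vertex_vec G f \<in> carrier_vec (length (vert_list G))"
  by (simp add: vertex_vec_def)

lemma nonzero_vertex_vecD:
  assumes fin: "finite (verts G)" and "vertex_vec G f \<noteq> 0\<^sub>v (length (vert_list G))"
  shows "\<exists>v\<in>verts G. f v \<noteq> 0"
proof (rule ccontr)
  assume "\<not> ?thesis"
  hence "vertex_vec G f = vertex_vec G (\<lambda>_. 0)" using vertex_vec_eq_iff[OF fin] by auto
  moreover have "0\<^sub>v (length (vert_list G)) = vertex_vec G (\<lambda>_. 0)" by (rule eq_vecI) (auto simp: vertex_vec_def)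
  ultimately show False using assms(2) by simp
qed

lemma nontrivial_eigenfunction:
  assumes wf: "wf_graph G" and reg: "regular G d" and ne: "verts G \<noteq> {}"
    and i: "1 \<le> i" "i < length (eigs G)" "\<bar>eigs G ! i\<bar> \<ge> real d - \<epsilon>" and \<epsilon>: "\<epsilon> \<ge> 0"
  shows "\<exists>\<mu> f. \<bar>\<mu>\<bar> \<ge> real d - \<epsilon> \<and> eigenfunction G \<mu> f \<and> (\<exists>v\<in>verts G. f v \<noteq> 0) \<and> (\<Sum>v\<in>verts G. f v) = 0"
proof -
  let ?n = "length (vert_list G)"
  have fin: "finite (verts G)" using wf by (simp add: wf_graph_def)
  obtain w where w: "w \<in> verts G" using ne by auto
  let ?one = "vertex_vec G (\<lambda>_. 1)"
  have "adj_mat G *\<^sub>v ?one = real d \<cdot>\<^sub>v ?one"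
    using eigenfunction_const[OF reg] eigenfunction_iff_vertex_vec[OF wf] by blast
  from proots_remove_eigenvector[OF adj_mat_carrier adj_mat_symmetric[OF wf] vertex_vec_carrier _ this]
  obtain R where R: "proots (char_poly (adj_mat G)) = add_mset (real d) R"
    "\<forall>\<mu>\<in>#R. \<exists>x\<in>carrier_vec (?n). x \<noteq> 0\<^sub>v (?n) \<and> adj_mat G *\<^sub>v x = \<mu> \<cdot>\<^sub>v x \<and> x \<bullet> ?one = 0"
    using vertex_vec_nonzero[OF fin w, of "\<lambda>_. 1"] by auto
  obtain \<mu> where \<mu>: "\<mu> \<in># R" "\<bar>\<mu>\<bar> \<ge> real d - \<epsilon>" using eigs_spectral_gap_witness[OF R(1) i \<epsilon>] by auto
  then obtain x where x: "x \<in> carrier_vec (?n)" "x \<noteq> 0\<^sub>v (?n)"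
    "adj_mat G *\<^sub>v x = \<mu> \<cdot>\<^sub>v x" "x \<bullet> ?one = 0" using R(2) by blast
  obtain f where f: "x = vertex_vec G f" using vertex_vec_surj[OF fin x(1)] .
  show ?thesis
    using \<mu>(2) x eigenfunction_iff_vertex_vec[OF wf, of \<mu> f] nonzero_vertex_vecD[OF fin, of f]
    by (intro exI[of _ \<mu>] exI[of _ f]) (simp add: f vertex_vec_scalar_prod[OF fin])
qed

text \<open>Both known eigenvectors are removed, the constants and the sign vector. For an
  eigenvalue near \<open>- d\<close> the signs of one side are flipped, and the second orthogonality
  relation becomes the zero sum.\<close>

lemma nontrivial_eigenfunction_bipartite:
  assumes wf: "wf_graph G" and reg: "regular G d" and ne: "verts G \<noteq> {}" and d: "d > 0"
    and S: "\<And>e. e \<in> darts G \<Longrightarrow> tl G e \<in> S \<longleftrightarrow> hd G e \<notin> S"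
    and i: "1 \<le> i" "i + 1 < length (eigs G)" "\<bar>eigs G ! i\<bar> \<ge> real d - \<epsilon>" and \<epsilon>: "\<epsilon> \<ge> 0"
  shows "\<exists>\<mu> f. \<mu> \<ge> real d - \<epsilon> \<and> eigenfunction G \<mu> f \<and> (\<exists>v\<in>verts G. f v \<noteq> 0) \<and> (\<Sum>v\<in>verts G. f v) = 0"
proof -
  let ?n = "length (vert_list G)"
  have fin: "finite (verts G)" using wf by (simp add: wf_graph_def)
  obtain w where w: "w \<in> verts G" using ne by auto
  define \<chi> where "\<chi> = (\<lambda>v. if v \<in> S then 1 else - 1 :: real)"
  let ?one = "vertex_vec G (\<lambda>_. 1)" and ?chi = "vertex_vec G \<chi>"
  have A: "adj_mat G *\<^sub>v ?one = real d \<cdot>\<^sub>v ?one"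
    using eigenfunction_const[OF reg] eigenfunction_iff_vertex_vec[OF wf] by blast
  have B: "adj_mat G *\<^sub>v ?chi = - real d \<cdot>\<^sub>v ?chi"
    using eigenfunction_sign[OF reg S] eigenfunction_iff_vertex_vec[OF wf] unfolding \<chi>_def by blast
  \<comment> \<open>Since \<open>\<chi>\<close> changes sign along every edge, summing it over tails
    and over heads shows that the sum is its own negative. This makes the two eigenvectors
    orthogonal.\<close>
  have \<chi>sum: "(\<Sum>v\<in>verts G. \<chi> v) = 0"
  proof -
    have "real d * (\<Sum>v\<in>verts G. \<chi> v) = (\<Sum>e\<in>darts G. \<chi> (tl G e))" by (rule sum_tail_regular[OF wf reg, symmetric])
    also have "\<dots> = (\<Sum>e\<in>darts G. - \<chi> (hd G e))" using S by (intro sum.cong) (auto simp: \<chi>_def)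
    also have "\<dots> = - (real d * (\<Sum>v\<in>verts G. \<chi> v))" using sum_head_regular[OF wf reg, of \<chi>] by (simp add: sum_negf)
    finally show ?thesis using d by simp
  qed
  have "\<exists>R. proots (char_poly (adj_mat G)) = add_mset (real d) (add_mset (- real d) R) \<and>
    (\<forall>\<mu>\<in>#R. \<exists>x\<in>carrier_vec (?n). x \<noteq> 0\<^sub>v (?n) \<and> adj_mat G *\<^sub>v x = \<mu> \<cdot>\<^sub>v x \<and> x \<bullet> ?one = 0 \<and> x \<bullet> ?chi = 0)"
    by (rule proots_remove_two_eigenvectors[OF adj_mat_carrier adj_mat_symmetric[OF wf] vertex_vec_carrier _ A vertex_vec_carrier _ B])
       (use vertex_vec_nonzero[OF fin w] in \<open>auto simp: vertex_vec_scalar_prod[OF fin] \<chi>sum, simp_all add: \<chi>_def\<close>)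
  then obtain R where R: "proots (char_poly (adj_mat G)) = add_mset (real d) (add_mset (- real d) R)"
    "\<forall>\<mu>\<in>#R. \<exists>x\<in>carrier_vec (?n). x \<noteq> 0\<^sub>v (?n) \<and> adj_mat G *\<^sub>v x = \<mu> \<cdot>\<^sub>v x \<and> x \<bullet> ?one = 0 \<and> x \<bullet> ?chi = 0"
    by blast
  obtain \<mu> where \<mu>: "\<mu> \<in># R" "\<bar>\<mu>\<bar> \<ge> real d - \<epsilon>" using eigs_spectral_gap_witness_bipartite[OF R(1) i \<epsilon> d] by auto
  then obtain x where x: "x \<in> carrier_vec (?n)" "x \<noteq> 0\<^sub>v (?n)"
    "adj_mat G *\<^sub>v x = \<mu> \<cdot>\<^sub>v x" "x \<bullet> ?one = 0" "x \<bullet> ?chi = 0" using R(2) by blast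
  obtain f where f: "x = vertex_vec G f" using vertex_vec_surj[OF fin x(1)] .
  have ef: "eigenfunction G \<mu> f" using x(3) eigenfunction_iff_vertex_vec[OF wf] by (simp add: f)
  have nz: "\<exists>v\<in>verts G. f v \<noteq> 0" using x(2) nonzero_vertex_vecD[OF fin] by (simp add: f)
  have s: "(\<Sum>v\<in>verts G. f v) = 0" "(\<Sum>v\<in>verts G. f v * \<chi> v) = 0"
    using x(4,5) by (simp_all add: f vertex_vec_scalar_prod[OF fin])
  show ?thesis
  proof (cases "\<mu> \<ge> real d - \<epsilon>")
    case True thus ?thesis using ef nz s by blast
  next
    case False
    hence "- \<mu> \<ge> real d - \<epsilon>" using \<mu>(2) by linarith
    moreover have "eigenfunction G (- \<mu>) (\<lambda>v. f v * \<chi> v)"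
      unfolding eigenfunction_def
    proof
      fix v assume v: "v \<in> verts G"
      have "(\<Sum>e\<in>{e \<in> darts G. tl G e = v}. f (hd G e) * \<chi> (hd G e)) = (\<Sum>e\<in>{e \<in> darts G. tl G e = v}. - \<chi> v * f (hd G e))"
        using S by (intro sum.cong) (auto simp: \<chi>_def)
      also have "\<dots> = - \<chi> v * (\<Sum>e\<in>{e \<in> darts G. tl G e = v}. f (hd G e))"
        by (rule sum_distrib_left[symmetric])
      also have "\<dots> = - \<chi> v * (\<mu> * f v)" using ef v by (simp add: eigenfunction_def)
      finally show "(\<Sum>e\<in>{e \<in> darts G. tl G e = v}. f (hd G e) * \<chi> (hd G e)) = - \<mu> * (f v * \<chi> v)" by simp
    qed
    moreover have "\<exists>v\<in>verts G. f v * \<chi> v \<noteq> 0" using nz by (auto simp: \<chi>_def)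
    ultimately show ?thesis using s(2) by blast
  qed
qed

section \<open>Sparse sets from eigenfunctions\<close>

lemma lift_assignments_compatible:
  "\<sigma> \<in> lift_assignments B n \<Longrightarrow> compatible_perms B n \<sigma>"
  by (auto simp: lift_assignments_def compatible_perms_def)

lemma component_subset_closed:
  assumes U: "boundary G U = {}" and x: "x \<in> U"
  shows "component G x \<subseteq> U"
proof -
  have "y \<in> U" if "(adj G)\<^sup>*\<^sup>* x y" for y
    using that
  proof induction
    case (step y z)
    thus ?case using U by (auto simp: adj_def boundary_def)
  qed (rule x)
  thus ?thesis by (auto simp: component_def)
qed

text \<open>The supports of the positive parts of \<open>f\<close> and \<open>- f\<close> are
  disjoint, so one of them has at most half of the vertices; the zero sum makes it nonempty.\<close>

lemma small_boundary_from_top_eigenfunction: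
  assumes wf: "wf_graph G" and reg: "regular G d"
    and f: "eigenfunction G \<mu> f" "\<exists>v\<in>verts G. f v \<noteq> 0" "(\<Sum>v\<in>verts G. f v) = 0"
    and \<mu>: "\<mu> \<ge> real d - \<epsilon>" and \<gamma>: "\<gamma> \<ge> 0" "8 * real d * \<epsilon> < \<gamma>\<^sup>2"
  shows "\<exists>U \<subseteq> verts G. U \<noteq> {} \<and> 2 * card U \<le> card (verts G) \<and> real (card (boundary G U)) \<le> \<gamma> * real (card U)"
proof -
  have fin: "finite (verts G)" using wf by (simp add: wf_graph_def)
  have main: ?thesis
    if f: "eigenfunction G \<mu> f" "\<exists>v\<in>verts G. f v \<noteq> 0" "(\<Sum>v\<in>verts G. f v) = 0"
      and half: "2 * card {v \<in> verts G. f v > 0} \<le> card (verts G)" for f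
  proof -
    have "\<exists>v\<in>verts G. f v > 0"
    proof (rule ccontr)
      assume "\<not> ?thesis"
      hence le: "\<forall>v\<in>verts G. - f v \<ge> 0" by auto
      have "(\<Sum>v\<in>verts G. - f v) = 0" using f(3) by (simp add: sum_negf)
      hence "\<forall>v\<in>verts G. - f v = 0" using sum_nonneg_eq_0_iff[OF fin, of "\<lambda>v. - f v"] le by auto
      thus False using f(2) by auto
    qed
    from cheeger_eigenfunction[OF wf reg f(1) \<mu> this \<gamma>]
    obtain U where U: "U \<noteq> {}" "U \<subseteq> {v \<in> verts G. f v > 0}" "real (card (boundary G U)) < \<gamma> * real (card U)" by blast
    have "card U \<le> card {v \<in> verts G. f v > 0}" using fin by (intro card_mono U) auto
    thus ?thesis using U half by (intro exI[of _ U]) auto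
  qed
  show ?thesis
  proof (cases "2 * card {v \<in> verts G. f v > 0} \<le> card (verts G)")
    case True thus ?thesis using main f by blast
  next
    case False
    have "card {v \<in> verts G. f v > 0} + card {v \<in> verts G. - f v > 0} = card ({v \<in> verts G. f v > 0} \<union> {v \<in> verts G. - f v > 0})"
      using fin by (intro card_Un_disjoint[symmetric]) auto
    also have "\<dots> \<le> card (verts G)" using fin by (intro card_mono) auto
    finally have "2 * card {v \<in> verts G. - f v > 0} \<le> card (verts G)" using False by linarith
    moreover have "eigenfunction G \<mu> (\<lambda>v. - f v)" using f(1) by (simp add: eigenfunction_def sum_negf)
    ultimately show ?thesis using f by (intro main[of "\<lambda>v. - f v"]) (auto simp: sum_negf)
  qed
qed

section \<open>The bipartite double cover\<close>

definition double_cover :: "('v, 'e) mgraph \<Rightarrow> ('v \<times> bool, 'e \<times> bool) mgraph" where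
  "double_cover B = \<lparr> verts = verts B \<times> UNIV, darts = darts B \<times> UNIV,
     tl = (\<lambda>(e, b). (tl B e, b)), hd = (\<lambda>(e, b). (hd B e, \<not> b)), rev = (\<lambda>(e, b). (rev B e, \<not> b)) \<rparr>"

lemma double_cover_sel [simp]:
  "verts (double_cover B) = verts B \<times> UNIV" "darts (double_cover B) = darts B \<times> UNIV"
  "tl (double_cover B) = (\<lambda>(e, b). (tl B e, b))" "hd (double_cover B) = (\<lambda>(e, b). (hd B e, \<not> b))"
  "rev (double_cover B) = (\<lambda>(e, b). (rev B e, \<not> b))"
  by (simp_all add: double_cover_def)

lemma wf_graph_double_cover: "wf_graph B \<Longrightarrow> wf_graph (double_cover B)"
  unfolding wf_graph_def by auto

lemma regular_double_cover:
  assumes "regular B d"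
  shows "regular (double_cover B) d"
proof -
  have "{x \<in> darts B \<times> (UNIV :: bool set). (case x of (e, b) \<Rightarrow> (tl B e, b)) = (v, c)} = {e \<in> darts B. tl B e = v} \<times> {c}" for v c
    by auto
  thus ?thesis using assms by (auto simp: regular_def degree_def card_cartesian_product)
qed

lemma adj_sym: "wf_graph B \<Longrightarrow> adj B u v \<Longrightarrow> adj B v u"
  unfolding adj_def using wf_graph_rev by metis

lemma adj_rtranclp_sym:
  assumes wf: "wf_graph B"
  shows "(adj B)\<^sup>*\<^sup>* u v \<Longrightarrow> (adj B)\<^sup>*\<^sup>* v u"
  by (induction rule: rtranclp_induct) (auto intro: converse_rtranclp_into_rtranclp adj_sym[OF wf])

lemma adj_double_cover: "adj (double_cover B) (u, b) (v, c) \<longleftrightarrow> adj B u v \<and> c = (\<not> b)"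
  by (auto simp: adj_def)

lemma double_cover_flip:
  assumes "(adj (double_cover B))\<^sup>*\<^sup>* (u, b) (v, c)"
  shows "(adj (double_cover B))\<^sup>*\<^sup>* (u, \<not> b) (v, \<not> c)"
  using assms
proof (induction rule: rtranclp_induct2)
  case (step v c w a)
  have "adj (double_cover B) (v, \<not> c) (w, \<not> a)" using step.hyps(2) by (simp add: adj_double_cover)
  with step.IH show ?case by (rule rtranclp.rtrancl_into_rtrancl)
qed simp

lemma double_cover_lift_path:
  assumes "(adj B)\<^sup>*\<^sup>* u v"
  shows "\<exists>c. (adj (double_cover B))\<^sup>*\<^sup>* (u, b) (v, c)"
  using assms
proof induction
  case (step v w)
  then obtain c where c: "(adj (double_cover B))\<^sup>*\<^sup>* (u, b) (v, c)" by auto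
  have "adj (double_cover B) (v, c) (w, \<not> c)" using step by (simp add: adj_double_cover)
  with c show ?case by (blast intro: rtranclp.rtrancl_into_rtrancl)
qed auto

text \<open>If the two copies of \<open>v0\<close> were not connected, the vertices whose
  \<open>True\<close> copy is reachable from \<open>(v0, True)\<close> would form one side of a
  bipartition. Once they are connected, exchanging the sheets connects everything.\<close>

lemma connected_graph_double_cover:
  assumes wf: "wf_graph B" and conn: "connected_graph B" and nb: "\<not> bipartite B"
  shows "connected_graph (double_cover B)"
proof -
  let ?D = "double_cover B"
  let ?r = "(adj ?D)\<^sup>*\<^sup>*"
  note wfD = wf_graph_double_cover[OF wf]
  obtain v0 where v0: "v0 \<in> verts B" using conn by (auto simp: connected_graph_def)
  have reach: "\<exists>c. ?r (v0, b) (v, c)" if "v \<in> verts B" for v b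
    using double_cover_lift_path conn v0 that by (metis connected_graph_def)
  have key: "?r (v0, True) (v0, False)"
  proof (rule ccontr)
    assume no: "\<not> ?thesis"
    define S where "S = {v \<in> verts B. ?r (v0, True) (v, True)}"
    have excl: "\<not> (?r (v0, True) (v, True) \<and> ?r (v0, True) (v, False))" for v
    proof
      assume a: "?r (v0, True) (v, True) \<and> ?r (v0, True) (v, False)"
      hence "?r (v0, False) (v, True)" using double_cover_flip[of B v0 True v False] by simp
      hence "?r (v, True) (v0, False)" by (rule adj_rtranclp_sym[OF wfD])
      thus False using a no by (meson rtranclp_trans)
    qed
    have "tl B e \<in> S \<longleftrightarrow> hd B e \<notin> S" if e: "e \<in> darts B" for e
    proof -
      note r = wf_graph_rev[OF wf e]
      have adj: "adj ?D (tl B e, b) (hd B e, \<not> b)" for b using e by (auto simp: adj_double_cover adj_def)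
      obtain c where c: "?r (v0, True) (tl B e, c)" using reach[OF r(5)] by blast
      hence c': "?r (v0, True) (hd B e, \<not> c)" using adj[of c] by (meson rtranclp.rtrancl_into_rtrancl)
      show ?thesis using c c' excl[of "tl B e"] excl[of "hd B e"] r by (cases c) (auto simp: S_def)
    qed
    hence "bipartite B" unfolding bipartite_def by (intro exI[of _ S]) (auto simp: S_def)
    thus False using nb by simp
  qed
  have key': "?r (v0, b) (v0, c)" for b c
    using key double_cover_flip[OF key] by (cases b; cases c) auto
  have all: "?r (v0, True) (v, c)" if v: "v \<in> verts B" for v c
  proof -
    obtain c' where c': "?r (v0, True) (v, c')" using reach[OF v] by blast
    show ?thesis
    proof (cases "c' = c")
      case True thus ?thesis using c' by simp
    next
      case False
      hence "?r (v0, False) (v, c)" using double_cover_flip[OF c'] by auto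
      thus ?thesis using key by (rule rtranclp_trans[rotated])
    qed
  qed
  have "?r (u, b) (v, c)" if "u \<in> verts B" "v \<in> verts B" for u v b c
    using adj_rtranclp_sym[OF wfD all[OF that(1), of b]] all[OF that(2), of c] by (rule rtranclp_trans)
  thus ?thesis using v0 by (auto simp: connected_graph_def)
qed

lemma compatible_perms_double_cover:
  "compatible_perms B n \<sigma> \<Longrightarrow> compatible_perms (double_cover B) n (\<lambda>e. \<sigma> (fst e))"
  by (auto simp: compatible_perms_def)

text \<open>On the double cover, \<open>f\<close> on one sheet and \<open>- f\<close> on the other
  form an eigenfunction for \<open>- \<mu>\<close>. It is odd under the exchange of the sheets, so
  its positive part contains at most one copy of each vertex. This gives both the disjoint sections
  and the bound by half of the vertices.\<close>

lemma small_boundary_from_bottom_eigenfunction: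
  assumes wf: "wf_graph B" and reg: "regular B d" and \<sigma>: "compatible_perms B n \<sigma>"
    and f: "eigenfunction (lift B n \<sigma>) \<mu> f" "\<exists>v\<in>verts (lift B n \<sigma>). f v \<noteq> 0"
    and \<mu>: "- \<mu> \<ge> real d - \<epsilon>" and \<gamma>: "\<gamma> \<ge> 0" "8 * real d * \<epsilon> < \<gamma>\<^sup>2"
  defines "D \<equiv> lift (double_cover B) n (\<lambda>e. \<sigma> (fst e))"
  shows "\<exists>U \<subseteq> verts D. U \<noteq> {} \<and> 2 * card U \<le> card (verts D) \<and> real (card (boundary D U)) \<le> \<gamma> * real (card U)
     \<and> (\<forall>v i. \<not> (((v, True), i) \<in> U \<and> ((v, False), i) \<in> U))"
proof -
  have wfD: "wf_graph D" unfolding D_def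
    by (intro wf_graph_lift wf_graph_double_cover compatible_perms_double_cover wf \<sigma>)
  have regD: "regular D d" unfolding D_def by (intro regular_lift regular_double_cover reg)
  have fin: "finite (verts B)" using wf by (simp add: wf_graph_def)
  define h where "h = (\<lambda>x :: ('a \<times> bool) \<times> nat. (if snd (fst x) then 1 else - 1) * f (fst (fst x), snd x))"
  have h: "eigenfunction D (- \<mu>) h"
    unfolding eigenfunction_def
  proof
    fix x assume "x \<in> verts D"
    then obtain v b i where x: "x = ((v, b), i)" "v \<in> verts B" "i < n" by (auto simp: D_def)
    define s where "s = (if b then 1 else - 1 :: real)"
    have "(\<Sum>e\<in>{e \<in> darts D. tl D e = x}. h (hd D e))
        = (\<Sum>e\<in>{e \<in> darts (lift B n \<sigma>). tl (lift B n \<sigma>) e = (v, i)}. - s * f (hd (lift B n \<sigma>) e))"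
    proof (rule sum.reindex_bij_witness[of _ "\<lambda>(e, j). ((e, b), j)" "\<lambda>((e, c), j). (e, j)"])
    qed (auto simp: D_def x h_def s_def)
    also have "\<dots> = - s * (\<Sum>e\<in>{e \<in> darts (lift B n \<sigma>). tl (lift B n \<sigma>) e = (v, i)}. f (hd (lift B n \<sigma>) e))"
      by (rule sum_distrib_left[symmetric])
    also have "\<dots> = - s * (\<mu> * f (v, i))"
      using f(1) x by (simp add: eigenfunction_def)
    also have "\<dots> = - \<mu> * h x" by (simp add: h_def x s_def)
    finally show "(\<Sum>e\<in>{e \<in> darts D. tl D e = x}. h (hd D e)) = - \<mu> * h x" .
  qed
  obtain v i where vi: "v \<in> verts B" "i < n" "f (v, i) \<noteq> 0" using f(2) by auto
  \<comment> \<open>The sheet is chosen according to the sign of \<open>f (v, i)\<close>.\<close>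
  have "\<exists>x\<in>verts D. h x > 0"
    using vi by (intro bexI[of _ "((v, f (v, i) > 0), i)"]) (auto simp: h_def D_def)
  from cheeger_eigenfunction[OF wfD regD h \<mu> this \<gamma>]
  obtain U where U: "U \<noteq> {}" "U \<subseteq> {x \<in> verts D. h x > 0}" "real (card (boundary D U)) < \<gamma> * real (card U)" by blast
  have "card U \<le> card (verts B \<times> {..<n})"
  proof (rule card_inj_on_le[where f = "\<lambda>x. (fst (fst x), snd x)"])
    show "inj_on (\<lambda>x. (fst (fst x), snd x)) U"
    proof (rule inj_onI)
      fix x y assume xy: "x \<in> U" "y \<in> U" "(fst (fst x), snd x) = (fst (fst y), snd y)"
      hence "h x > 0" "h y > 0" using U(2) by auto
      hence "snd (fst x) = snd (fst y)" using xy(3) by (auto simp: h_def split: if_splits)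
      thus "x = y" using xy(3) by (auto simp: prod_eq_iff)
    qed
    show "(\<lambda>x. (fst (fst x), snd x)) ` U \<subseteq> verts B \<times> {..<n}" using U(2) by (auto simp: D_def)
  qed (use fin in simp)
  hence "2 * card U \<le> card (verts D)" by (simp add: D_def card_cartesian_product)
  moreover have "\<not> (((v, True), i) \<in> U \<and> ((v, False), i) \<in> U)" for v i
  proof
    assume "((v, True), i) \<in> U \<and> ((v, False), i) \<in> U"
    hence "h ((v, True), i) > 0" "h ((v, False), i) > 0" using U(2) by auto
    thus False by (simp add: h_def)
  qed
  ultimately show ?thesis using U by (intro exI[of _ U]) auto
qed

section \<open>From nearly invariant sets to structured assignments\<close>

lemma top_eigenfunction_structured:
  assumes wf: "wf_graph B" and \<sigma>: "\<sigma> \<in> lift_assignments B n"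
    and U: "U \<subseteq> verts (lift B n \<sigma>)"
    and inv: "nearly_invariant B n \<sigma> k0 U"
  shows "\<sigma> \<in> structured_assignments B n k0 False"
  unfolding structured_assignments_def
proof (rule CollectI, rule conjI[OF \<sigma>], intro exI conjI ballI)
  fix v assume "v \<in> verts B"
  thus "(fiber_section U v, {}) \<in> admissible_pairs n k0"
    using inv fiber_section_subset[OF U, of v] by (auto simp: admissible_pairs_def nearly_invariant_def)
next
  fix e assume e: "e \<in> darts B"
  show "(inner_section B \<sigma> U e, {}) \<in> near_pairs (fiber_section U (tl B e), {})"
    using inv e by (auto simp: near_pairs_def near_subsets_def slack_def nearly_invariant_def)
  show "maps_pair False (inner_section B \<sigma> U e, {}) (inner_section B \<sigma> U (rev B e), {}) (\<sigma> e)"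
    using inner_section_rev[OF wf lift_assignments_compatible[OF \<sigma>] e] by (simp add: maps_pair_def)
qed

text \<open>The copy of \<open>e\<close> that starts in one sheet ends in the other, and both copies
  carry the permutation \<open>\<sigma> e\<close>. So \<open>\<sigma> e\<close> interchanges the
  sheets' inner sections, which is \<open>maps_pair\<close> with \<open>sw = True\<close>. A
  half-loop becomes an edge between the two copies of its vertex.\<close>

lemma bottom_eigenfunction_structured:
  fixes B :: "('v, 'e) mgraph"
  assumes wf: "wf_graph B" and \<sigma>: "\<sigma> \<in> lift_assignments B n"
  defines "\<sigma>' \<equiv> \<lambda>e :: 'e \<times> bool. \<sigma> (fst e)"
  assumes U: "U \<subseteq> verts (lift (double_cover B) n \<sigma>')"
    and disj: "\<forall>v i. \<not> (((v, True), i) \<in> U \<and> ((v, False), i) \<in> U)"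
    and inv: "nearly_invariant (double_cover B) n \<sigma>' k0 U"
  shows "\<sigma> \<in> structured_assignments B n k0 True"
  unfolding structured_assignments_def
proof (rule CollectI, rule conjI[OF \<sigma>], intro exI conjI ballI)
  fix v assume "v \<in> verts B"
  thus "(fiber_section U (v, True), fiber_section U (v, False)) \<in> admissible_pairs n k0"
    using inv fiber_section_subset[OF U] disj by (auto simp: admissible_pairs_def fiber_section_def nearly_invariant_def)
next
  fix e assume e: "e \<in> darts B"
  let ?I = "\<lambda>b. inner_section (double_cover B) \<sigma>' U (e, b)"
  show "(?I True, ?I False) \<in> near_pairs (fiber_section U (tl B e, True), fiber_section U (tl B e, False))"
    using inv e by (auto simp: near_pairs_def nearly_invariant_def)
  have "\<sigma>' (e, b) ` ?I b = inner_section (double_cover B) \<sigma>' U (rev B e, \<not> b)" for b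
    using inner_section_rev[OF wf_graph_double_cover[OF wf] compatible_perms_double_cover[OF lift_assignments_compatible[OF \<sigma>]], of "(e, b)" U] e
    by (simp add: \<sigma>'_def)
  from this[of True] this[of False]
  show "maps_pair True (?I True, ?I False)
     (inner_section (double_cover B) \<sigma>' U (rev B e, True), inner_section (double_cover B) \<sigma>' U (rev B e, False)) (\<sigma> e)"
    by (simp add: maps_pair_def \<sigma>'_def)
qed

text \<open>Component sizes are controlled in the lift of \<open>B\<close>, not in the lift of its
  double cover. The projection of a closed set is closed, hence contains a component, and projecting
  does not increase the cardinality.\<close>

lemma closed_set_card_ge_double_cover:
  assumes comp: "\<forall>x\<in>verts (lift B n \<sigma>). r \<le> card (component (lift B n \<sigma>) x)" and fin: "finite (verts B)"
    and U: "U \<subseteq> verts (lift (double_cover B) n (\<lambda>e. \<sigma> (fst e)))" "U \<noteq> {}"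
      "boundary (lift (double_cover B) n (\<lambda>e. \<sigma> (fst e))) U = {}"
  shows "r \<le> card U"
proof -
  let ?p = "\<lambda>x :: ('a \<times> bool) \<times> nat. (fst (fst x), snd x)"
  let ?D = "lift (double_cover B) n (\<lambda>e. \<sigma> (fst e))"
  have finU: "finite U" using U(1) by (rule finite_subset) (use fin in simp)
  have bd: "boundary (lift B n \<sigma>) (?p ` U) = {}"
  proof (rule equals0I)
    fix e assume "e \<in> boundary (lift B n \<sigma>) (?p ` U)"
    then obtain a i where e: "e = (a, i)" "a \<in> darts B" "i < n" "(tl B a, i) \<in> ?p ` U" "(hd B a, \<sigma> a i) \<notin> ?p ` U"
      by (auto simp: boundary_def)
    then obtain b where b: "((tl B a, b), i) \<in> U" by auto
    hence "((a, b), i) \<notin> boundary ?D U" using U(3) by simp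
    hence "((hd B a, \<not> b), \<sigma> a i) \<in> U" using b e by (auto simp: boundary_def)
    hence "(hd B a, \<sigma> a i) \<in> ?p ` U" by (rule rev_image_eqI) simp
    thus False using e(5) by simp
  qed
  obtain x where x: "x \<in> U" using U(2) by auto
  have "?p x \<in> verts (lift B n \<sigma>)" using U(1) x by auto
  hence "r \<le> card (component (lift B n \<sigma>) (?p x))" using comp by blast
  also have "\<dots> \<le> card (?p ` U)" using component_subset_closed[OF bd] x finU by (intro card_mono) auto
  also have "\<dots> \<le> card U" by (rule card_image_le[OF finU])
  finally show ?thesis .
qed

section \<open>Assembling the probability bound\<close>

lemma bipartite_lift:
  assumes S: "\<forall>e\<in>darts B. tl B e \<in> S \<longleftrightarrow> hd B e \<notin> S" and e: "e \<in> darts (lift B n \<sigma>)"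
  shows "tl (lift B n \<sigma>) e \<in> S \<times> UNIV \<longleftrightarrow> hd (lift B n \<sigma>) e \<notin> S \<times> UNIV"
  using assms by auto

lemma prob_lift_le:
  assumes wf: "wf_graph B"
    and sub: "\<And>\<sigma>. \<sigma> \<in> lift_assignments B n \<Longrightarrow> P (lift B n \<sigma>) \<Longrightarrow> \<sigma> \<in> X"
    and X: "real (card X) \<le> c * real (card (lift_assignments B n))" "finite X" and c: "c \<ge> 0"
  shows "prob_lift B n P \<le> c"
proof -
  have "card {\<sigma> \<in> lift_assignments B n. P (lift B n \<sigma>)} \<le> card X" using sub by (intro card_mono X) auto
  hence "real (card {\<sigma> \<in> lift_assignments B n. P (lift B n \<sigma>)}) \<le> c * real (card (lift_assignments B n))"
    using X(1) by linarith
  \<comment> \<open>If there are no assignments, the quotient is \<open>0 / 0 = 0\<close>.\<close>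
  thus ?thesis using c by (cases "card (lift_assignments B n) = 0") (auto simp: prob_lift_def divide_simps)
qed

theorem theorem3p2:
  fixes B :: "('v, 'e) mgraph" and d :: nat
  assumes "wf_graph B" and "connected_graph B" and "regular B d" and "d \<ge> 3"
  shows "\<forall>j::nat. j > 0 \<longrightarrow> (\<exists>\<epsilon>::real > 0. \<exists>C::real > 0. \<exists>r::nat.
     (\<not> bipartite B \<longrightarrow> (\<forall>n::nat. n \<ge> 1 \<longrightarrow>
        prob_lift B n (\<lambda>G. (\<forall>x \<in> verts G. card (component G x) \<ge> r) \<and>
           (\<exists>i. 1 \<le> i \<and> i < length (eigs G) \<and> \<bar>eigs G ! i\<bar> \<ge> real d - \<epsilon>))
        \<le> C / real n ^ j)) \<and>
     (bipartite B \<longrightarrow> (\<forall>n::nat. n \<ge> 1 \<longrightarrow>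
        prob_lift B n (\<lambda>G. (\<forall>x \<in> verts G. card (component G x) \<ge> r) \<and>
           (\<exists>i. 1 \<le> i \<and> i + 1 < length (eigs G) \<and> \<bar>eigs G ! i\<bar> \<ge> real d - \<epsilon>))
        \<le> C / real n ^ j)))"
proof (intro allI impI, goal_cases)
  case (1 j)
  note wf = assms(1) and conn = assms(2) and reg = assms(3) and d = assms(4)
  have fin: "finite (verts B)" using wf by (simp add: wf_graph_def)
  have d0: "d > 0" using d by simp
  obtain k0 C where k0: "k0 \<ge> 1" and C: "C > 0"
    and le: "\<And>n sw. n \<ge> 1 \<Longrightarrow> real (card (structured_assignments B n k0 sw)) \<le> C / real n ^ j * real (card (lift_assignments B n))"
    using card_structured_assignments[OF wf conn reg d, of j] by metis
  obtain \<gamma>1 r1 where \<gamma>1: "\<gamma>1 > 0" "sparse_sets_nearly_invariant B k0 \<gamma>1 r1"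
    using connected_sparse_sets_nearly_invariant[OF wf conn k0] by blast
  \<comment> \<open>For bipartite \<open>B\<close> the double cover is disconnected; the implication
    is then vacuous and 1 is a dummy value.\<close>
  have "\<exists>\<gamma>2>0. \<exists>r2. \<not> bipartite B \<longrightarrow> sparse_sets_nearly_invariant (double_cover B) k0 \<gamma>2 r2"
  proof (cases "bipartite B")
    case True
    thus ?thesis by (intro exI[of _ 1]) simp
  next
    case False
    from connected_sparse_sets_nearly_invariant[OF wf_graph_double_cover[OF wf] connected_graph_double_cover[OF wf conn this] k0]
    show ?thesis by blast
  qed
  then obtain \<gamma>2 r2 where \<gamma>2: "\<gamma>2 > 0" "\<not> bipartite B \<Longrightarrow> sparse_sets_nearly_invariant (double_cover B) k0 \<gamma>2 r2"
    by blast
  define \<gamma> where "\<gamma> = min \<gamma>1 \<gamma>2"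
  define r where "r = max r1 r2"
  \<comment> \<open>Half of the critical value, so that
    \<open>8 * d * \<epsilon> = \<gamma> ^ 2 / 2\<close> is strictly below
    \<open>\<gamma> ^ 2\<close>.\<close>
  define \<epsilon> where "\<epsilon> = \<gamma>\<^sup>2 / (16 * real d)"
  have \<gamma>: "\<gamma> > 0" "\<gamma> \<ge> 0" using \<gamma>1 \<gamma>2 by (auto simp: \<gamma>_def)
  have \<epsilon>: "\<epsilon> > 0" "\<epsilon> \<ge> 0" using \<gamma> d0 by (auto simp: \<epsilon>_def)
  have "8 * real d * \<epsilon> = \<gamma>\<^sup>2 / 2" using d0 by (simp add: \<epsilon>_def)
  moreover have "\<gamma>\<^sup>2 > 0" using \<gamma> by simp
  ultimately have \<gamma>\<epsilon>: "8 * real d * \<epsilon> < \<gamma>\<^sup>2" by linarith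
  have finS: "finite (structured_assignments B n k0 sw)" for n sw
    by (rule finite_subset[OF _ finite_lift_assignments[OF wf, of n]]) (auto simp: structured_assignments_def)
  have top: "\<sigma> \<in> structured_assignments B n k0 False"
    if \<sigma>: "\<sigma> \<in> lift_assignments B n" and comp: "\<forall>x\<in>verts (lift B n \<sigma>). r \<le> card (component (lift B n \<sigma>) x)"
      and f: "\<mu> \<ge> real d - \<epsilon>" "eigenfunction (lift B n \<sigma>) \<mu> f" "\<exists>v\<in>verts (lift B n \<sigma>). f v \<noteq> 0" "(\<Sum>v\<in>verts (lift B n \<sigma>). f v) = 0"
    for \<sigma> n \<mu> f
  proof -
    let ?G = "lift B n \<sigma>"
    note c = lift_assignments_compatible[OF \<sigma>]
    from small_boundary_from_top_eigenfunction[OF wf_graph_lift[OF wf c] regular_lift[OF reg] f(2-4) f(1) \<gamma>(2) \<gamma>\<epsilon>]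
    obtain U where U: "U \<subseteq> verts ?G" "U \<noteq> {}" "2 * card U \<le> card (verts ?G)" "real (card (boundary ?G U)) \<le> \<gamma> * real (card U)" by blast
    have "r1 \<le> card U" if "boundary ?G U = {}"
    proof -
      obtain x where x: "x \<in> U" using U(2) by auto
      have finU: "finite U" using U(1) by (rule finite_subset) (use fin in simp)
      have "r \<le> card (component ?G x)" using comp U(1) x by blast
      also have "\<dots> \<le> card U" using component_subset_closed[OF that x] finU by (rule card_mono[rotated])
      finally show ?thesis by (simp add: r_def)
    qed
    from sparse_sets_nearly_invariantD[OF \<gamma>1(2) c U _ this] show ?thesis
      using top_eigenfunction_structured[OF wf \<sigma> U(1)] by (simp add: \<gamma>_def)
  qed
  have bottom: "\<sigma> \<in> structured_assignments B n k0 True"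
    if nb: "\<not> bipartite B" and \<sigma>: "\<sigma> \<in> lift_assignments B n" and comp: "\<forall>x\<in>verts (lift B n \<sigma>). r \<le> card (component (lift B n \<sigma>) x)"
      and f: "- \<mu> \<ge> real d - \<epsilon>" "eigenfunction (lift B n \<sigma>) \<mu> f" "\<exists>v\<in>verts (lift B n \<sigma>). f v \<noteq> 0"
    for \<sigma> n \<mu> f
  proof -
    let ?D = "lift (double_cover B) n (\<lambda>e. \<sigma> (fst e))"
    note c = lift_assignments_compatible[OF \<sigma>]
    from small_boundary_from_bottom_eigenfunction[OF wf reg c f(2,3) f(1) \<gamma>(2) \<gamma>\<epsilon>]
    obtain U where U: "U \<subseteq> verts ?D" "U \<noteq> {}" "2 * card U \<le> card (verts ?D)" "real (card (boundary ?D U)) \<le> \<gamma> * real (card U)"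
      and disj: "\<forall>v i. \<not> (((v, True), i) \<in> U \<and> ((v, False), i) \<in> U)" by blast
    have "r2 \<le> card U" if "boundary ?D U = {}"
      using closed_set_card_ge_double_cover[OF comp fin U(1,2) that] by (simp add: r_def)
    from sparse_sets_nearly_invariantD[OF \<gamma>2(2)[OF nb] compatible_perms_double_cover[OF c] U _ this] show ?thesis
      using bottom_eigenfunction_structured[OF wf \<sigma> U(1) disj] by (simp add: \<gamma>_def)
  qed
  have lift: "wf_graph (lift B n \<sigma>)" "verts (lift B n \<sigma>) \<noteq> {}" if "\<sigma> \<in> lift_assignments B n" "n \<ge> 1" for n \<sigma>
  proof -
    show "wf_graph (lift B n \<sigma>)" by (rule wf_graph_lift[OF wf lift_assignments_compatible[OF that(1)]])
    have "verts B \<noteq> {}" using conn by (simp add: connected_graph_def)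
    moreover have "0 \<in> {..<n}" using that(2) by simp
    ultimately show "verts (lift B n \<sigma>) \<noteq> {}" by fastforce
  qed
  \<comment> \<open>The factor 2 covers the two kinds of structured assignments that occur when
    \<open>B\<close> is not bipartite.\<close>
  have C0: "2 * C > 0" using C by simp
  have C2: "2 * C / real n ^ j \<ge> 0" for n using C by simp
  show ?case
  proof (rule exI[of _ \<epsilon>], rule conjI[OF \<epsilon>(1)], rule exI[of _ "2 * C"], rule conjI[OF C0], rule exI[of _ r],
      intro conjI impI allI, goal_cases)
    case nb: (1 n)
    let ?X = "structured_assignments B n k0 False \<union> structured_assignments B n k0 True"
    have "card ?X \<le> card (structured_assignments B n k0 False) + card (structured_assignments B n k0 True)"
      by (rule card_Un_le)
    hence X: "real (card ?X) \<le> 2 * C / real n ^ j * real (card (lift_assignments B n))"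
      using le[OF nb(2), of False] le[OF nb(2), of True] by linarith
    show ?case
    proof (rule prob_lift_le[OF wf _ X _ C2], elim conjE exE, goal_cases)
      case G: (1 \<sigma> i)
      let ?G = "lift B n \<sigma>"
      obtain \<mu> f where f: "\<bar>\<mu>\<bar> \<ge> real d - \<epsilon>" "eigenfunction ?G \<mu> f" "\<exists>v\<in>verts ?G. f v \<noteq> 0" "(\<Sum>v\<in>verts ?G. f v) = 0"
        using nontrivial_eigenfunction[OF lift(1)[OF G(1) nb(2)] regular_lift[OF reg] lift(2)[OF G(1) nb(2)] G(3-5) \<epsilon>(2)] by blast
      show ?case
      proof (cases "\<mu> \<ge> real d - \<epsilon>")
        case True thus ?thesis using top[OF G(1,2) True f(2-4)] by blast
      next
        case False
        hence "- \<mu> \<ge> real d - \<epsilon>" using f(1) by linarith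
        thus ?thesis using bottom[OF nb(1) G(1,2) _ f(2,3)] by blast
      qed
    qed (use finS in simp)
  next
    case bip: (2 n)
    let ?X = "structured_assignments B n k0 False"
    have "C / real n ^ j * real (card (lift_assignments B n)) \<le> 2 * C / real n ^ j * real (card (lift_assignments B n))"
      using C by (intro mult_right_mono divide_right_mono) auto
    hence X: "real (card ?X) \<le> 2 * C / real n ^ j * real (card (lift_assignments B n))"
      using le[OF bip(2), of False] by linarith
    obtain S where S: "\<forall>e\<in>darts B. tl B e \<in> S \<longleftrightarrow> hd B e \<notin> S" using bip(1) by (auto simp: bipartite_def)
    show ?case
    proof (rule prob_lift_le[OF wf _ X finS C2], elim conjE exE, goal_cases)
      case G: (1 \<sigma> i)
      let ?G = "lift B n \<sigma>"
      obtain \<mu> f where f: "\<mu> \<ge> real d - \<epsilon>" "eigenfunction ?G \<mu> f" "\<exists>v\<in>verts ?G. f v \<noteq> 0" "(\<Sum>v\<in>verts ?G. f v) = 0"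
        using nontrivial_eigenfunction_bipartite[OF lift(1)[OF G(1) bip(2)] regular_lift[OF reg] lift(2)[OF G(1) bip(2)] d0
            bipartite_lift[OF S] G(3-5) \<epsilon>(2)] by blast
      show ?case by (rule top[OF G(1,2) f])
    qed
  qed
qed

end
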